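(* Consider a tetrahedron $\Delta(v_0v_1v_2v_3)$ in Minkowski spacetime $\mathbb{R}^{1,2}$ with no null edges and no null triangular faces. The causal structure of $\Delta(v_0v_1v_2v_3)$ relative to the reference vertex $v_0$ is uniquely determined by the causal positions of the vertices $(v_1,v_2,v_3)$ relative to the two lightcones at $v_0$ and the intersection of the lightcones at $v_0$ with the opposite triangle $\Delta(v_1v_2v_3)$. There are exactly $13$ distinct vertex causal types of Lorentzian tetrahedra under these conditions.
   Context: $\mathbb{R}^{1,2}$ is $\mathbb{R}^3$ with the inner product $\langle x,y\rangle=\eta_{\mu\nu}x^\mu y^\nu$, $\eta=\mathrm{diag}(-1,1,1)$. A tetrahedron is the convex hull of four affinely independent points of $\mathbb{R}^{1,2}$. An edge is null if its squared length vanishes; a triangular face is null if its squared area vanishes. $e(v_iv_j)$ denotes the edge joining $v_i$ and $v_j$. A point $x\neq v_0$ is timelike, spacelike or null (lightlike) relative to $v_0$ if $\langle x-v_0,x-v_0\rangle$ is negative, positive or zero, respectively. Causal structure: for $\sigma=\Delta(v_0v_1v_2v_3)$, the causal structure of $\sigma$ relative to $v_0$ is the partition of $\sigma$ induced by the two null hypersurfaces (the future and past lightcones at $v_0$) $$\mathcal{N}^\pm(v_0)=\{x\in\sigma : \eta_{\mu\nu}(x-v_0)^\mu(x-v_0)^\nu=0,\ \pm(x^0-v_0^0)>0\}.$$ The intersection of $\mathcal{N}^\pm(v_0)$ with the interior and boundary of $\sigma$ determines the causal character (spacelike, timelike or null) of regions within $\sigma$ relative to $v_0$. Two simplices are said to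 have the same causal type at a vertex $v_0$ if their lightcone intersection patterns are topologically equivalent. The 13 types in the classification summarized by the statement are the following. Labels of vertices are representative, "timelike"/"spacelike" is relative to $v_0$, and "lightcone" means one of the two lightcones at $v_0$, intersected with the opposite triangle $\Delta(v_1v_2v_3)$. A. All three of $v_1,v_2,v_3$ timelike. A1: all in the same (future or past) lightcone, and the triangle meets no lightcone. A2: two vertices in one timelike region and the third in the opposite one; the triangle meets both lightcones. B. $v_1,v_2$ timelike, $v_3$ spacelike. B1: $v_1,v_2$ in the same timelike region; $e(v_1v_3)$ and $e(v_2v_3)$ meet the same lightcone, and $e(v_1v_2)$ meets none. B2: $v_1,v_2$ in opposite timelike regions; $e(v_1v_2)$ meets both lightcones. C. $v_1$ timelike, $v_2,v_3$ spacelike; $e(v_1v_2)$ and $e(v_1v_3)$ meet the same lightcone. C1: $e(v_2v_3)$ meets no lightcone. C2: $e(v_2v_3)$ meets that same lightcone twice. C3: $e(v_2v_3)$ meets the other lightcone. D. All three vertices spacelike. D1: the triangle meets no lightcone. D2: the interior of the triangle meets exactly one lightcone, in a closed conic section, and its edges meet none. D3: exactly one edge meets one lightcone. D4: two edges meet the same lightcone and the third edge meets none. D5: all three edges meet the same lightcone. D6: two edges meet different lightcones (one the future, the other the past lightcone). *)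

theory Defs
  imports "HOL-Analysis.Analysis"
begin

(* Points of R^{1,2} are vectors of type real^3; the time coordinate x^0 is the component $ 1. *)

definition mink :: "real^3 \<Rightarrow> real^3 \<Rightarrow> real" where
  "mink x y = - (x $ 1 * y $ 1) + x $ 2 * y $ 2 + x $ 3 * y $ 3"

definition timelike_rel :: "real^3 \<Rightarrow> real^3 \<Rightarrow> bool" where
  "timelike_rel p x \<longleftrightarrow> x \<noteq> p \<and> mink (x - p) (x - p) < 0"

definition spacelike_rel :: "real^3 \<Rightarrow> real^3 \<Rightarrow> bool" where
  "spacelike_rel p x \<longleftrightarrow> x \<noteq> p \<and> mink (x - p) (x - p) > 0"

definition null_rel :: "real^3 \<Rightarrow> real^3 \<Rightarrow> bool" where
  "null_rel p x \<longleftrightarrow> x \<noteq> p \<and> mink (x - p) (x - p) = 0"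

(* A sign e = 1 stands for the future of p and e = - 1 for the past of p. *)

abbreviation signs :: "real set" where
  "signs \<equiv> {1, - 1}"

definition lightcone :: "real \<Rightarrow> real^3 \<Rightarrow> (real^3) set" where
  "lightcone e p = {x. null_rel p x \<and> e * (x $ 1 - p $ 1) > 0}"

definition timecone :: "real \<Rightarrow> real^3 \<Rightarrow> (real^3) set" where
  "timecone e p = {x. timelike_rel p x \<and> e * (x $ 1 - p $ 1) > 0}"

definition spacelike_region :: "real^3 \<Rightarrow> (real^3) set" where
  "spacelike_region p = {x. spacelike_rel p x}"

(* A tetrahedron is given by its labelled vertices v 0, v 1, v 2, v 3 (the numeral type 4
   has exactly the elements 0, 1, 2, 3); v 0 is the reference vertex. *)

type_synonym vertices = "4 \<Rightarrow> real^3"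

definition tetrahedron :: "vertices \<Rightarrow> bool" where
  "tetrahedron v \<longleftrightarrow> inj v \<and> \<not> affine_dependent (range v)"

definition face :: "vertices \<Rightarrow> 4 set \<Rightarrow> (real^3) set" where
  "face v J = convex hull (v ` J)"

abbreviation solid :: "vertices \<Rightarrow> (real^3) set" where
  "solid v \<equiv> face v UNIV"

abbreviation opposite :: "vertices \<Rightarrow> (real^3) set" where
  "opposite v \<equiv> face v {1, 2, 3}"

definition sq_length :: "real^3 \<Rightarrow> real^3 \<Rightarrow> real" where
  "sq_length a b = mink (b - a) (b - a)"

(* Squared area of the triangle a b c, as a quarter of the Gram determinant of two of its
   edge vectors; it is negative for triangles in timelike planes. *)

definition sq_area :: "real^3 \<Rightarrow> real^3 \<Rightarrow> real^3 \<Rightarrow> real" where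
  "sq_area a b c =
     (mink (b - a) (b - a) * mink (c - a) (c - a) - (mink (b - a) (c - a))\<^sup>2) / 4"

definition no_null_edges :: "vertices \<Rightarrow> bool" where
  "no_null_edges v \<longleftrightarrow> (\<forall>i j. i \<noteq> j \<longrightarrow> sq_length (v i) (v j) \<noteq> 0)"

definition no_null_faces :: "vertices \<Rightarrow> bool" where
  "no_null_faces v \<longleftrightarrow>
     (\<forall>i j k. i \<noteq> j \<and> j \<noteq> k \<and> i \<noteq> k \<longrightarrow> sq_area (v i) (v j) (v k) \<noteq> 0)"

definition admissible :: "vertices \<Rightarrow> bool" where
  "admissible v \<longleftrightarrow> tetrahedron v \<and> no_null_edges v \<and> no_null_faces v"

(* Topological equivalence of the causal structures relative to v 0 and w 0: a homeomorphism of
   the tetrahedra that carries faces to faces, relabelling the vertices by p, and carries each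
   part of the partition cut out by the lightcones to the corresponding part.
   The sign s = - 1 allows for exchanging future and past. *)

definition same_structure :: "(4 \<Rightarrow> 4) \<Rightarrow> real \<Rightarrow> vertices \<Rightarrow> vertices \<Rightarrow> bool" where
  "same_structure p s v w \<longleftrightarrow>
     (\<exists>h h'. homeomorphism (solid v) (solid w) h h' \<and>
        (\<forall>J. h ` face v J = face w (p ` J)) \<and>
        (\<forall>e\<in>signs. h ` (lightcone e (v 0) \<inter> solid v) = lightcone (s * e) (w 0) \<inter> solid w) \<and>
        (\<forall>e\<in>signs. h ` (timecone e (v 0) \<inter> solid v) = timecone (s * e) (w 0) \<inter> solid w) \<and>
        h ` (spacelike_region (v 0) \<inter> solid v) = spacelike_region (w 0) \<inter> solid w)"

definition relabelling :: "(4 \<Rightarrow> 4) \<Rightarrow> bool" where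
  "relabelling p \<longleftrightarrow> bij p \<and> p 0 = 0"

definition same_causal_type :: "vertices \<Rightarrow> vertices \<Rightarrow> bool" where
  "same_causal_type v w \<longleftrightarrow> (\<exists>p s. relabelling p \<and> s \<in> signs \<and> same_structure p s v w)"

definition causal_type_rel :: "(vertices \<times> vertices) set" where
  "causal_type_rel = {(v, w). admissible v \<and> admissible w \<and> same_causal_type v w}"

definition same_vertex_positions :: "(4 \<Rightarrow> 4) \<Rightarrow> real \<Rightarrow> vertices \<Rightarrow> vertices \<Rightarrow> bool" where
  "same_vertex_positions p s v w \<longleftrightarrow>
     (\<forall>i\<in>{1, 2, 3}.
        (\<forall>e\<in>signs. v i \<in> timecone e (v 0) \<longleftrightarrow> w (p i) \<in> timecone (s * e) (w 0)) \<and>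
        (v i \<in> spacelike_region (v 0) \<longleftrightarrow> w (p i) \<in> spacelike_region (w 0)))"

(* Topological equivalence of the intersections of the lightcones with the opposite triangles;
   nothing is required of the timelike and spacelike regions of the triangles. *)

definition same_opposite_intersection :: "(4 \<Rightarrow> 4) \<Rightarrow> real \<Rightarrow> vertices \<Rightarrow> vertices \<Rightarrow> bool" where
  "same_opposite_intersection p s v w \<longleftrightarrow>
     (\<exists>g g'. homeomorphism (opposite v) (opposite w) g g' \<and>
        (\<forall>J. J \<subseteq> {1, 2, 3} \<longrightarrow> g ` face v J = face w (p ` J)) \<and>
        (\<forall>e\<in>signs. g ` (lightcone e (v 0) \<inter> opposite v) = lightcone (s * e) (w 0) \<inter> opposite w))"

definition meets :: "vertices \<Rightarrow> real \<Rightarrow> 4 set \<Rightarrow> bool" where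
  "meets v e J \<longleftrightarrow> lightcone e (v 0) \<inter> face v J \<noteq> {}"

definition meets_none :: "vertices \<Rightarrow> 4 set \<Rightarrow> bool" where
  "meets_none v J \<longleftrightarrow> (\<forall>e\<in>signs. \<not> meets v e J)"

definition timelike_vertex :: "vertices \<Rightarrow> real \<Rightarrow> 4 \<Rightarrow> bool" where
  "timelike_vertex v e i \<longleftrightarrow> v i \<in> timecone e (v 0)"

definition spacelike_vertex :: "vertices \<Rightarrow> 4 \<Rightarrow> bool" where
  "spacelike_vertex v i \<longleftrightarrow> v i \<in> spacelike_region (v 0)"

(* A plane that misses v 0 cuts the lightcones in a conic section. The section is a closed curve
   (an ellipse) iff it is compact; here the whole of it must lie inside the triangle. *)

definition closed_conic_inside :: "vertices \<Rightarrow> real \<Rightarrow> bool" where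
  "closed_conic_inside v e \<longleftrightarrow>
     (let C = lightcone e (v 0) \<inter> affine hull (opposite v)
      in C \<noteq> {} \<and> compact C \<and> C \<subseteq> rel_interior (opposite v))"

datatype causal_type = A1 | A2 | B1 | B2 | C1 | C2 | C3 | D1 | D2 | D3 | D4 | D5 | D6

fun representative :: "causal_type \<Rightarrow> vertices \<Rightarrow> bool" where
  "representative A1 v \<longleftrightarrow>
     (\<exists>e\<in>signs. timelike_vertex v e 1 \<and> timelike_vertex v e 2 \<and> timelike_vertex v e 3) \<and>
     meets_none v {1, 2, 3}"
| "representative A2 v \<longleftrightarrow>
     (\<exists>e\<in>signs. timelike_vertex v e 1 \<and> timelike_vertex v e 2 \<and> timelike_vertex v (- e) 3) \<and>
     (\<forall>e\<in>signs. meets v e {1, 2, 3})"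
| "representative B1 v \<longleftrightarrow>
     (\<exists>e\<in>signs. timelike_vertex v e 1 \<and> timelike_vertex v e 2) \<and> spacelike_vertex v 3 \<and>
     (\<exists>e\<in>signs. meets v e {1, 3} \<and> meets v e {2, 3}) \<and> meets_none v {1, 2}"
| "representative B2 v \<longleftrightarrow>
     (\<exists>e\<in>signs. timelike_vertex v e 1 \<and> timelike_vertex v (- e) 2) \<and> spacelike_vertex v 3 \<and>
     (\<forall>e\<in>signs. meets v e {1, 2})"
| "representative C1 v \<longleftrightarrow>
     (\<exists>e\<in>signs. timelike_vertex v e 1) \<and> spacelike_vertex v 2 \<and> spacelike_vertex v 3 \<and>
     (\<exists>e\<in>signs. meets v e {1, 2} \<and> meets v e {1, 3}) \<and> meets_none v {2, 3}"
| "representative C2 v \<longleftrightarrow>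
     (\<exists>e\<in>signs. timelike_vertex v e 1) \<and> spacelike_vertex v 2 \<and> spacelike_vertex v 3 \<and>
     (\<exists>e\<in>signs. meets v e {1, 2} \<and> meets v e {1, 3} \<and>
        card (lightcone e (v 0) \<inter> face v {2, 3}) = 2)"
| "representative C3 v \<longleftrightarrow>
     (\<exists>e\<in>signs. timelike_vertex v e 1) \<and> spacelike_vertex v 2 \<and> spacelike_vertex v 3 \<and>
     (\<exists>e\<in>signs. meets v e {1, 2} \<and> meets v e {1, 3} \<and> meets v (- e) {2, 3})"
| "representative D1 v \<longleftrightarrow>
     spacelike_vertex v 1 \<and> spacelike_vertex v 2 \<and> spacelike_vertex v 3 \<and>
     meets_none v {1, 2, 3}"
| "representative D2 v \<longleftrightarrow>
     spacelike_vertex v 1 \<and> spacelike_vertex v 2 \<and> spacelike_vertex v 3 \<and>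
     (\<exists>e\<in>signs. closed_conic_inside v e \<and>
        lightcone (- e) (v 0) \<inter> rel_interior (opposite v) = {}) \<and>
     meets_none v {1, 2} \<and> meets_none v {1, 3} \<and> meets_none v {2, 3}"
| "representative D3 v \<longleftrightarrow>
     spacelike_vertex v 1 \<and> spacelike_vertex v 2 \<and> spacelike_vertex v 3 \<and>
     (\<exists>e\<in>signs. meets v e {1, 2} \<and> \<not> meets v (- e) {1, 2}) \<and>
     meets_none v {1, 3} \<and> meets_none v {2, 3}"
| "representative D4 v \<longleftrightarrow>
     spacelike_vertex v 1 \<and> spacelike_vertex v 2 \<and> spacelike_vertex v 3 \<and>
     (\<exists>e\<in>signs. meets v e {1, 2} \<and> meets v e {1, 3}) \<and> meets_none v {2, 3}"
| "representative D5 v \<longleftrightarrow>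
     spacelike_vertex v 1 \<and> spacelike_vertex v 2 \<and> spacelike_vertex v 3 \<and>
     (\<exists>e\<in>signs. meets v e {1, 2} \<and> meets v e {1, 3} \<and> meets v e {2, 3})"
| "representative D6 v \<longleftrightarrow>
     spacelike_vertex v 1 \<and> spacelike_vertex v 2 \<and> spacelike_vertex v 3 \<and>
     (\<exists>e\<in>signs. meets v e {1, 2} \<and> meets v (- e) {1, 3})"

definition has_type :: "causal_type \<Rightarrow> vertices \<Rightarrow> bool" where
  "has_type t v \<longleftrightarrow> (\<exists>p. relabelling p \<and> representative t (v \<circ> p))"

lemma same_structure_refl: "same_structure id 1 v v"
  unfolding same_structure_def
  by (rule exI[of _ id], rule exI[of _ id]) (simp add: homeomorphism_ident id_def)

lemma same_structure_sym:
  assumes "same_structure p s v w" "bij p" "s \<in> signs"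
  shows "same_structure (inv p) s w v"
proof -
  obtain h h' where hom: "homeomorphism (solid v) (solid w) h h'"
    and f: "\<forall>J. h ` face v J = face w (p ` J)"
    and l: "\<forall>e\<in>signs.
      h ` (lightcone e (v 0) \<inter> solid v) = lightcone (s * e) (w 0) \<inter> solid w"
    and t: "\<forall>e\<in>signs.
      h ` (timecone e (v 0) \<inter> solid v) = timecone (s * e) (w 0) \<inter> solid w"
    and sp: "h ` (spacelike_region (v 0) \<inter> solid v) = spacelike_region (w 0) \<inter> solid w"
    using assms(1) unfolding same_structure_def by (elim exE conjE)
  have preimage: "h' ` B = A" if sAB: "h ` A = B" and sA: "A \<subseteq> solid v" for A B
  proof -
    have "h' (h x) = x" if "x \<in> A" for x
      using that sA hom by (auto simp: homeomorphism_def)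
    then show ?thesis using sAB by force
  qed
  have sub: "face v J \<subseteq> solid v" for J
    unfolding face_def by (intro hull_mono image_mono subset_UNIV)
  have f': "h' ` face w J = face v (inv p ` J)" for J
  proof (rule preimage)
    show "h ` face v (inv p ` J) = face w J"
      using f[rule_format, of "inv p ` J"] \<open>bij p\<close> by (simp add: image_image bij_is_surj surj_f_inv_f)
  qed (rule sub)
  have ss: "s * e \<in> signs" "s * (s * e) = e" if "e \<in> signs" for e
    using that assms(3) by auto
  show ?thesis
    unfolding same_structure_def
  proof (intro exI conjI allI ballI)
    show "homeomorphism (solid w) (solid v) h' h"
      using hom by (simp add: homeomorphism_symD)
    fix e assume e: "e \<in> signs"
    show "h' ` (lightcone e (w 0) \<inter> solid w) = lightcone (s * e) (v 0) \<inter> solid v"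
      using bspec[OF l ss(1)[OF e]] by (intro preimage) (simp_all add: ss(2)[OF e])
    show "h' ` (timecone e (w 0) \<inter> solid w) = timecone (s * e) (v 0) \<inter> solid v"
      using bspec[OF t ss(1)[OF e]] by (intro preimage) (simp_all add: ss(2)[OF e])
  next
    show "h' ` (spacelike_region (w 0) \<inter> solid w) = spacelike_region (v 0) \<inter> solid v"
      by (rule preimage[OF sp]) simp
  qed (rule f')
qed

lemma same_structure_trans:
  assumes "same_structure p s u v" "same_structure q r v w" "s \<in> signs" "r \<in> signs"
  shows "same_structure (q \<circ> p) (r * s) u w"
proof -
  obtain h h' where h: "homeomorphism (solid u) (solid v) h h'"
    "\<forall>J. h ` face u J = face v (p ` J)"
    "\<forall>e\<in>signs.
      h ` (lightcone e (u 0) \<inter> solid u) = lightcone (s * e) (v 0) \<inter> solid v"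
    "\<forall>e\<in>signs.
      h ` (timecone e (u 0) \<inter> solid u) = timecone (s * e) (v 0) \<inter> solid v"
    "h ` (spacelike_region (u 0) \<inter> solid u) = spacelike_region (v 0) \<inter> solid v"
    using assms(1) unfolding same_structure_def by (elim exE conjE)
  obtain k k' where k: "homeomorphism (solid v) (solid w) k k'"
    "\<forall>J. k ` face v J = face w (q ` J)"
    "\<forall>e\<in>signs.
      k ` (lightcone e (v 0) \<inter> solid v) = lightcone (r * e) (w 0) \<inter> solid w"
    "\<forall>e\<in>signs.
      k ` (timecone e (v 0) \<inter> solid v) = timecone (r * e) (w 0) \<inter> solid w"
    "k ` (spacelike_region (v 0) \<inter> solid v) = spacelike_region (w 0) \<inter> solid w"
    using assms(2) unfolding same_structure_def by (elim exE conjE)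
  have ss: "s * e \<in> signs" if "e \<in> signs" for e
    using that assms(3) by auto
  show ?thesis
    unfolding same_structure_def
  proof (intro exI conjI allI ballI)
    show "homeomorphism (solid u) (solid w) (k \<circ> h) (h' \<circ> k')"
      by (rule homeomorphism_compose[OF h(1) k(1)])
    show "(k \<circ> h) ` face u J = face w ((q \<circ> p) ` J)" for J
      by (simp only: image_comp[symmetric] h(2)[rule_format] k(2)[rule_format])
    fix e assume e: "e \<in> signs"
    show "(k \<circ> h) ` (lightcone e (u 0) \<inter> solid u) = lightcone (r * s * e) (w 0) \<inter> solid w"
      by (simp only: image_comp[symmetric] bspec[OF h(3) e] bspec[OF k(3) ss[OF e]] mult.assoc)
    show "(k \<circ> h) ` (timecone e (u 0) \<inter> solid u) = timecone (r * s * e) (w 0) \<inter> solid w"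
      by (simp only: image_comp[symmetric] bspec[OF h(4) e] bspec[OF k(4) ss[OF e]] mult.assoc)
  next
    show "(k \<circ> h) ` (spacelike_region (u 0) \<inter> solid u) = spacelike_region (w 0) \<inter> solid w"
      by (simp only: image_comp[symmetric] h(5) k(5))
  qed
qed

lemma equiv_causal_type_rel: "equiv {v. admissible v} causal_type_rel"
proof (rule equivI)
  show "causal_type_rel \<subseteq> {v. admissible v} \<times> {v. admissible v}"
    by (auto simp: causal_type_rel_def)
  have "same_causal_type v v" for v
    unfolding same_causal_type_def
    by (rule exI[of _ id], rule exI[of _ 1]) (simp add: relabelling_def same_structure_refl)
  then show "refl_on {v. admissible v} causal_type_rel"
    by (simp add: refl_on_def causal_type_rel_def)
  show "sym causal_type_rel"
  proof (rule symI)
    fix v w assume "(v, w) \<in> causal_type_rel"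
    then obtain p s where *: "admissible v" "admissible w" "relabelling p"
      "s \<in> signs" "same_structure p s v w"
      unfolding causal_type_rel_def same_causal_type_def by blast
    have "bij p" "p 0 = 0" using *(3) by (simp_all add: relabelling_def)
    then have "relabelling (inv p)"
      unfolding relabelling_def by (metis bij_imp_bij_inv bij_inv_eq_iff)
    moreover have "same_structure (inv p) s w v"
      by (rule same_structure_sym[OF *(5) \<open>bij p\<close> *(4)])
    ultimately have "same_causal_type w v"
      using *(4) unfolding same_causal_type_def by (intro exI conjI)
    with * show "(w, v) \<in> causal_type_rel"
      by (simp add: causal_type_rel_def)
  qed
  show "trans causal_type_rel"
  proof (rule transI)
    fix u v w assume "(u, v) \<in> causal_type_rel" "(v, w) \<in> causal_type_rel"
    then obtain p s q r where *: "admissible u" "admissible w" "relabelling p" "relabelling q"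
      "s \<in> signs" "r \<in> signs" "same_structure p s u v" "same_structure q r v w"
      unfolding causal_type_rel_def same_causal_type_def by blast
    have "relabelling (q \<circ> p)"
      using *(3,4) by (simp add: relabelling_def bij_comp)
    moreover have "r * s \<in> signs"
      using *(5,6) by auto
    moreover have "same_structure (q \<circ> p) (r * s) u w"
      by (rule same_structure_trans[OF *(7,8,5,6)])
    ultimately have "same_causal_type u w"
      unfolding same_causal_type_def by (intro exI conjI)
    with *(1,2) show "(u, w) \<in> causal_type_rel"
      by (simp add: causal_type_rel_def)
  qed
qed

end

theory Submission
  imports Defs
begin

text \<open>Seen from \<open>v\<^sub>0\<close> a tetrahedron is a cone over its opposite face, and causal character is
  invariant under scaling. So everything happens in the orthant of coordinates with respect to the
  edge vectors at \<open>v\<^sub>0\<close>, and a causal equivalence is a homogeneous homeomorphism of the orthant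
  that preserves its faces and the five causal regions.

  If the orthant contains a future timelike vector, then it contains one, \<open>c\<close>, in its interior. Every
  line \<open>b + m c\<close> runs through the regions in the same causal order, with one past and one future
  crossing whose parameters are continuous in \<open>b\<close>. Hence a map of the boundary of the
  orthant that preserves the causal regions extends to the interior: stretch each ray
  \<open>b + m c\<close>, \<open>m \<ge> 0\<close>, piecewise linearly so that crossings go to crossings. On the boundary the same
  is done on each of the three edges of the opposite face, where the crossings are transversal
  because no face at \<open>v\<^sub>0\<close> is null.

  The causal structure is thus determined by the signs of the vertices, the signs of the edges with
  two spacelike ends, and, if there are no crossings on the boundary, the sign of a closed conic inside.
  One combination is impossible: if the future cone meets two edges and the past cone the third, then
  the common vertex of the first two is a positive combination of future timelike vectors. The
  remaining sign patterns form \<open>13\<close> classes under permutations and time reversal.\<close>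

subsection \<open>The causal rank of a vector\<close>

text \<open>The rank is a number because along a line in a timelike direction it is a sum of two
  signs, one for each crossing. Preserving the causal regions then means preserving two comparisons,
  and time reversal is multiplication by -1. The obstacle is continuity where pieces of the
  half-line shrink to nothing: both crossings merge at the apex, and a crossing may pass through the
  base point as that point moves. The stretching is therefore a sum of clipped increments times
  slopes, and on a bounded piece the increment never exceeds the length that the slope divides by.
  Homogeneity serves twice: it reduces the faces at the apex to edges, and it lets the finished map
  be rescaled so as to keep the coordinate sum, hence the tetrahedron. Inverses need no construction
  of their own, since exchanging the two frames gives a map of the same kind. Conversely, the signs
  can be read off from which cones meet which faces, so every equivalence preserves them. Together
  with one explicit tetrahedron of each type this makes the count exact.\<close>

text \<open>The rank encodes the five regions in their causal order: past timelike, past null,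
  spacelike (or zero), future null and future timelike vectors have ranks
  \<open>-2\<close>, \<open>-1\<close>, \<open>0\<close>, \<open>1\<close>, \<open>2\<close>.\<close>

definition causal_rank :: "real^3 \<Rightarrow> real" where
  "causal_rank x =
     (if mink x x > 0 then 0 else if mink x x = 0 then sgn (x $ 1) else 2 * sgn (x $ 1))"

section \<open>Algebra of the Minkowski form and of the rank\<close>

lemma vec3_eq_iff: "(x :: real^3) = y \<longleftrightarrow> x $ 1 = y $ 1 \<and> x $ 2 = y $ 2 \<and> x $ 3 = y $ 3"
  by (simp add: vec_eq_iff forall_3)

lemma mink_commute: "mink x y = mink y x"
  by (simp add: mink_def)

lemma mink_add: "mink (x + y) z = mink x z + mink y z" "mink z (x + y) = mink z x + mink z y"
  by (simp_all add: mink_def algebra_simps)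

lemma mink_diff: "mink (x - y) z = mink x z - mink y z" "mink z (x - y) = mink z x - mink z y"
  by (simp_all add: mink_def algebra_simps)

lemma mink_scale: "mink (t *\<^sub>R x) y = t * mink x y" "mink x (t *\<^sub>R y) = t * mink x y"
  by (simp_all add: mink_def algebra_simps)

lemma mink_minus: "mink (- x) y = - mink x y" "mink x (- y) = - mink x y"
  by (simp_all add: mink_def algebra_simps)

lemma mink_zero [simp]: "mink 0 y = 0" "mink x 0 = 0"
  by (simp_all add: mink_def)

text \<open>On vectors with vanishing time component the form is positive definite.\<close>

lemma time_component_nonzero:
  assumes "mink x x \<le> 0" "x \<noteq> 0"
  shows "x $ 1 \<noteq> 0"
proof
  assume z: "x $ 1 = 0"
  have "(x $ 2)\<^sup>2 + (x $ 3)\<^sup>2 \<le> 0"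
    using assms(1) z by (simp add: mink_def power2_eq_square)
  then have "x $ 2 = 0 \<and> x $ 3 = 0"
    by (simp add: sum_power2_le_zero_iff)
  with z assms(2) show False
    by (simp add: vec3_eq_iff)
qed

lemma causal_rank_zero [simp]: "causal_rank 0 = 0"
  by (simp add: causal_rank_def mink_def)

lemma causal_rank_uminus: "causal_rank (- x) = - causal_rank x"
  by (simp add: causal_rank_def mink_minus sgn_minus)

lemma causal_rank_scale: "t > 0 \<Longrightarrow> causal_rank (t *\<^sub>R x) = causal_rank x"
  by (simp add: causal_rank_def mink_scale sgn_mult zero_less_mult_iff mult_less_0_iff)

lemma causal_rank_cases:
  obtains "causal_rank x = - 2" | "causal_rank x = - 1" | "causal_rank x = 0"
    | "causal_rank x = 1" | "causal_rank x = 2"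
proof -
  have "sgn (x $ 1) = - 1 \<or> sgn (x $ 1) = 0 \<or> sgn (x $ 1) = 1"
    by (simp add: sgn_real_def)
  then show ?thesis
    using that unfolding causal_rank_def by (cases "mink x x > 0"; cases "mink x x = 0") auto
qed

lemma causal_rank_eq_0_iff: "causal_rank x = 0 \<longleftrightarrow> x = 0 \<or> mink x x > 0"
  using time_component_nonzero[of x]
  by (cases "x = 0") (auto simp: causal_rank_def sgn_real_def not_less)

lemma causal_rank_null_iff: "\<bar>causal_rank x\<bar> = 1 \<longleftrightarrow> mink x x = 0 \<and> x \<noteq> 0"
  using time_component_nonzero[of x]
  by (cases "x = 0") (auto simp: causal_rank_def sgn_real_def)

lemma causal_rank_eq_2_iff: "causal_rank x = 2 \<longleftrightarrow> mink x x < 0 \<and> x $ 1 > 0"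
  by (auto simp: causal_rank_def sgn_real_def split: if_splits)

lemma lightcone_iff: "e \<in> signs \<Longrightarrow> x \<in> lightcone e p \<longleftrightarrow> causal_rank (x - p) = e"
  by (auto simp: lightcone_def null_rel_def causal_rank_def sgn_real_def split: if_splits)

lemma timecone_iff: "e \<in> signs \<Longrightarrow> x \<in> timecone e p \<longleftrightarrow> causal_rank (x - p) = 2 * e"
  by (auto simp: timecone_def timelike_rel_def causal_rank_def sgn_real_def split: if_splits)

text \<open>The zero vector has rank 0 because \<open>sgn 0 = 0\<close>, so the rank alone cannot
  separate the apex from the spacelike points; the clause \<open>x \<noteq> p\<close> has to be
  carried along.\<close>

lemma spacelike_region_iff: "x \<in> spacelike_region p \<longleftrightarrow> x \<noteq> p \<and> causal_rank (x - p) = 0"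
  by (auto simp: spacelike_region_def spacelike_rel_def causal_rank_eq_0_iff)

section \<open>The reversed Cauchy-Schwarz inequality\<close>

lemma abs_spatial_product_less:
  fixes c1 c2 c3 y1 y2 y3 :: real
  assumes "c2\<^sup>2 + c3\<^sup>2 < c1\<^sup>2" "y2\<^sup>2 + y3\<^sup>2 \<le> y1\<^sup>2" "y1 \<noteq> 0"
  shows "\<bar>y2 * c2 + y3 * c3\<bar> < \<bar>y1 * c1\<bar>"
proof -
  \<comment> \<open>The Lagrange identity. The vector \<open>(y1, y2, y3)\<close> may be null, so
    strictness comes from \<open>(c1, c2, c3)\<close>, which is timelike.\<close>
  have "(y2 * c2 + y3 * c3)\<^sup>2 = (y2\<^sup>2 + y3\<^sup>2) * (c2\<^sup>2 + c3\<^sup>2) - (y2 * c3 - y3 * c2)\<^sup>2"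
    by algebra
  also have "\<dots> \<le> (y2\<^sup>2 + y3\<^sup>2) * (c2\<^sup>2 + c3\<^sup>2)"
    by simp
  also have "\<dots> \<le> y1\<^sup>2 * (c2\<^sup>2 + c3\<^sup>2)"
    using assms(2) by (intro mult_right_mono) simp_all
  also have "\<dots> < y1\<^sup>2 * c1\<^sup>2"
    using assms(1,3) by (intro mult_strict_left_mono) simp_all
  finally have "(y2 * c2 + y3 * c3)\<^sup>2 < (y1 * c1)\<^sup>2"
    by (simp add: power_mult_distrib)
  then show ?thesis
    by (meson abs_le_square_iff not_le)
qed

text \<open>In the product of a timelike vector with a causal one the time part outweighs the
  spatial part. Future and past are thus told apart by \<open>mink Y C\<close>, which, unlike a
  coordinate, can be expressed through the roots of the quadratic along a line.\<close>

lemma sgn_time_component: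
  assumes C: "mink C C < 0" "C $ 1 > 0" and Y: "mink Y Y \<le> 0"
  shows "sgn (Y $ 1) = - sgn (mink Y C)"
proof (cases "Y = 0")
  case False
  then have "Y $ 1 \<noteq> 0"
    using Y time_component_nonzero by blast
  moreover from this have "\<bar>Y $ 2 * C $ 2 + Y $ 3 * C $ 3\<bar> < \<bar>Y $ 1 * C $ 1\<bar>"
    using C Y by (intro abs_spatial_product_less) (simp_all add: mink_def power2_eq_square)
  moreover have "sgn (Y $ 1 * C $ 1) = sgn (Y $ 1)"
    using C(2) by (simp add: sgn_mult)
  ultimately show ?thesis
    by (auto simp: mink_def sgn_real_def abs_if split: if_splits)
qed (simp add: mink_zero)

lemma orthogonal_timelike_null:
  assumes "mink C C < 0" "mink Y Y \<le> 0" "mink Y C = 0"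
  shows "Y = 0"
proof (rule ccontr)
  assume "Y \<noteq> 0"
  then have "Y $ 1 \<noteq> 0"
    using assms(2) time_component_nonzero by blast
  then have "\<bar>Y $ 2 * C $ 2 + Y $ 3 * C $ 3\<bar> < \<bar>Y $ 1 * C $ 1\<bar>"
    using assms(1,2) by (intro abs_spatial_product_less) (simp_all add: mink_def power2_eq_square)
  then show False
    using assms(3) by (simp add: mink_def)
qed

text \<open>The Gram determinant, four times the \<open>sq_area\<close> of the triangle spanned by
  \<open>x\<close> and \<open>y\<close>. It is also minus a quarter of the discriminant of the form
  at x + m y, as a quadratic in m, which is how it enters the roots below.\<close>

definition gram :: "real^3 \<Rightarrow> real^3 \<Rightarrow> real" where
  "gram x y = mink x x * mink y y - (mink x y)\<^sup>2"

text \<open>The reversed Cauchy-Schwarz inequality. Along X + m C the form is a quadratic in m with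
  negative leading coefficient, and it is nonnegative where the time component vanishes; so its
  discriminant is not negative.\<close>

lemma gram_nonpos:
  assumes C: "mink C C < 0"
  shows "gram X C \<le> 0"
proof -
  have c1: "C $ 1 \<noteq> 0"
    using C time_component_nonzero[of C] by (cases "C = 0") auto
  define m where "m = - (X $ 1) / C $ 1"
  define Z where "Z = X + m *\<^sub>R C"
  have "Z $ 1 = 0"
    using c1 by (simp add: Z_def m_def)
  then have "mink Z Z \<ge> 0"
    by (simp add: mink_def)
  then have "mink C C * mink Z Z \<le> 0"
    using C by (simp add: mult_nonpos_nonneg)
  moreover have "mink C C * mink Z Z = (m * mink C C + mink X C)\<^sup>2 + gram X C"
    by (simp add: Z_def gram_def mink_add mink_scale mink_commute[of C X] power2_eq_square algebra_simps)
  ultimately show ?thesis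
    by (smt (verit) zero_le_power2)
qed

text \<open>The equality case: the part \<open>Z\<close> of \<open>X\<close> orthogonal to
  \<open>C\<close> is null, and the orthogonal complement of a timelike vector contains no nonzero
  null vector.\<close>

lemma gram_zero_parallel:
  assumes C: "mink C C < 0" and 0: "gram X C = 0"
  obtains m where "X = m *\<^sub>R C"
proof -
  define Z where "Z = X - (mink X C / mink C C) *\<^sub>R C"
  have ZC: "mink Z C = 0"
    using C by (simp add: Z_def mink_diff mink_scale)
  have "mink C C * mink Z Z = gram X C"
    using C by (simp add: Z_def gram_def mink_diff mink_scale mink_commute[of C X] power2_eq_square field_simps)
  then have "mink Z Z = 0"
    using C 0 by simp
  then have "Z = 0"
    using C ZC orthogonal_timelike_null[of C Z] by simp
  then have "X = (mink X C / mink C C) *\<^sub>R C"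
    by (simp add: Z_def)
  then show thesis ..
qed

text \<open>The two parameters at which the line \<open>X + m C\<close> crosses the past and the future light cone.\<close>

definition past_root :: "real^3 \<Rightarrow> real^3 \<Rightarrow> real" where
  "past_root C X = (mink X C - sqrt (- gram X C)) / (- mink C C)"

definition future_root :: "real^3 \<Rightarrow> real^3 \<Rightarrow> real" where
  "future_root C X = (mink X C + sqrt (- gram X C)) / (- mink C C)"

lemma past_root_le_future_root:
  assumes "mink C C < 0"
  shows "past_root C X \<le> future_root C X"
  using assms gram_nonpos[OF assms, of X]
  by (simp add: past_root_def future_root_def divide_right_mono_neg)

lemma past_root_less_future_root:
  assumes "mink C C < 0" "gram X C \<noteq> 0"
  shows "past_root C X < future_root C X"
proof -
  have "sqrt (- gram X C) > 0"
    using gram_nonpos[OF assms(1), of X] assms(2) by simp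
  then show ?thesis
    using assms(1) by (simp add: past_root_def future_root_def divide_strict_right_mono_neg)
qed

text \<open>With roots \<open>?l \<le> ?h\<close>, the form at \<open>?Y\<close> is
  \<open>mink C C\<close> times the product of \<open>m - ?h\<close> and \<open>m - ?l\<close>, and
  \<open>2 * mink ?Y C\<close> is \<open>mink C C\<close> times their sum. The product decides
  between spacelike, null and timelike, the sum between past and future; adding the two signs
  records both. If the roots coincide, the line passes through 0, of rank 0.\<close>

lemma causal_rank_line:
  assumes C: "causal_rank C = 2"
  shows "causal_rank (X + m *\<^sub>R C) = sgn (m - future_root C X) + sgn (m - past_root C X)"
proof -
  let ?h = "future_root C X" and ?l = "past_root C X" and ?Y = "X + m *\<^sub>R C"
  have C': "mink C C < 0" "C $ 1 > 0"
    using C by (simp_all add: causal_rank_eq_2_iff)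
  define s where "s = sqrt (- gram X C)"
  have s: "s \<ge> 0" "s * s = - gram X C"
    using gram_nonpos[OF C'(1), of X] by (simp_all add: s_def)
  have le: "?l \<le> ?h"
    by (rule past_root_le_future_root[OF C'(1)])
  have sum: "mink C C * (?h + ?l) = - 2 * mink X C"
    using C'(1) by (simp add: future_root_def past_root_def field_simps)
  have prod: "mink C C * (?h * ?l) = mink X X"
  proof -
    have "(mink X C + s) * (mink X C - s) = mink C C * mink X X"
      using s(2) by (simp add: gram_def power2_eq_square algebra_simps)
    then have "?h * ?l = mink C C * mink X X / (mink C C * mink C C)"
      unfolding future_root_def past_root_def s_def[symmetric] by simp
    then show ?thesis
      using C'(1) by simp
  qed
  have "mink ?Y ?Y = mink X X + 2 * m * mink X C + m * m * mink C C"
    by (simp add: mink_add mink_scale mink_commute[of C X] algebra_simps)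
  also have "\<dots> = mink C C * (?h * ?l) - m * (mink C C * (?h + ?l)) + m * m * mink C C"
    by (simp only: sum prod)
  also have "\<dots> = mink C C * ((m - ?h) * (m - ?l))"
    by (simp add: algebra_simps)
  finally have Q: "mink ?Y ?Y = mink C C * ((m - ?h) * (m - ?l))" .
  have "2 * mink ?Y C = 2 * m * mink C C - (- 2 * mink X C)"
    by (simp add: mink_add mink_scale)
  also have "\<dots> = mink C C * ((m - ?h) + (m - ?l))"
    by (simp only: sum[symmetric]) (simp add: algebra_simps)
  finally have t: "2 * mink ?Y C = mink C C * ((m - ?h) + (m - ?l))" .
  have "sgn (?Y $ 1) = sgn ((m - ?h) + (m - ?l))" if "mink ?Y ?Y \<le> 0"
  proof -
    have "sgn (2 * mink ?Y C) = - sgn ((m - ?h) + (m - ?l))"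
      using C'(1) unfolding t by (simp add: sgn_mult)
    then show ?thesis
      using sgn_time_component[OF C' that] by (simp add: sgn_mult)
  qed
  then have rank: "causal_rank ?Y =
      (if (m - ?h) * (m - ?l) < 0 then 0
       else (if (m - ?h) * (m - ?l) = 0 then 1 else 2) * sgn ((m - ?h) + (m - ?l)))"
    using C'(1) unfolding causal_rank_def Q
    by (simp add: mult_le_0_iff not_less zero_less_mult_iff del: mult_eq_0_iff)
  consider "m < ?l" | "m = ?l" | "?l < m" "m < ?h" | "m = ?h" | "?h < m"
    by linarith
  then show ?thesis
  proof cases
    case 1
    then have "(m - ?h) * (m - ?l) > 0" using le by (intro mult_neg_neg) auto
    moreover from this have "\<not> (m - ?h) * (m - ?l) < 0" by linarith
    ultimately show ?thesis unfolding rank using 1 le by (simp add: sgn_real_def)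
  next
    case 3
    then have "(m - ?h) * (m - ?l) < 0" by (intro mult_neg_pos) auto
    then show ?thesis unfolding rank using 3 by (simp add: sgn_real_def)
  next
    case 5
    then have "(m - ?h) * (m - ?l) > 0" using le by (intro mult_pos_pos) auto
    moreover from this have "\<not> (m - ?h) * (m - ?l) < 0" by linarith
    ultimately show ?thesis unfolding rank using 5 le by (simp add: sgn_real_def)
  next
    case 2
    then show ?thesis unfolding rank by simp
  next
    case 4
    then show ?thesis unfolding rank by simp
  qed
qed

lemma root_signs:
  assumes C: "causal_rank C = 2"
  shows "causal_rank X = - sgn (future_root C X) - sgn (past_root C X)"
  using causal_rank_line[OF C, of X 0] by (simp add: sgn_minus)

lemma roots_scale:
  assumes "t \<ge> 0"
  shows "future_root C (t *\<^sub>R X) = t * future_root C X" "past_root C (t *\<^sub>R X) = t * past_root C X"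
proof -
  have "- gram (t *\<^sub>R X) C = t\<^sup>2 * (- gram X C)"
    by (simp add: gram_def mink_scale power2_eq_square algebra_simps)
  then have "sqrt (- gram (t *\<^sub>R X) C) = t * sqrt (- gram X C)"
    using assms by (simp only: real_sqrt_mult real_sqrt_abs abs_of_nonneg)
  then show "future_root C (t *\<^sub>R X) = t * future_root C X" "past_root C (t *\<^sub>R X) = t * past_root C X"
    by (simp_all add: future_root_def past_root_def mink_scale add_divide_distrib diff_divide_distrib algebra_simps)
qed

text \<open>Convexity of the future timelike cone: the line Y + m X has rank 2 already at m = 0, so
  both roots are negative and have been passed at m = 1 as well.\<close>

lemma causal_rank_add_future:
  assumes "causal_rank X = 2" "causal_rank Y = 2"
  shows "causal_rank (X + Y) = 2"
proof -
  have "future_root X Y < 0"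
    using root_signs[OF assms(1), of Y] assms(2) past_root_le_future_root[of X Y] assms(1)
    by (auto simp: causal_rank_eq_2_iff sgn_real_def split: if_splits)
  moreover have "past_root X Y \<le> future_root X Y"
    using assms(1) by (simp add: past_root_le_future_root causal_rank_eq_2_iff)
  ultimately show ?thesis
    using causal_rank_line[OF assms(1), of Y 1] by (simp add: add.commute)
qed

lemma causal_rank_line_mono:
  assumes C: "causal_rank C = 2" and "m \<le> n"
  shows "causal_rank (X + m *\<^sub>R C) \<le> causal_rank (X + n *\<^sub>R C)"
  unfolding causal_rank_line[OF C] using \<open>m \<le> n\<close> by (auto simp: sgn_real_def)

subsection \<open>Piecewise linear maps of the half-line\<close>

text \<open>For compatible breakpoints, the increasing map of the half-line that sends 0,
  \<open>b\<close>, \<open>a\<close> to 0, \<open>b'\<close>, \<open>a'\<close> and has slope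
  \<open>k\<close> beyond \<open>a\<close>. A sum of clipped increments, in place of a case
  distinction, keeps the formula continuous in the breakpoints even when a piece has length 0: the
  division by 0 then meets an increment that is 0.\<close>

definition stretch :: "real \<Rightarrow> real \<Rightarrow> real \<Rightarrow> real \<Rightarrow> real \<Rightarrow> real \<Rightarrow> real" where
  "stretch b a b' a' k m =
     min m b * (b' / b) + max 0 (min (m - b) (a - b)) * ((a' - b') / (a - b)) + max 0 (m - a) * k"

text \<open>A piece may have length 0 only together with its image; otherwise the map would collapse
  an interval or would have to spread out a point.\<close>

definition compatible :: "real \<Rightarrow> real \<Rightarrow> real \<Rightarrow> real \<Rightarrow> bool" where
  "compatible b a b' a' \<longleftrightarrow>
     0 \<le> b \<and> b \<le> a \<and> 0 \<le> b' \<and> b' \<le> a' \<and> (b = 0 \<longleftrightarrow> b' = 0) \<and> (a = b \<longleftrightarrow> a' = b')"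

lemma compatible_sym: "compatible b a b' a' \<Longrightarrow> compatible b' a' b a"
  by (auto simp: compatible_def)

lemma stretch_lower:
  assumes "compatible b a b' a'" "0 \<le> m" "m \<le> b"
  shows "stretch b a b' a' k m = m * (b' / b)"
proof -
  have "b \<le> a" using assms by (simp add: compatible_def)
  with assms(2,3) show ?thesis by (simp add: stretch_def)
qed

lemma stretch_middle:
  assumes "compatible b a b' a'" "b \<le> m" "m \<le> a"
  shows "stretch b a b' a' k m = b' + (m - b) * ((a' - b') / (a - b))"
  using assms by (cases "b = 0") (auto simp: stretch_def compatible_def)

lemma stretch_upper:
  assumes "compatible b a b' a'" "a \<le> m"
  shows "stretch b a b' a' k m = a' + (m - a) * k"
  using assms by (cases "b = 0"; cases "a = b") (auto simp: stretch_def compatible_def)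

lemma stretch_zero: "compatible b a b' a' \<Longrightarrow> stretch b a b' a' k 0 = 0"
  by (rule trans[OF stretch_lower]) (auto simp: compatible_def)

text \<open>The rank along a line is a sum of signs of this kind, so this is all that the causal
  regions ask of the map.\<close>

lemma stretch_compare:
  assumes c: "compatible b a b' a'" and "0 \<le> m" "k > 0"
  shows "0 \<le> stretch b a b' a' k m"
    and "sgn (stretch b a b' a' k m - b') = sgn (m - b)"
    and "sgn (stretch b a b' a' k m - a') = sgn (m - a)"
proof -
  let ?s = "stretch b a b' a' k m"
  have c': "0 \<le> b" "b \<le> a" "0 \<le> b'" "b' \<le> a'" "b = 0 \<longleftrightarrow> b' = 0" "a = b \<longleftrightarrow> a' = b'"
    using c by (auto simp: compatible_def)
  consider "m < b" | "m = b" | "b < m" "m < a" | "m = a" | "a < m"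
    by linarith
  then have "0 \<le> ?s \<and> sgn (?s - b') = sgn (m - b) \<and> sgn (?s - a') = sgn (m - a)"
  proof cases
    case 1
    then have b: "b > 0" "b' > 0" using c' \<open>0 \<le> m\<close> by auto
    then have "?s = m * (b' / b)" using stretch_lower[OF c \<open>0 \<le> m\<close>] 1 by simp
    moreover have "m * (b' / b) < b'"
      using 1 b by (simp add: field_simps)
    moreover have "0 \<le> m * (b' / b)"
      using b \<open>0 \<le> m\<close> by simp
    ultimately show ?thesis using 1 c' by (simp add: sgn_real_def)
  next
    case 2
    then have "?s = b'" using stretch_middle[OF c] c' by simp
    with 2 c' show ?thesis by (auto simp: sgn_real_def)
  next
    case 3
    then have ab: "a > b" "a' > b'" using c' by auto
    have "?s = b' + (m - b) * ((a' - b') / (a - b))" using stretch_middle[OF c] 3 by simp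
    moreover have "(m - b) * ((a' - b') / (a - b)) > 0" using ab 3 by simp
    moreover have "(m - b) * ((a' - b') / (a - b)) < a' - b'"
    proof -
      have "(m - b) * (a' - b') < (a - b) * (a' - b')"
        using ab 3 by (intro mult_strict_right_mono) auto
      then show ?thesis using ab by (simp add: pos_divide_less_eq mult.commute)
    qed
    ultimately show ?thesis using 3 c' by (simp add: sgn_real_def)
  next
    case 4
    then have "?s = a'" using stretch_upper[OF c] c' by simp
    with 4 c' show ?thesis by (auto simp: sgn_real_def)
  next
    case 5
    then have "?s = a' + (m - a) * k" using stretch_upper[OF c] by simp
    moreover have "(m - a) * k > 0" using 5 \<open>k > 0\<close> by simp
    ultimately have "?s > a'" by linarith
    then show ?thesis using 5 c' by (simp add: sgn_real_def)
  qed
  then show "0 \<le> ?s" "sgn (?s - b') = sgn (m - b)" "sgn (?s - a') = sgn (m - a)"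
    by simp_all
qed

text \<open>The inverse is again a stretching, with the breakpoints exchanged and the last slope
  inverted.\<close>

lemma stretch_inverse:
  assumes c: "compatible b a b' a'" and "0 \<le> m" "k > 0"
  shows "stretch b' a' b a (1 / k) (stretch b a b' a' k m) = m"
proof -
  let ?s = "stretch b a b' a' k m"
  note cmp = stretch_compare[OF assms]
  note c2 = compatible_sym[OF c]
  have c': "0 \<le> b" "b \<le> a" "0 \<le> b'" "b' \<le> a'" "b = 0 \<longleftrightarrow> b' = 0" "a = b \<longleftrightarrow> a' = b'"
    using c by (auto simp: compatible_def)
  consider "m < b" | "b \<le> m" "m < a" | "a \<le> m"
    by linarith
  then show ?thesis
  proof cases
    case 1
    then have "?s < b'" using cmp(2) by (simp add: sgn_real_def split: if_splits)
    moreover have "b > 0" "b' > 0" using 1 c' \<open>0 \<le> m\<close> by auto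
    ultimately show ?thesis
      using stretch_lower[OF c \<open>0 \<le> m\<close>] stretch_lower[OF c2 cmp(1)] 1 by simp
  next
    case 2
    then have "b' \<le> ?s" "?s < a'" using cmp by (auto simp: sgn_real_def split: if_splits)
    moreover have "a > b" "a' > b'" using 2 c' by auto
    ultimately show ?thesis
      using stretch_middle[OF c] stretch_middle[OF c2] 2 by simp
  next
    case 3
    then have "a' \<le> ?s" using cmp by (auto simp: sgn_real_def split: if_splits)
    then show ?thesis
      using stretch_upper[OF c] stretch_upper[OF c2] 3 \<open>k > 0\<close> by simp
  qed
qed

lemma stretch_eq_0_iff:
  assumes "compatible b a b' a'" "0 \<le> m" "k > 0"
  shows "stretch b a b' a' k m = 0 \<longleftrightarrow> m = 0"
  using stretch_inverse[OF assms] stretch_zero[OF assms(1)] stretch_zero[OF compatible_sym[OF assms(1)]]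
  by metis

lemma stretch_scale:
  assumes "t > 0"
  shows "stretch (t * b) (t * a) (t * b') (t * a') k (t * m) = t * stretch b a b' a' k m"
proof -
  have 1: "min (t * x) (t * y) = t * min x y" "max 0 (t * x) = t * max 0 x" for x y :: real
    using assms by (auto simp: min_def max_def zero_le_mult_iff)
  have 2: "t * x - t * y = t * (x - y)" for x y
    by (simp add: algebra_simps)
  have 3: "t * x / (t * y) = x / y" for x y
    using assms by simp
  show ?thesis
    unfolding stretch_def 2 1 3 by (simp add: algebra_simps)
qed

text \<open>The quotient may be undefined (\<open>x / 0 = 0\<close>), but only where the factor \<open>h\<close> vanishes.\<close>

lemma continuous_on_bounded_ratio:
  fixes f g h :: "'a::topological_space \<Rightarrow> real"
  assumes f: "continuous_on S f" and g: "continuous_on S g" and h: "continuous_on S h"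
    and bound: "\<And>x. x \<in> S \<Longrightarrow> \<bar>f x\<bar> \<le> g x"
    and zero: "\<And>x. x \<in> S \<Longrightarrow> g x = 0 \<Longrightarrow> h x = 0"
  shows "continuous_on S (\<lambda>x. f x * (h x / g x))"
  unfolding continuous_on_def
proof
  fix x assume x: "x \<in> S"
  have lim: "(f \<longlongrightarrow> f x) (at x within S)" "(g \<longlongrightarrow> g x) (at x within S)"
    "(h \<longlongrightarrow> h x) (at x within S)"
    using f g h x by (simp_all add: continuous_on_def)
  show "((\<lambda>x. f x * (h x / g x)) \<longlongrightarrow> f x * (h x / g x)) (at x within S)"
  proof (cases "g x = 0")
    case False
    then show ?thesis by (intro tendsto_intros lim)
  next
    case True
    have le: "\<bar>f y * (h y / g y)\<bar> \<le> \<bar>h y\<bar>" if "y \<in> S" for y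
    proof (cases "g y = 0")
      case False
      then have "\<bar>f y\<bar> * \<bar>h y\<bar> \<le> \<bar>g y\<bar> * \<bar>h y\<bar>"
        using bound[OF that] by (intro mult_right_mono) auto
      then show ?thesis
        using False by (simp add: abs_mult field_simps)
    qed simp
    have "h x = 0"
      by (rule zero[OF x True])
    then have "((\<lambda>y. \<bar>h y\<bar>) \<longlongrightarrow> 0) (at x within S)"
      using tendsto_rabs[OF lim(3)] by simp
    then have "((\<lambda>x. f x * (h x / g x)) \<longlongrightarrow> 0) (at x within S)"
    proof (rule Lim_null_comparison[rotated])
      show "\<forall>\<^sub>F y in at x within S. norm (f y * (h y / g y)) \<le> \<bar>h y\<bar>"
        unfolding eventually_at_filter real_norm_def by (intro always_eventually allI impI le)
    qed
    then show ?thesis using True by simp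
  qed
qed

text \<open>On each of the two bounded pieces an increment, clipped to the length of the piece,
  multiplies a quotient with that length as denominator, so the lemma on bounded ratios applies;
  compatibility makes the numerator vanish with the denominator.\<close>

lemma continuous_on_stretch:
  fixes b a b' a' m :: "'a::topological_space \<Rightarrow> real"
  assumes cont: "continuous_on S b" "continuous_on S a" "continuous_on S b'" "continuous_on S a'"
      "continuous_on S m"
    and c: "\<And>x. x \<in> S \<Longrightarrow> compatible (b x) (a x) (b' x) (a' x)"
    and m: "\<And>x. x \<in> S \<Longrightarrow> 0 \<le> m x"
  shows "continuous_on S (\<lambda>x. stretch (b x) (a x) (b' x) (a' x) k (m x))"
  unfolding stretch_def
proof (intro continuous_on_add)
  show "continuous_on S (\<lambda>x. min (m x) (b x) * (b' x / b x))"
  proof (rule continuous_on_bounded_ratio)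
    show "\<bar>min (m x) (b x)\<bar> \<le> b x" if "x \<in> S" for x
      using c[OF that] m[OF that] by (auto simp: compatible_def)
  qed (use c in \<open>auto simp: compatible_def intro!: continuous_intros cont\<close>)
  show "continuous_on S (\<lambda>x. max 0 (min (m x - b x) (a x - b x)) * ((a' x - b' x) / (a x - b x)))"
  proof (rule continuous_on_bounded_ratio)
    show "\<bar>max 0 (min (m x - b x) (a x - b x))\<bar> \<le> a x - b x" if "x \<in> S" for x
      using c[OF that] m[OF that] by (auto simp: compatible_def)
  qed (use c in \<open>auto simp: compatible_def intro!: continuous_intros cont\<close>)
  show "continuous_on S (\<lambda>x. max 0 (m x - a x) * k)"
    by (intro continuous_intros cont)
qed

subsection \<open>Homogeneous maps of the orthant\<close>

definition comb :: "(3 \<Rightarrow> real^3) \<Rightarrow> real^3 \<Rightarrow> real^3" where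
  "comb u a = (\<Sum>i\<in>UNIV. a $ i *\<^sub>R u i)"

lemma comb_add: "comb u (a + b) = comb u a + comb u b"
  by (simp add: comb_def scaleR_add_left sum.distrib)

lemma comb_scale: "comb u (t *\<^sub>R a) = t *\<^sub>R comb u a"
  by (simp add: comb_def scaleR_sum_right)

lemma linear_comb: "linear (comb u)"
  by (rule linearI) (simp_all add: comb_add comb_scale)

lemma comb_zero [simp]: "comb u 0 = 0"
  by (simp add: comb_def)

definition orthant :: "(real^3) set" where
  "orthant = {a. \<forall>i. 0 \<le> a $ i}"

definition orthant_boundary :: "(real^3) set" where
  "orthant_boundary = {a \<in> orthant. \<exists>i. a $ i = 0}"

text \<open>Keeping the zero coordinates means that every face of the orthant is respected.
  Homogeneity permits a later rescaling along the rays, which changes no causal region.\<close>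

definition orthant_map :: "(real^3 \<Rightarrow> real^3) \<Rightarrow> bool" where
  "orthant_map F \<longleftrightarrow> continuous_on orthant F \<and> F ` orthant \<subseteq> orthant \<and>
     (\<forall>a\<in>orthant. \<forall>i. F a $ i = 0 \<longleftrightarrow> a $ i = 0) \<and>
     (\<forall>a\<in>orthant. \<forall>t>0. F (t *\<^sub>R a) = t *\<^sub>R F a)"

lemma orthant_scale: "a \<in> orthant \<Longrightarrow> 0 \<le> t \<Longrightarrow> t *\<^sub>R a \<in> orthant"
  by (simp add: orthant_def)

text \<open>Every vector is \<open>b + m c\<close> with \<open>b\<close> in the boundary of the orthant for exactly one \<open>m\<close>.\<close>

definition apex_coord :: "real^3 \<Rightarrow> real^3 \<Rightarrow> real" where
  "apex_coord c a = min (a $ 1 / c $ 1) (min (a $ 2 / c $ 2) (a $ 3 / c $ 3))"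

definition base_point :: "real^3 \<Rightarrow> real^3 \<Rightarrow> real^3" where
  "base_point c a = a - apex_coord c a *\<^sub>R c"

lemma base_point_apex: "base_point c a + apex_coord c a *\<^sub>R c = a"
  by (simp add: base_point_def)

lemma base_point_boundary:
  assumes "\<And>i. c $ i > 0"
  shows "base_point c a \<in> orthant_boundary"
proof -
  let ?m = "apex_coord c a"
  have le: "?m * c $ i \<le> a $ i" for i
  proof -
    have "?m \<le> a $ i / c $ i"
      using exhaust_3[of i] by (auto simp: apex_coord_def)
    then show ?thesis
      using assms[of i] by (simp add: pos_le_divide_eq)
  qed
  have "\<exists>i. ?m = a $ i / c $ i"
    unfolding apex_coord_def min_def by metis
  then obtain i where "?m = a $ i / c $ i" ..
  then have "a $ i - ?m * c $ i = 0"
    using assms[of i] by simp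
  with le show ?thesis
    by (auto simp: orthant_boundary_def orthant_def base_point_def)
qed

lemma apex_coord_nonneg:
  assumes "\<And>i. c $ i > 0" "a \<in> orthant"
  shows "apex_coord c a \<ge> 0"
  using assms by (simp add: apex_coord_def orthant_def less_imp_le)

text \<open>A vanishing coordinate of \<open>b\<close> makes the minimum of the quotients for
  \<open>b\<close> equal to 0, and adding m c shifts all three quotients by
  \<open>m\<close>.\<close>

lemma apex_coord_boundary:
  assumes c: "\<And>i. c $ i > 0" and b: "b \<in> orthant_boundary"
  shows "apex_coord c (b + m *\<^sub>R c) = m"
proof -
  have nz: "c $ i \<noteq> 0" for i
    using c[of i] by simp
  have ge: "0 \<le> b $ i / c $ i" for i
    using b c[of i] by (simp add: orthant_boundary_def orthant_def)
  obtain j where j: "b $ j = 0"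
    using b by (auto simp: orthant_boundary_def)
  have eq: "(b + m *\<^sub>R c) $ i / c $ i = b $ i / c $ i + m" for i
    using nz[of i] by (simp add: add_divide_distrib)
  show ?thesis
    unfolding apex_coord_def eq using ge[of 1] ge[of 2] ge[of 3] j exhaust_3[of j] by auto
qed

lemma apex_coord_scale: "t > 0 \<Longrightarrow> apex_coord c (t *\<^sub>R a) = t * apex_coord c a"
  by (simp add: apex_coord_def min_mult_distrib_left)

lemma base_point_scale: "t > 0 \<Longrightarrow> base_point c (t *\<^sub>R a) = t *\<^sub>R base_point c a"
  by (simp add: base_point_def apex_coord_scale scaleR_diff_right)

lemma continuous_on_apex_coord: "(\<And>i. c $ i > 0) \<Longrightarrow> continuous_on S (apex_coord c)"
  unfolding apex_coord_def by (intro continuous_intros) (auto simp: less_le)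

lemma continuous_on_base_point: "(\<And>i. c $ i > 0) \<Longrightarrow> continuous_on S (base_point c)"
  unfolding base_point_def by (intro continuous_intros continuous_on_apex_coord)

text \<open>The rank along the segment from \<open>X\<close> to \<open>Y\<close> jumps at two parameters \<open>lo\<close> and \<open>hi\<close>; a jump of
  height \<open>0\<close> leaves its parameter arbitrary.\<close>

definition edge_pattern ::
    "real^3 \<Rightarrow> real^3 \<Rightarrow> real \<times> real \<times> real \<Rightarrow> real \<Rightarrow> real \<Rightarrow> bool" where
  "edge_pattern X Y K lo hi \<longleftrightarrow> 0 < lo \<and> lo < hi \<and> hi < 1 \<and>
     (\<forall>t\<in>{0..1}. causal_rank ((1 - t) *\<^sub>R X + t *\<^sub>R Y) =
        fst K + fst (snd K) * sgn (t - lo) + snd (snd K) * sgn (t - hi))"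

text \<open>A nonzero point of the cone over the edge lies on the ray through the edge point with
  parameter \<open>y / (x + y)\<close>; multiplying the comparisons by \<open>x + y\<close> removes
  the quotient.\<close>

lemma edge_pattern_cone:
  assumes "edge_pattern X Y K lo hi" "0 \<le> x" "0 \<le> y" "x + y > 0"
  shows "causal_rank (x *\<^sub>R X + y *\<^sub>R Y) =
    fst K + fst (snd K) * sgn (y - lo * (x + y)) + snd (snd K) * sgn (y - hi * (x + y))"
proof -
  let ?s = "x + y"
  define t where "t = y / ?s"
  have t: "0 \<le> t" "t \<le> 1"
    using assms by (simp_all add: t_def)
  have y: "y = ?s * t" "x = ?s * (1 - t)"
    using assms(4) by (simp_all add: t_def field_simps)
  have "x *\<^sub>R X + y *\<^sub>R Y = ?s *\<^sub>R ((1 - t) *\<^sub>R X + t *\<^sub>R Y)"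
    by (simp add: scaleR_add_right y[symmetric])
  then have "causal_rank (x *\<^sub>R X + y *\<^sub>R Y) = causal_rank ((1 - t) *\<^sub>R X + t *\<^sub>R Y)"
    using assms(4) by (simp add: causal_rank_scale)
  moreover have "sgn (y - z * ?s) = sgn (t - z)" for z
  proof -
    have "y - z * ?s = ?s * (t - z)"
      using y(1) by (simp add: algebra_simps)
    then show ?thesis
      using assms(4) by (simp add: sgn_mult)
  qed
  ultimately show ?thesis
    using assms(1) t by (simp add: edge_pattern_def)
qed

text \<open>The index type is arithmetic modulo 3: edge \<open>i\<close> runs from \<open>i\<close>
  to \<open>i + 1\<close>, and opposite to the index \<open>k\<close> lies edge
  \<open>k + 1\<close>, from \<open>k + 1\<close> to \<open>k + 2\<close>.\<close>

lemma index3_cases: "i = k \<or> i = k + 1 \<or> i = k + 2" for i k :: 3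
  using exhaust_3[of i] exhaust_3[of k] by auto

lemma index3_simps:
  fixes k :: 3
  shows "k + 1 + 1 = k + 2" "k + 1 + 2 = k" "k + 2 + 1 = k" "k + 2 + 2 = k + 1"
    "k - 1 = k + 2" "k + 1 - 1 = k" "k + 2 - 1 = k + 1"
  using exhaust_3[of k] by auto

lemma index3_distinct: "k \<noteq> k + 1" "k \<noteq> k + 2" "k + 1 \<noteq> k + 2" for k :: 3
  using exhaust_3[of k] by auto

lemma sum_index3: "(\<Sum>i\<in>UNIV. f i) = f k + f (k + 1) + f (k + 2)" for k :: 3
proof -
  have U: "UNIV = {k, k + 1, k + 2}"
    using index3_cases[of _ k] by auto
  show ?thesis
    unfolding U using index3_distinct[of k] by (simp add: add.assoc)
qed

text \<open>Two frames with the same jumps \<open>K\<close> on each edge, at parameters that may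
  differ. Even a jump of height 0 has its parameter, so every edge has two distinct interior
  breakpoints and none needs separate treatment. The assumptions are symmetric in the two frames,
  which later yields the inverse.\<close>

locale matched_frames =
  fixes u u' :: "3 \<Rightarrow> real^3" and l h l' h' :: "3 \<Rightarrow> real" and K :: "3 \<Rightarrow> real \<times> real \<times> real"
    and c c' :: "real^3"
  assumes indep: "\<And>a. comb u a = 0 \<Longrightarrow> a = 0" and indep': "\<And>a. comb u' a = 0 \<Longrightarrow> a = 0"
    and pattern: "\<And>i. edge_pattern (u i) (u (i + 1)) (K i) (l i) (h i)"
    and pattern': "\<And>i. edge_pattern (u' i) (u' (i + 1)) (K i) (l' i) (h' i)"
    and c: "\<And>i. c $ i > 0" "causal_rank (comb u c) = 2"
    and c': "\<And>i. c' $ i > 0" "causal_rank (comb u' c') = 2"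
begin

text \<open>Here \<open>s\<close> is the sum of the two coordinates of a point over the edge and
  \<open>y\<close> is the second of them. The last slope is the one for which the end
  \<open>y = s\<close> stays fixed.\<close>

definition edge_map :: "3 \<Rightarrow> real \<Rightarrow> real \<Rightarrow> real" where
  "edge_map i s y = stretch (l i * s) (h i * s) (l' i * s) (h' i * s) ((1 - h' i) / (1 - h i)) y"

text \<open>For a boundary point at most one of the three displacements is nonzero.\<close>

definition displacement :: "3 \<Rightarrow> real^3 \<Rightarrow> real" where
  "displacement i b = edge_map i (b $ i + b $ (i + 1)) (b $ (i + 1)) - b $ (i + 1)"

text \<open>Displacement \<open>i\<close> moves weight from coordinate \<open>i\<close> to
  coordinate \<open>i + 1\<close>, so the coordinate sum is kept. A single formula for all three
  faces makes continuity immediate, without gluing along the axes.\<close>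

definition boundary_map :: "real^3 \<Rightarrow> real^3" where
  "boundary_map b = (\<chi> i. b $ i - displacement i b + displacement (i - 1) b)"

text \<open>Over a boundary point only the heights \<open>m \<ge> 0\<close> lie in the orthant, so
  crossings at negative heights are replaced by 0.\<close>

definition height_map :: "real^3 \<Rightarrow> real \<Rightarrow> real" where
  "height_map b m =
     stretch (max 0 (past_root (comb u c) (comb u b))) (max 0 (future_root (comb u c) (comb u b)))
       (max 0 (past_root (comb u' c') (comb u' (boundary_map b))))
       (max 0 (future_root (comb u' c') (comb u' (boundary_map b)))) 1 m"

definition cone_map :: "real^3 \<Rightarrow> real^3" where
  "cone_map a = boundary_map (base_point c a) + height_map (base_point c a) (apex_coord c a) *\<^sub>R c'"

lemma breaks: "0 < l i" "l i < h i" "h i < 1" "0 < l' i" "l' i < h' i" "h' i < 1"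
  using pattern[of i] pattern'[of i] by (simp_all add: edge_pattern_def)

lemma edge_compatible:
  assumes "s \<ge> 0"
  shows "compatible (l i * s) (h i * s) (l' i * s) (h' i * s)"
proof -
  have "l i * s \<le> h i * s" "l' i * s \<le> h' i * s"
    using assms breaks[of i] by (auto intro!: mult_right_mono)
  then show ?thesis
    using assms breaks[of i] by (auto simp: compatible_def)
qed

lemma edge_factor_pos: "(1 - h' i) / (1 - h i) > 0"
  using breaks[of i] by simp

lemma edge_map_zero: "s \<ge> 0 \<Longrightarrow> edge_map i s 0 = 0"
  unfolding edge_map_def by (rule stretch_zero[OF edge_compatible])

lemma edge_map_total:
  assumes "s \<ge> 0"
  shows "edge_map i s s = s"
proof -
  have "h i * s \<le> s"
    using breaks[of i] assms by (intro mult_left_le_one_le) auto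
  then have "edge_map i s s = h' i * s + (s - h i * s) * ((1 - h' i) / (1 - h i))"
    unfolding edge_map_def by (rule stretch_upper[OF edge_compatible[OF assms]])
  also have "s - h i * s = s * (1 - h i)"
    by (simp add: algebra_simps)
  also have "h' i * s + s * (1 - h i) * ((1 - h' i) / (1 - h i)) = s"
  proof -
    have "s * (1 - h i) * ((1 - h' i) / (1 - h i)) = s * (1 - h' i)"
      using breaks[of i] by simp
    then show ?thesis
      by (simp only:) (simp add: algebra_simps)
  qed
  finally show ?thesis .
qed

lemma edge_map_compare:
  assumes "0 \<le> s" "0 \<le> y"
  shows "0 \<le> edge_map i s y" "sgn (edge_map i s y - l' i * s) = sgn (y - l i * s)"
    "sgn (edge_map i s y - h' i * s) = sgn (y - h i * s)" "edge_map i s y = 0 \<longleftrightarrow> y = 0"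
  using stretch_compare[OF edge_compatible[OF assms(1)] assms(2) edge_factor_pos, of i]
    stretch_eq_0_iff[OF edge_compatible[OF assms(1)] assms(2) edge_factor_pos, of i]
  by (simp_all add: edge_map_def)

lemma edge_map_less:
  assumes "0 \<le> y" "y < s"
  shows "edge_map i s y < s"
proof (cases "y \<le> h i * s")
  case True
  have s: "0 < s" using assms by simp
  have "edge_map i s y \<le> h' i * s"
    using edge_map_compare(3)[of s y i] assms True s by (auto simp: sgn_real_def split: if_splits)
  also have "\<dots> < s"
    using breaks[of i] s by simp
  finally show ?thesis .
next
  case False
  have s: "0 < s" using assms by simp
  have "edge_map i s y = h' i * s + (y - h i * s) * ((1 - h' i) / (1 - h i))"
    unfolding edge_map_def using False s by (intro stretch_upper[OF edge_compatible]) auto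
  also have "\<dots> < h' i * s + (s - h i * s) * ((1 - h' i) / (1 - h i))"
    using assms(2) edge_factor_pos[of i]
    by (intro add_strict_left_mono mult_strict_right_mono) auto
  also have "\<dots> = edge_map i s s"
  proof -
    have "h i * s \<le> s"
      using breaks[of i] s by (intro mult_left_le_one_le) auto
    then show ?thesis
      unfolding edge_map_def using s by (intro stretch_upper[OF edge_compatible, symmetric]) auto
  qed
  also have "\<dots> = s" using s by (simp add: edge_map_total)
  finally show ?thesis .
qed

lemma edge_map_scale: "t > 0 \<Longrightarrow> edge_map i (t * s) (t * y) = t * edge_map i s y"
  unfolding edge_map_def using stretch_scale[of t] by (simp add: mult.left_commute)

text \<open>Two displacements involve coordinate \<open>k\<close>. When it is 0 they vanish, because
  the edge maps fix both 0 and \<open>s\<close>.\<close>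

lemma boundary_map_edge:
  assumes b: "b \<in> orthant" and k: "b $ k = 0"
  defines "s \<equiv> b $ (k + 1) + b $ (k + 2)"
  defines "g \<equiv> edge_map (k + 1) s (b $ (k + 2))"
  shows "boundary_map b $ k = 0" "boundary_map b $ (k + 1) = s - g" "boundary_map b $ (k + 2) = g"
proof -
  have nonneg: "0 \<le> b $ i" for i
    using b by (simp add: orthant_def)
  have "displacement k b = 0"
    by (simp add: displacement_def k edge_map_total nonneg)
  moreover have "displacement (k + 2) b = 0"
    by (simp add: displacement_def index3_simps k edge_map_zero nonneg)
  moreover have "displacement (k + 1) b = g - b $ (k + 2)"
    by (simp add: displacement_def index3_simps g_def s_def)
  ultimately show "boundary_map b $ k = 0" "boundary_map b $ (k + 1) = s - g"
    "boundary_map b $ (k + 2) = g"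
    by (simp_all add: boundary_map_def index3_simps k s_def)
qed

lemma boundary_map_boundary:
  assumes "b \<in> orthant_boundary"
  shows "boundary_map b \<in> orthant_boundary" "boundary_map b $ i = 0 \<longleftrightarrow> b $ i = 0"
    "causal_rank (comb u' (boundary_map b)) = causal_rank (comb u b)"
proof -
  obtain k where b: "b \<in> orthant" and k: "b $ k = 0"
    using assms by (auto simp: orthant_boundary_def)
  have nonneg: "0 \<le> b $ i" for i
    using b by (simp add: orthant_def)
  define x y where "x = b $ (k + 1)" and "y = b $ (k + 2)"
  define g where "g = edge_map (k + 1) (x + y) y"
  have xy: "0 \<le> x" "0 \<le> y"
    by (simp_all add: x_def y_def nonneg)
  note eqs = boundary_map_edge[OF b k, folded x_def y_def, folded g_def]
  have g: "0 \<le> g" "g = 0 \<longleftrightarrow> y = 0"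
    using edge_map_compare(1,4)[of "x + y" y] xy by (simp_all add: g_def)
  have g2: "g \<le> x + y \<and> (g = x + y \<longleftrightarrow> x = 0)"
  proof (cases "x = 0")
    case True
    then show ?thesis using xy by (simp add: g_def edge_map_total)
  next
    case False
    then have "g < x + y"
      unfolding g_def using xy by (intro edge_map_less) auto
    then show ?thesis using False by simp
  qed
  have nn: "0 \<le> boundary_map b $ j" for j
    using index3_cases[of j k] eqs g(1) g2 by auto
  show "boundary_map b \<in> orthant_boundary"
    using nn eqs(1) by (auto simp: orthant_boundary_def orthant_def)
  show "boundary_map b $ i = 0 \<longleftrightarrow> b $ i = 0"
    using index3_cases[of i k] eqs g g2 k by (auto simp: x_def[symmetric] y_def[symmetric])
  have comb: "comb w a = (a $ (k + 1)) *\<^sub>R w (k + 1) + (a $ (k + 2)) *\<^sub>R w (k + 1 + 1)"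
    if "a $ k = 0" for a and w :: "3 \<Rightarrow> real^3"
    by (simp add: comb_def sum_index3[of _ k] that index3_simps)
  show "causal_rank (comb u' (boundary_map b)) = causal_rank (comb u b)"
  proof (cases "x + y = 0")
    case True
    then have "x = 0" "y = 0" using xy by auto
    then show ?thesis
      using g(2) by (simp add: comb[OF k] comb[OF eqs(1)] eqs x_def[symmetric] y_def[symmetric])
  next
    case False
    then have s: "x + y > 0" using xy by simp
    have "causal_rank (comb u' (boundary_map b)) =
        causal_rank ((x + y - g) *\<^sub>R u' (k + 1) + g *\<^sub>R u' (k + 1 + 1))"
      by (simp add: comb[OF eqs(1)] eqs)
    also have "\<dots> = fst (K (k + 1)) + fst (snd (K (k + 1))) * sgn (g - l' (k + 1) * (x + y)) +
        snd (snd (K (k + 1))) * sgn (g - h' (k + 1) * (x + y))"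
      using edge_pattern_cone[OF pattern'[of "k + 1"], of "x + y - g" g] g g2 s by simp
    also have "\<dots> = fst (K (k + 1)) + fst (snd (K (k + 1))) * sgn (y - l (k + 1) * (x + y)) +
        snd (snd (K (k + 1))) * sgn (y - h (k + 1) * (x + y))"
      using edge_map_compare(2,3)[of "x + y" y "k + 1"] s xy by (simp add: g_def)
    also have "\<dots> = causal_rank (x *\<^sub>R u (k + 1) + y *\<^sub>R u (k + 1 + 1))"
      using edge_pattern_cone[OF pattern[of "k + 1"], of x y] xy s by simp
    finally show ?thesis
      by (simp add: comb[OF k] x_def y_def)
  qed
qed

lemma boundary_map_scale:
  assumes "t > 0"
  shows "boundary_map (t *\<^sub>R b) = t *\<^sub>R boundary_map b"
proof -
  have "displacement i (t *\<^sub>R b) = t * displacement i b" for i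
    using edge_map_scale[OF assms, of i "b $ i + b $ (i + 1)" "b $ (i + 1)"]
    by (simp add: displacement_def distrib_left right_diff_distrib)
  then show ?thesis
    by (simp add: boundary_map_def vec_eq_iff algebra_simps)
qed

lemma continuous_on_boundary_map: "continuous_on orthant boundary_map"
proof -
  have "continuous_on orthant (displacement i)" for i
    unfolding displacement_def edge_map_def
    by (intro continuous_intros continuous_on_stretch edge_compatible) (auto simp: orthant_def)
  then show ?thesis
    unfolding boundary_map_def by (intro continuous_intros)
qed

text \<open>The rank of a boundary point gives only the sum of its two root signs. The past root is
  strictly smaller unless \<open>b = 0\<close>, and then the five possible pairs of signs have
  different sums, so equal ranks force equal signs. Equal roots would make the boundary point
  \<open>b\<close> a multiple of the interior point \<open>c\<close>, hence 0.\<close>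

lemma root_sign_cases:
  assumes "b \<in> orthant_boundary"
  shows "sgn (future_root (comb u c) (comb u b)) =
      sgn (future_root (comb u' c') (comb u' (boundary_map b)))" (is "sgn ?h = sgn ?h'")
    and "sgn (past_root (comb u c) (comb u b)) =
      sgn (past_root (comb u' c') (comb u' (boundary_map b)))" (is "sgn ?l = sgn ?l'")
    and "past_root (comb u c) (comb u b) = future_root (comb u c) (comb u b) \<longleftrightarrow> b = 0"
    and "past_root (comb u' c') (comb u' (boundary_map b)) =
      future_root (comb u' c') (comb u' (boundary_map b)) \<longleftrightarrow> b = 0"
proof -
  have zero_iff: "past_root (comb w d) (comb w a) = future_root (comb w d) (comb w a) \<longleftrightarrow> a = 0"
    if w: "\<And>a. comb w a = 0 \<Longrightarrow> a = 0" and d: "\<And>i. d $ i > 0" "causal_rank (comb w d) = 2"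
      and a: "a \<in> orthant_boundary" for w d a
  proof
    have q: "mink (comb w d) (comb w d) < 0"
      using d(2) by (simp add: causal_rank_eq_2_iff)
    assume "past_root (comb w d) (comb w a) = future_root (comb w d) (comb w a)"
    then have "gram (comb w a) (comb w d) = 0"
      using past_root_less_future_root[OF q] by fastforce
    then obtain m where "comb w a = m *\<^sub>R comb w d"
      by (rule gram_zero_parallel[OF q])
    then have "comb w (a + (- m) *\<^sub>R d) = 0"
      by (simp only: comb_add comb_scale) simp
    then have a0: "a = m *\<^sub>R d"
      using w by fastforce
    then have "m = 0"
      using a d(1) by (auto simp: orthant_boundary_def) (metis less_irrefl)
    then show "a = 0" using a0 by simp
  qed (simp add: future_root_def past_root_def gram_def)
  have bb: "boundary_map b \<in> orthant_boundary" "b = 0 \<longleftrightarrow> boundary_map b = 0"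
    using boundary_map_boundary[OF assms] by (auto simp: vec_eq_iff)
  have le: "?l \<le> ?h" "?l' \<le> ?h'"
    using c(2) c'(2) by (simp_all add: past_root_le_future_root causal_rank_eq_2_iff)
  have iff: "?l = ?h \<longleftrightarrow> b = 0" "?l' = ?h' \<longleftrightarrow> b = 0"
    using zero_iff[OF indep c assms] zero_iff[OF indep' c' bb(1)] bb(2) by simp_all
  have eq: "- sgn ?h - sgn ?l = - sgn ?h' - sgn ?l'"
    using root_signs[OF c(2), of "comb u b"] root_signs[OF c'(2), of "comb u' (boundary_map b)"]
      boundary_map_boundary(3)[OF assms] by simp
  have "sgn ?h = sgn ?h' \<and> sgn ?l = sgn ?l'"
  proof (cases "b = 0")
    case True
    then show ?thesis
      using bb(2) by (simp add: future_root_def past_root_def gram_def)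
  next
    case False
    then have "?l < ?h" "?l' < ?h'"
      using le iff by auto
    then show ?thesis
      using eq by (auto simp: sgn_real_def split: if_splits)
  qed
  then show "sgn ?h = sgn ?h'" "sgn ?l = sgn ?l'" "?l = ?h \<longleftrightarrow> b = 0" "?l' = ?h' \<longleftrightarrow> b = 0"
    using iff by simp_all
qed

text \<open>Since the root signs agree, the clipped pieces shrink to length 0 on both sides at
  once.\<close>

lemma height_compatible:
  assumes "b \<in> orthant_boundary"
  shows "compatible (max 0 (past_root (comb u c) (comb u b))) (max 0 (future_root (comb u c) (comb u b)))
       (max 0 (past_root (comb u' c') (comb u' (boundary_map b))))
       (max 0 (future_root (comb u' c') (comb u' (boundary_map b))))"
    (is "compatible (max 0 ?l) (max 0 ?h) (max 0 ?l') (max 0 ?h')")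
proof -
  have le: "?l \<le> ?h" "?l' \<le> ?h'"
    using c(2) c'(2) by (simp_all add: past_root_le_future_root causal_rank_eq_2_iff)
  note s = root_sign_cases[OF assms]
  have zero: "?h = 0 \<and> ?h' = 0 \<and> ?l = 0 \<and> ?l' = 0" if "?l = ?h \<or> ?l' = ?h'"
  proof -
    have "b = 0" using that s(3,4) by blast
    then have "?h = 0" "?l = 0"
      by (simp_all add: future_root_def past_root_def gram_def)
    then show ?thesis
      using s(1,2) by (simp add: sgn_0_0)
  qed
  have "max 0 ?l = max 0 ?h \<longleftrightarrow> ?h \<le> 0" "max 0 ?l' = max 0 ?h' \<longleftrightarrow> ?h' \<le> 0"
    using le zero by (auto simp: max_def)
  moreover have "?h \<le> 0 \<longleftrightarrow> ?h' \<le> 0" "?l \<le> 0 \<longleftrightarrow> ?l' \<le> 0"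
    using s by (auto simp: sgn_real_def split: if_splits)
  ultimately show ?thesis
    using le by (auto simp: compatible_def max_def)
qed

lemma height_map_compare:
  assumes b: "b \<in> orthant_boundary" and "0 \<le> m"
  shows "0 \<le> height_map b m" "height_map b m = 0 \<longleftrightarrow> m = 0"
    "sgn (height_map b m - future_root (comb u' c') (comb u' (boundary_map b))) =
      sgn (m - future_root (comb u c) (comb u b))"
    "sgn (height_map b m - past_root (comb u' c') (comb u' (boundary_map b))) =
      sgn (m - past_root (comb u c) (comb u b))"
proof -
  note cmp = stretch_compare[OF height_compatible[OF b] \<open>0 \<le> m\<close> zero_less_one, folded height_map_def]
  show pos: "0 \<le> height_map b m"
    by (rule cmp(1))
  show "height_map b m = 0 \<longleftrightarrow> m = 0"
    unfolding height_map_def by (rule stretch_eq_0_iff[OF height_compatible[OF b] \<open>0 \<le> m\<close> zero_less_one])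
  \<comment> \<open>A nonnegative root is not affected by the clipping. A negative one is, but then
    every nonnegative height lies above the root on both sides.\<close>
  have aux: "sgn (x' - y') = sgn (x - y)"
    if "sgn y = sgn y'" "sgn (x' - max 0 y') = sgn (x - max 0 y)" "0 \<le> x" "0 \<le> x'" for x x' y y' :: real
    using that by (auto simp: sgn_real_def max_def split: if_splits)
  show "sgn (height_map b m - future_root (comb u' c') (comb u' (boundary_map b))) =
      sgn (m - future_root (comb u c) (comb u b))"
    by (rule aux[OF root_sign_cases(1)[OF b] cmp(3) \<open>0 \<le> m\<close> pos])
  show "sgn (height_map b m - past_root (comb u' c') (comb u' (boundary_map b))) =
      sgn (m - past_root (comb u c) (comb u b))"
    by (rule aux[OF root_sign_cases(2)[OF b] cmp(2) \<open>0 \<le> m\<close> pos])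
qed

text \<open>The definition of \<open>cone_map\<close> already writes the image as a boundary point
  plus a multiple of \<open>c'\<close>, and that decomposition is unique. The inverse can therefore
  be checked separately on base points and on heights.\<close>

lemma cone_map_coordinates:
  assumes "a \<in> orthant"
  shows "base_point c' (cone_map a) = boundary_map (base_point c a)"
    and "apex_coord c' (cone_map a) = height_map (base_point c a) (apex_coord c a)"
proof -
  have b: "boundary_map (base_point c a) \<in> orthant_boundary"
    by (intro boundary_map_boundary base_point_boundary c)
  show ap: "apex_coord c' (cone_map a) = height_map (base_point c a) (apex_coord c a)"
    unfolding cone_map_def by (rule apex_coord_boundary[OF c'(1) b])
  show "base_point c' (cone_map a) = boundary_map (base_point c a)"
    unfolding base_point_def[of c' "cone_map a"] ap by (simp add: cone_map_def)
qed

lemma causal_rank_cone_map: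
  assumes "a \<in> orthant"
  shows "causal_rank (comb u' (cone_map a)) = causal_rank (comb u a)"
proof -
  let ?b = "base_point c a" and ?m = "apex_coord c a"
  have b: "?b \<in> orthant_boundary"
    by (rule base_point_boundary[OF c(1)])
  have "0 \<le> ?m"
    by (rule apex_coord_nonneg[OF c(1) assms])
  note cmp = height_map_compare[OF b this]
  have "causal_rank (comb u a) = causal_rank (comb u (?b + ?m *\<^sub>R c))"
    by (simp only: base_point_apex)
  also have "\<dots> = causal_rank (comb u' (cone_map a))"
    by (simp add: cone_map_def comb_add comb_scale causal_rank_line[OF c(2)] causal_rank_line[OF c'(2)] cmp)
  finally show ?thesis ..
qed

lemma orthant_map_cone_map: "orthant_map cone_map"
  unfolding orthant_map_def
proof (intro conjI ballI allI impI)
  have b: "base_point c a \<in> orthant_boundary" for a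
    by (rule base_point_boundary[OF c(1)])
  have bb: "boundary_map (base_point c a) \<in> orthant_boundary" for a
    by (rule boundary_map_boundary(1)[OF b])
  have m: "0 \<le> apex_coord c a" if "a \<in> orthant" for a
    by (rule apex_coord_nonneg[OF c(1) that])
  have cn: "continuous_on orthant (\<lambda>a. base_point c a)" "continuous_on orthant (\<lambda>a. apex_coord c a)"
    using continuous_on_base_point[OF c(1)] continuous_on_apex_coord[OF c(1)] by simp_all
  have cb: "continuous_on orthant (\<lambda>a. boundary_map (base_point c a))"
    by (rule continuous_on_compose2[OF continuous_on_boundary_map cn(1)])
      (use b in \<open>auto simp: orthant_boundary_def\<close>)
  have cc: "continuous_on S (\<lambda>a. comb w (f a))" if "continuous_on S f" for S :: "(real^3) set" and w f
    unfolding comb_def by (intro continuous_intros that)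
  have cr: "continuous_on S (\<lambda>a. future_root C (f a))" "continuous_on S (\<lambda>a. past_root C (f a))"
    if "continuous_on S f" "causal_rank C = 2" for S :: "(real^3) set" and C f
  proof -
    have "mink C C \<noteq> 0"
      using that(2) by (simp add: causal_rank_eq_2_iff)
    moreover have "continuous_on S (\<lambda>a. mink (f a) (f a))" "continuous_on S (\<lambda>a. mink (f a) C)"
      unfolding mink_def by (intro continuous_intros that(1))+
    ultimately show "continuous_on S (\<lambda>a. future_root C (f a))" "continuous_on S (\<lambda>a. past_root C (f a))"
      unfolding future_root_def past_root_def gram_def by (intro continuous_intros; simp)+
  qed
  have ch: "continuous_on orthant (\<lambda>a. height_map (base_point c a) (apex_coord c a))"
    unfolding height_map_def
  proof (rule continuous_on_stretch)
    show "continuous_on orthant (\<lambda>a. max 0 (past_root (comb u c) (comb u (base_point c a))))"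
      "continuous_on orthant (\<lambda>a. max 0 (future_root (comb u c) (comb u (base_point c a))))"
      by (rule continuous_on_max[OF continuous_on_const cr(2)[OF cc[OF cn(1)] c(2)]]
          continuous_on_max[OF continuous_on_const cr(1)[OF cc[OF cn(1)] c(2)]])+
    show "continuous_on orthant (\<lambda>a. max 0 (past_root (comb u' c') (comb u' (boundary_map (base_point c a)))))"
      "continuous_on orthant (\<lambda>a. max 0 (future_root (comb u' c') (comb u' (boundary_map (base_point c a)))))"
      by (rule continuous_on_max[OF continuous_on_const cr(2)[OF cc[OF cb] c'(2)]]
          continuous_on_max[OF continuous_on_const cr(1)[OF cc[OF cb] c'(2)]])+
  qed (rule height_compatible b m cn | assumption)+
  show "continuous_on orthant cone_map"
    unfolding cone_map_def by (intro continuous_on_add continuous_on_scaleR continuous_on_const cb ch)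
  show "cone_map ` orthant \<subseteq> orthant"
  proof
    fix x assume "x \<in> cone_map ` orthant"
    then obtain a where a: "a \<in> orthant" "x = cone_map a" by blast
    have "0 \<le> height_map (base_point c a) (apex_coord c a) * c' $ i" for i
      using height_map_compare(1)[OF b m[OF a(1)]] c'(1)[of i] by simp
    then show "x \<in> orthant"
      using bb[of a] by (simp add: a(2) cone_map_def orthant_def orthant_boundary_def)
  qed
  fix a assume a: "a \<in> orthant"
  fix i
  let ?b = "base_point c a" and ?m = "apex_coord c a"
  have nn: "0 \<le> ?b $ i" "0 \<le> boundary_map ?b $ i" "0 < c $ i" "0 < c' $ i"
    using b[of a] bb[of a] c(1) c'(1) by (simp_all add: orthant_boundary_def orthant_def)
  have "a $ i = ?b $ i + ?m * c $ i"
    by (simp add: base_point_def)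
  then have "a $ i = 0 \<longleftrightarrow> ?b $ i = 0 \<and> ?m = 0"
    using nn m[OF a] by (simp add: add_nonneg_eq_0_iff)
  moreover have "cone_map a $ i = 0 \<longleftrightarrow> boundary_map ?b $ i = 0 \<and> height_map ?b ?m = 0"
    using nn height_map_compare(1)[OF b m[OF a]] by (simp add: cone_map_def add_nonneg_eq_0_iff)
  ultimately show "cone_map a $ i = 0 \<longleftrightarrow> a $ i = 0"
    using boundary_map_boundary(2)[OF b] height_map_compare(2)[OF b m[OF a]] by simp
next
  fix a t assume "a \<in> orthant" and t: "(0::real) < t"
  have mx: "max 0 (t * x) = t * max 0 x" for x
    using t by (auto simp: max_def zero_le_mult_iff)
  have "height_map (t *\<^sub>R b) (t * m) = t * height_map b m" for b m
    using t by (simp add: height_map_def boundary_map_scale comb_scale roots_scale mx stretch_scale)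
  then show "cone_map (t *\<^sub>R a) = t *\<^sub>R cone_map a"
    using t by (simp add: cone_map_def base_point_scale apex_coord_scale boundary_map_scale scaleR_add_right)
qed

end

section \<open>Inverses by exchanging the two frames\<close>

lemma matched_frames_sym:
  "matched_frames u u' l h l' h' K c c' \<Longrightarrow> matched_frames u' u l' h' l h K c' c"
  unfolding matched_frames_def by (intro conjI; elim conjE; assumption)

lemma edge_map_inverse:
  assumes M: "matched_frames u u' l h l' h' K c c'" and "0 \<le> s" "0 \<le> y"
  shows "matched_frames.edge_map l' h' l h i s (matched_frames.edge_map l h l' h' i s y) = y"
proof -
  have "1 / ((1 - h' i) / (1 - h i)) = (1 - h i) / (1 - h' i)"
    by simp
  then show ?thesis
    using stretch_inverse[OF matched_frames.edge_compatible[OF M assms(2)] assms(3)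
      matched_frames.edge_factor_pos[OF M, of i], of i]
    by (simp only: matched_frames.edge_map_def[OF M] matched_frames.edge_map_def[OF matched_frames_sym[OF M]])
qed

lemma boundary_map_inverse:
  assumes M: "matched_frames u u' l h l' h' K c c'" and b: "b \<in> orthant_boundary"
  shows "matched_frames.boundary_map l' h' l h (matched_frames.boundary_map l h l' h' b) = b"
proof -
  interpret M: matched_frames u u' l h l' h' K c c' by (rule M)
  interpret W: matched_frames u' u l' h' l h K c' c by (rule matched_frames_sym[OF M])
  obtain k where o: "b \<in> orthant" and k: "b $ k = 0"
    using b by (auto simp: orthant_boundary_def)
  note e1 = M.boundary_map_edge[OF o k]
  have o2: "M.boundary_map b \<in> orthant"
    using M.boundary_map_boundary(1)[OF b] by (simp add: orthant_boundary_def)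
  note e2 = W.boundary_map_edge[OF o2 e1(1)]
  \<comment> \<open>Both edge maps are taken with the same \<open>s\<close>, which makes them
    inverse to each other.\<close>
  have sum: "M.boundary_map b $ (k + 1) + M.boundary_map b $ (k + 2) = b $ (k + 1) + b $ (k + 2)"
    by (simp add: e1)
  have nn: "0 \<le> b $ i" for i
    using o by (simp add: orthant_def)
  have "W.edge_map (k + 1) (b $ (k + 1) + b $ (k + 2)) (M.boundary_map b $ (k + 2)) = b $ (k + 2)"
    unfolding e1(3) by (intro edge_map_inverse[OF M] add_nonneg_nonneg nn)
  then have "W.boundary_map (M.boundary_map b) $ i = b $ i" for i
    using index3_cases[of i k] k e2[unfolded sum] by auto
  then show ?thesis
    by (simp add: vec_eq_iff)
qed

lemma cone_map_inverse:
  assumes M: "matched_frames u u' l h l' h' K c c'" and a: "a \<in> orthant"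
  shows "matched_frames.cone_map u' u l' h' l h c' c (matched_frames.cone_map u u' l h l' h' c c' a) = a"
proof -
  interpret M: matched_frames u u' l h l' h' K c c' by (rule M)
  interpret W: matched_frames u' u l' h' l h K c' c by (rule matched_frames_sym[OF M])
  let ?b = "base_point c a" and ?m = "apex_coord c a"
  have b: "?b \<in> orthant_boundary"
    by (rule base_point_boundary[OF M.c(1)])
  have m: "0 \<le> ?m"
    by (rule apex_coord_nonneg[OF M.c(1) a])
  have "W.height_map (M.boundary_map ?b) (M.height_map ?b ?m) = ?m"
    using stretch_inverse[OF M.height_compatible[OF b] m zero_less_one]
    by (simp add: W.height_map_def M.height_map_def boundary_map_inverse[OF M b])
  then show ?thesis
    unfolding W.cone_map_def M.cone_map_coordinates[OF a] boundary_map_inverse[OF M b]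
    by (simp add: base_point_apex)
qed

lemma matched_frames_orthant_maps:
  assumes M: "matched_frames u u' l h l' h' K c c'"
  obtains F G where "orthant_map F" "orthant_map G"
    "\<And>a. a \<in> orthant \<Longrightarrow> G (F a) = a" "\<And>a. a \<in> orthant \<Longrightarrow> F (G a) = a"
    "\<And>a. a \<in> orthant \<Longrightarrow> causal_rank (comb u' (F a)) = causal_rank (comb u a)"
proof -
  note M' = matched_frames_sym[OF M]
  show thesis
    by (rule that[OF matched_frames.orthant_map_cone_map[OF M] matched_frames.orthant_map_cone_map[OF M']
          cone_map_inverse[OF M] cone_map_inverse[OF M'] matched_frames.causal_rank_cone_map[OF M]])
qed

subsection \<open>Edges\<close>

text \<open>Cramer's rule with determinant \<open>gram X Y\<close>: a plane that is not null
  contains no nonzero vector orthogonal to the whole plane. This is how the absence of null faces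
  excludes tangency to the light cone.\<close>

lemma combination_orthogonal:
  assumes "mink (a *\<^sub>R X + b *\<^sub>R Y) X = 0" "mink (a *\<^sub>R X + b *\<^sub>R Y) Y = 0" "gram X Y \<noteq> 0"
  shows "a = 0 \<and> b = 0"
proof -
  have e: "a * mink X X + b * mink X Y = 0" "a * mink X Y + b * mink Y Y = 0"
    using assms(1,2) by (simp_all add: mink_add mink_scale mink_commute[of Y X])
  have "a * gram X Y = (a * mink X X + b * mink X Y) * mink Y Y - (a * mink X Y + b * mink Y Y) * mink X Y"
    "b * gram X Y = (a * mink X Y + b * mink Y Y) * mink X X - (a * mink X X + b * mink X Y) * mink X Y"
    by (simp_all add: gram_def power2_eq_square algebra_simps)
  then have "a * gram X Y = 0" "b * gram X Y = 0"
    by (simp_all only: e mult_zero_left diff_self)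
  then show ?thesis
    using assms(3) by simp
qed

text \<open>Since \<open>Z\<close> is null, the form at Z + d V begins with the negative linear term
  2 d \<open>mink Z V\<close>. The new vector is future because its product with the future null
  vector \<open>Z\<close> is negative.\<close>

lemma causal_rank_push:
  assumes Z: "causal_rank Z = 1" and V: "mink Z V < 0"
  obtains d where "d > 0" "causal_rank (Z + d *\<^sub>R V) = 2"
proof -
  have z: "mink Z Z = 0" "Z $ 1 > 0"
    using Z by (auto simp: causal_rank_def sgn_real_def split: if_splits)
  \<comment> \<open>For spacelike \<open>V\<close> this is the minimiser of the quadratic in
    \<open>d\<close>; for the other \<open>V\<close> every positive \<open>d\<close> makes it
    negative.\<close>
  define d where "d = (if mink V V \<le> 0 then 1 else - mink Z V / mink V V)"
  have d: "d > 0"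
    using V by (simp add: d_def divide_neg_pos)
  let ?W = "Z + d *\<^sub>R V"
  have "mink ?W ?W = 2 * d * mink Z V + d * d * mink V V"
    by (simp add: mink_add mink_scale z(1) mink_commute[of V Z] algebra_simps)
  also have "\<dots> < 0"
  proof (cases "mink V V \<le> 0")
    case True
    then show ?thesis using V by (simp add: d_def)
  next
    case False
    then have "2 * d * mink Z V + d * d * mink V V = - (mink Z V)\<^sup>2 / mink V V"
      by (simp add: d_def power2_eq_square field_simps)
    also have "\<dots> < 0"
      using V False by (simp add: divide_neg_pos)
    finally show ?thesis .
  qed
  finally have W: "mink ?W ?W < 0" .
  have neg: "mink Z ?W < 0"
    using V d by (simp add: mink_add mink_scale z(1) mult_pos_neg)
  have "?W \<noteq> 0"
    using W by (metis mink_zero(1) less_irrefl)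
  then have nz: "?W $ 1 \<noteq> 0"
    using W by (intro time_component_nonzero) auto
  have "?W $ 1 > 0"
  proof (rule ccontr)
    assume "\<not> ?W $ 1 > 0"
    then have "(- ?W) $ 1 > 0"
      using nz by (simp only: vector_uminus_component)
    moreover have "mink (- ?W) (- ?W) < 0"
      using W by (simp only: mink_minus minus_minus)
    ultimately have "sgn (Z $ 1) = - sgn (mink Z (- ?W))"
      using z(1) by (intro sgn_time_component) auto
    then show False
      using neg z(2) unfolding mink_minus by simp
  qed
  then have "causal_rank ?W = 2"
    using W by (simp add: causal_rank_eq_2_iff)
  with d that show thesis by blast
qed

section \<open>Crossings along a segment\<close>

lemma sgn_diff_swap: "sgn (x - y) = - sgn (y - x)" for x y :: real
  by (simp add: sgn_real_def)

text \<open>Division by \<open>t\<close> turns the segment into the line Y + m X at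
  \<open>m = (1 - t) / t\<close>. Clearing the denominator makes the formula hold at
  \<open>t = 0\<close> as well.\<close>

lemma causal_rank_segment:
  assumes X: "causal_rank X = 2" and t: "0 \<le> t" "t \<le> 1"
  shows "causal_rank ((1 - t) *\<^sub>R X + t *\<^sub>R Y) =
    sgn (1 - t * (1 + future_root X Y)) + sgn (1 - t * (1 + past_root X Y))"
proof (cases "t = 0")
  case True
  then show ?thesis using X by simp
next
  case False
  then have t': "t > 0" using t by simp
  have "(1 - t) *\<^sub>R X + t *\<^sub>R Y = t *\<^sub>R (Y + ((1 - t) / t) *\<^sub>R X)"
    using t' by (simp add: scaleR_add_right)
  then have "causal_rank ((1 - t) *\<^sub>R X + t *\<^sub>R Y) = causal_rank (Y + ((1 - t) / t) *\<^sub>R X)"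
    using t' by (simp add: causal_rank_scale)
  also have "\<dots> = sgn ((1 - t) / t - future_root X Y) + sgn ((1 - t) / t - past_root X Y)"
    by (rule causal_rank_line[OF X])
  finally have eq: "causal_rank ((1 - t) *\<^sub>R X + t *\<^sub>R Y) =
      sgn ((1 - t) / t - future_root X Y) + sgn ((1 - t) / t - past_root X Y)" .
  have "sgn ((1 - t) / t - r) = sgn (1 - t * (1 + r))" for r
  proof -
    have "1 - t * (1 + r) = t * ((1 - t) / t - r)"
    proof -
      have A: "t * ((1 - t) / t) = 1 - t" using t' by simp
      show ?thesis by (simp only: right_diff_distrib A) (simp add: algebra_simps)
    qed
    then show ?thesis using t' by (simp add: sgn_mult)
  qed
  then show ?thesis by (simp only: eq)
qed

text \<open>A positive root \<open>r\<close> of the line is met on the segment at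
  \<open>1 / (1 + r)\<close>, the solution of \<open>(1 - t) / t = r\<close>.\<close>

lemma sgn_segment_parameter:
  fixes r :: real
  assumes "r > 0"
  shows "sgn (1 - t * (1 + r)) = sgn (1 / (1 + r) - t)" "0 < 1 / (1 + r)" "1 / (1 + r) < 1"
proof -
  have "1 - t * (1 + r) = (1 + r) * (1 / (1 + r) - t)"
  proof -
    have A: "(1 + r) * (1 / (1 + r)) = 1" using assms by simp
    show ?thesis by (simp only: right_diff_distrib A) (simp add: mult.commute)
  qed
  then show "sgn (1 - t * (1 + r)) = sgn (1 / (1 + r) - t)"
    using assms by (simp add: sgn_mult)
qed (use assms in simp_all)

lemma sgn_segment_negative:
  assumes "r < 0" "0 \<le> t" "t \<le> 1"
  shows "sgn (1 - t * (1 + r)) = (1::real)"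
proof -
  have "t * (1 + r) < 1"
  proof (cases "t = 0")
    case False
    then have "t * r < 0" using assms by (simp add: mult_pos_neg)
    then show ?thesis using assms by (simp add: distrib_left)
  qed simp
  then show ?thesis by simp
qed

text \<open>A spacelike \<open>Y\<close> has rank 0, so its two roots, being distinct, have opposite
  signs; only the positive one is met between \<open>X\<close> and \<open>Y\<close>.\<close>

lemma single_crossing:
  assumes X: "causal_rank X = 2" and Y: "mink Y Y > 0"
  obtains s where "0 < s" "s < 1"
    "\<And>t. 0 \<le> t \<Longrightarrow> t \<le> 1 \<Longrightarrow> causal_rank ((1 - t) *\<^sub>R X + t *\<^sub>R Y) = 1 + sgn (s - t)"
proof -
  have q: "mink X X < 0"
    using X by (simp add: causal_rank_eq_2_iff)
  have "gram Y X < 0"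
    using Y q by (simp add: gram_def mult_pos_neg add_nonneg_pos) (smt (verit) mult_pos_neg zero_le_power2)
  then have "past_root X Y < future_root X Y"
    by (intro past_root_less_future_root q) simp
  moreover have "sgn (future_root X Y) + sgn (past_root X Y) = 0"
    using root_signs[OF X, of Y] Y by (simp add: causal_rank_def)
  ultimately have r: "future_root X Y > 0" "past_root X Y < 0"
    by (auto simp: sgn_real_def split: if_splits)
  show thesis
    by (rule that[of "1 / (1 + future_root X Y)"])
      (simp_all only: sgn_segment_parameter(2,3)[OF r(1)] causal_rank_segment[OF X]
        sgn_segment_parameter(1)[OF r(1)] sgn_segment_negative[OF r(2)])
qed

lemma edge_pattern_minus:
  assumes "edge_pattern (- X) (- Y) (k0, k1, k2) lo hi"
  shows "edge_pattern X Y (- k0, - k1, - k2) lo hi"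
proof -
  have "(1 - t) *\<^sub>R (- X) + t *\<^sub>R (- Y) = - ((1 - t) *\<^sub>R X + t *\<^sub>R Y)" for t
    by simp
  then have "causal_rank ((1 - t) *\<^sub>R X + t *\<^sub>R Y) = - causal_rank ((1 - t) *\<^sub>R (- X) + t *\<^sub>R (- Y))" for t
    by (metis causal_rank_uminus minus_minus)
  then show ?thesis
    using assms by (simp add: edge_pattern_def algebra_simps)
qed

lemma edge_pattern_swap:
  assumes "edge_pattern Y X (k0, k1, k2) lo hi"
  shows "edge_pattern X Y (k0, - k2, - k1) (1 - hi) (1 - lo)"
  unfolding edge_pattern_def
proof (intro conjI ballI)
  fix t :: real assume t: "t \<in> {0..1}"
  then have "1 - t \<in> {0..1}" by simp
  then have "causal_rank ((1 - (1 - t)) *\<^sub>R Y + (1 - t) *\<^sub>R X) = k0 + k1 * sgn (1 - t - lo) + k2 * sgn (1 - t - hi)"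
    using assms unfolding edge_pattern_def fst_conv snd_conv by blast
  moreover have "sgn (1 - t - x) = - sgn (t - (1 - x))" for x
    by (simp add: sgn_real_def)
  ultimately show "causal_rank ((1 - t) *\<^sub>R X + t *\<^sub>R Y) = fst (k0, - k2, - k1) +
      fst (snd (k0, - k2, - k1)) * sgn (t - (1 - hi)) + snd (snd (k0, - k2, - k1)) * sgn (t - (1 - lo))"
    by (simp add: add.commute)
qed (use assms in \<open>auto simp: edge_pattern_def\<close>)

text \<open>Meant for two spacelike ends in a plane that is not null. At most one of the cones is
  then met, as \<open>edge_sign_iff\<close> shows, so the order of the two tests does not
  matter.\<close>

definition edge_sign :: "real^3 \<Rightarrow> real^3 \<Rightarrow> real" where
  "edge_sign X Y =
     (if \<exists>t\<in>{0..1}. causal_rank ((1 - t) *\<^sub>R X + t *\<^sub>R Y) = 1 then 1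
      else if \<exists>t\<in>{0..1}. causal_rank ((1 - t) *\<^sub>R X + t *\<^sub>R Y) = - 1 then - 1 else 0)"

text \<open>The coefficients \<open>(k0, k1, k2)\<close> of \<open>edge_pattern\<close> between ends
  of rank \<open>r\<close> and \<open>s\<close>, so that \<open>k0 - k1 - k2 = r\<close> and
  \<open>k0 + k1 + k2 = s\<close>. A single crossing sits at the later parameter if the edge starts
  spacelike and at the earlier one if it ends spacelike, which makes the definition fit the reversal
  of edges.\<close>

definition jumps :: "real \<Rightarrow> real \<Rightarrow> real \<Rightarrow> real \<times> real \<times> real" where
  "jumps r s e =
     (if r = 0 \<and> s = 0 then (0, e, - e)
      else if r = 0 then (s / 2, 0, s / 2)
      else if s = 0 then (r / 2, - r / 2, 0)
      else ((r + s) / 2, (s - r) / 4, (s - r) / 4))"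

lemma nonnull_rank: "mink X X \<noteq> 0 \<Longrightarrow> causal_rank X \<in> {- 2, 0, 2}"
  using causal_rank_null_iff[of X] causal_rank_cases[of X] by (auto simp: abs_if split: if_splits)

lemma edge_pattern_future:
  assumes X: "causal_rank X = 2" and Y: "mink Y Y \<noteq> 0" and g: "gram X Y \<noteq> 0"
  obtains lo hi where "edge_pattern X Y (jumps 2 (causal_rank Y) e) lo hi"
proof -
  let ?h = "future_root X Y" and ?l = "past_root X Y"
  have less: "?l < ?h"
    using X g by (intro past_root_less_future_root)
      (simp_all add: causal_rank_eq_2_iff gram_def mink_commute mult.commute)
  note sum = root_signs[OF X, of Y]
  consider "causal_rank Y = 2" | "causal_rank Y = 0" | "causal_rank Y = - 2"
    using nonnull_rank[OF Y] by blast
  then show thesis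
  proof cases
    case y: 1
    then have 1: "?h < 0" "?l < 0"
      using sum less by (auto simp: sgn_real_def split: if_splits)
    have "causal_rank ((1 - t) *\<^sub>R X + t *\<^sub>R Y) = 2" if "0 \<le> t" "t \<le> 1" for t
      by (simp only: causal_rank_segment[OF X that] sgn_segment_negative[OF 1(1) that]
          sgn_segment_negative[OF 1(2) that])
    \<comment> \<open>Both jumps have height 0 here, and the two parameters are arbitrary.\<close>
    then have "edge_pattern X Y (jumps 2 (causal_rank Y) e) (1/3) (2/3)"
      by (simp add: edge_pattern_def jumps_def y)
    then show thesis by (rule that)
  next
    case y: 2
    then have "mink Y Y > 0"
      using Y by (auto simp: causal_rank_eq_0_iff)
    then obtain s where s: "0 < s" "s < 1"
      "\<And>t. 0 \<le> t \<Longrightarrow> t \<le> 1 \<Longrightarrow> causal_rank ((1 - t) *\<^sub>R X + t *\<^sub>R Y) = 1 + sgn (s - t)"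
      by (rule single_crossing[OF X]) blast
    have "causal_rank ((1 - t) *\<^sub>R X + t *\<^sub>R Y) = 1 - sgn (t - s)" if "0 \<le> t" "t \<le> 1" for t
      using s(3)[OF that] sgn_diff_swap[of s t] by linarith
    \<comment> \<open>The only crossing is at \<open>s\<close>. The second jump has height 0, and
      its parameter is just some number between \<open>s\<close> and 1.\<close>
    then have "edge_pattern X Y (jumps 2 (causal_rank Y) e) s ((1 + s) / 2)"
      using s(1,2) by (simp add: edge_pattern_def jumps_def y)
    then show thesis by (rule that)
  next
    case y: 3
    then have 3: "?h > 0" "?l > 0"
      using sum less by (auto simp: sgn_real_def split: if_splits)
    have "1 / (1 + ?h) < 1 / (1 + ?l)"
      using 3 less by (simp add: frac_less2)
    moreover have "causal_rank ((1 - t) *\<^sub>R X + t *\<^sub>R Y) = - sgn (t - 1 / (1 + ?h)) - sgn (t - 1 / (1 + ?l))"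
      if "0 \<le> t" "t \<le> 1" for t
      using causal_rank_segment[OF X that, of Y] sgn_segment_parameter(1)[OF 3(1), of t]
        sgn_segment_parameter(1)[OF 3(2), of t] sgn_diff_swap[of "1 / (1 + ?h)" t]
        sgn_diff_swap[of "1 / (1 + ?l)" t] by linarith
    ultimately have "edge_pattern X Y (jumps 2 (causal_rank Y) e) (1 / (1 + ?h)) (1 / (1 + ?l))"
      using sgn_segment_parameter(2)[OF 3(1)] sgn_segment_parameter(3)[OF 3(2)]
      unfolding edge_pattern_def by (auto simp: jumps_def y)
    then show thesis by (rule that)
  qed
qed

lemma edge_pattern_timelike:
  assumes X: "causal_rank X = 2 \<or> causal_rank X = - 2" and Y: "mink Y Y \<noteq> 0" and g: "gram X Y \<noteq> 0"
  obtains lo hi where "edge_pattern X Y (jumps (causal_rank X) (causal_rank Y) e) lo hi"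
  using X
proof
  assume "causal_rank X = 2"
  then show thesis using edge_pattern_future[of X Y e] assms that by metis
next
  assume x: "causal_rank X = - 2"
  obtain lo hi where E: "edge_pattern (- X) (- Y) (jumps 2 (causal_rank (- Y)) e) lo hi"
    by (rule edge_pattern_future[of "- X" "- Y" e])
      (use x Y g in \<open>simp_all add: causal_rank_uminus mink_minus gram_def\<close>)
  obtain k0 k1 k2 where K: "jumps 2 (causal_rank (- Y)) e = (k0, k1, k2)"
    by (cases "jumps 2 (causal_rank (- Y)) e") auto
  have "(- k0, - k1, - k2) = jumps (causal_rank X) (causal_rank Y) e"
    using K by (auto simp: jumps_def x causal_rank_uminus field_simps split: if_splits)
  then show thesis
    using edge_pattern_minus[OF E[unfolded K]] that by metis
qed

text \<open>A null point on the edge cannot be a tangency, so it can be pushed along the edge into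
  the timelike cone. The timelike point found there divides the edge into two pieces with one
  crossing each.\<close>

lemma edge_pattern_spacelike_future:
  assumes X: "mink X X > 0" and Y: "mink Y Y > 0" and g: "gram X Y \<noteq> 0"
    and t: "t \<in> {0..1}" "causal_rank ((1 - t) *\<^sub>R X + t *\<^sub>R Y) = 1"
  obtains lo hi where "edge_pattern X Y (0, 1, - 1) lo hi"
proof -
  let ?Z = "(1 - t) *\<^sub>R X + t *\<^sub>R Y"
  have z: "mink ?Z ?Z = 0"
    using t(2) causal_rank_null_iff[of ?Z] by simp
  have r: "causal_rank X = 0" "causal_rank Y = 0"
    using X Y by (simp_all add: causal_rank_eq_0_iff)
  have "\<exists>x y. 0 \<le> x \<and> 0 \<le> y \<and> causal_rank (x *\<^sub>R X + y *\<^sub>R Y) = 2"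
  proof -
    \<comment> \<open>\<open>?Z\<close> is orthogonal to itself, so its weighted products with the
      two ends cancel. Either one product is negative, and pushing towards that end works, or both
      vanish, which is impossible in a plane that is not null.\<close>
    have sum: "(1 - t) * mink ?Z X + t * mink ?Z Y = 0"
      using z by (simp add: mink_add mink_scale)
    have t01: "0 < t" "t < 1"
      using t r by (auto simp: less_le)
    consider "mink ?Z X < 0" | "mink ?Z Y < 0" | "mink ?Z X = 0" "mink ?Z Y = 0"
      | "mink ?Z X > 0" "mink ?Z Y \<ge> 0" | "mink ?Z X \<ge> 0" "mink ?Z Y > 0"
      by linarith
    then show ?thesis
    proof cases
      case 1
      then obtain d where "d > 0" "causal_rank (?Z + d *\<^sub>R X) = 2"
        by (rule causal_rank_push[OF t(2)])
      moreover have "?Z + d *\<^sub>R X = (1 - t + d) *\<^sub>R X + t *\<^sub>R Y"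
        by (simp add: algebra_simps)
      ultimately show ?thesis
        using t01 by (intro exI[of _ "1 - t + d"] exI[of _ t]) simp
    next
      case 2
      then obtain d where "d > 0" "causal_rank (?Z + d *\<^sub>R Y) = 2"
        by (rule causal_rank_push[OF t(2)])
      moreover have "?Z + d *\<^sub>R Y = (1 - t) *\<^sub>R X + (t + d) *\<^sub>R Y"
        by (simp add: algebra_simps)
      ultimately show ?thesis
        using t01 by (intro exI[of _ "1 - t"] exI[of _ "t + d"]) simp
    next
      case 3
      then show ?thesis
        using combination_orthogonal[OF 3 g] t01 by simp
    next
      case 4
      then show ?thesis
        using sum mult_pos_pos[of "1 - t" "mink ?Z X"] mult_nonneg_nonneg[of t "mink ?Z Y"] t01
        by linarith
    next
      case 5
      then show ?thesis
        using sum mult_nonneg_nonneg[of "1 - t" "mink ?Z X"] mult_pos_pos[of t "mink ?Z Y"] t01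
        by linarith
    qed
  qed
  then obtain x y where xy: "0 \<le> x" "0 \<le> y" and c: "causal_rank (x *\<^sub>R X + y *\<^sub>R Y) = 2"
    by blast
  have pos: "x > 0" "y > 0"
  proof -
    have "causal_rank (z *\<^sub>R W) = 0" if "causal_rank W = 0" "0 \<le> z" for z W
      using that causal_rank_scale[of z W] by (cases "z = 0") auto
    then have "x \<noteq> 0" "y \<noteq> 0"
      using c r xy by auto
    then show "x > 0" "y > 0" using xy by simp_all
  qed
  define p where "p = y / (x + y)"
  have p: "0 < p" "p < 1"
    using pos by (simp_all add: p_def)
  define C where "C = (1 - p) *\<^sub>R X + p *\<^sub>R Y"
  have "x *\<^sub>R X + y *\<^sub>R Y = (x + y) *\<^sub>R C"
  proof -
    have "(x + y) * (1 - p) = x" "(x + y) * p = y"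
    proof -
      show "(x + y) * p = y" using pos by (simp add: p_def)
      then show "(x + y) * (1 - p) = x" by (simp only: right_diff_distrib) simp
    qed
    then show ?thesis
      by (simp only: C_def scaleR_add_right scaleR_scaleR)
  qed
  then have C: "causal_rank C = 2"
    using c pos by (simp add: causal_rank_scale)
  obtain s1 where s1: "0 < s1" "s1 < 1"
    "\<And>t. 0 \<le> t \<Longrightarrow> t \<le> 1 \<Longrightarrow> causal_rank ((1 - t) *\<^sub>R C + t *\<^sub>R X) = 1 + sgn (s1 - t)"
    by (rule single_crossing[OF C X]) blast
  obtain s2 where s2: "0 < s2" "s2 < 1"
    "\<And>t. 0 \<le> t \<Longrightarrow> t \<le> 1 \<Longrightarrow> causal_rank ((1 - t) *\<^sub>R C + t *\<^sub>R Y) = 1 + sgn (s2 - t)"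
    by (rule single_crossing[OF C Y]) blast
  \<comment> \<open>\<open>s1\<close> and \<open>s2\<close> are measured from \<open>C\<close>
    towards \<open>X\<close> and \<open>Y\<close>; \<open>lo\<close> and \<open>hi\<close> are the
    same points measured from \<open>X\<close>.\<close>
  define lo hi where "lo = p * (1 - s1)" and "hi = p + s2 * (1 - p)"
  have lo: "0 < lo" "lo < p"
    using p s1(1,2) by (simp_all add: lo_def)
  have "s2 * (1 - p) < 1 * (1 - p)" "0 < s2 * (1 - p)"
    using p s2(1,2) by (auto intro!: mult_strict_right_mono)
  then have hi: "p < hi" "hi < 1"
    by (simp_all add: hi_def)
  have "causal_rank ((1 - t) *\<^sub>R X + t *\<^sub>R Y) = sgn (t - lo) - sgn (t - hi)" if t: "0 \<le> t" "t \<le> 1" for t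
  proof (cases "t \<le> p")
    case True
    define q where "q = (p - t) / p"
    have q: "0 \<le> q" "q \<le> 1" "t = p * (1 - q)"
      using True p t by (simp_all add: q_def field_simps)
    have "(1 - t) *\<^sub>R X + t *\<^sub>R Y = (1 - q) *\<^sub>R C + q *\<^sub>R X"
      by (simp add: C_def q(3) algebra_simps)
    then have "causal_rank ((1 - t) *\<^sub>R X + t *\<^sub>R Y) = 1 + sgn (s1 - q)"
      using s1(3)[OF q(1,2)] by simp
    moreover have "t - lo = p * (s1 - q)"
      by (simp add: q(3) lo_def algebra_simps)
    then have "sgn (t - lo) = sgn (s1 - q)"
      using p by (simp add: sgn_mult)
    ultimately show ?thesis using True hi by simp
  next
    case False
    define q where "q = (t - p) / (1 - p)"
    have q: "0 \<le> q" "q \<le> 1" "t = p + q * (1 - p)"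
      using False p t by (simp_all add: q_def field_simps)
    have "(1 - t) *\<^sub>R X + t *\<^sub>R Y = (1 - q) *\<^sub>R C + q *\<^sub>R Y"
      by (simp add: C_def q(3) algebra_simps)
    then have "causal_rank ((1 - t) *\<^sub>R X + t *\<^sub>R Y) = 1 + sgn (s2 - q)"
      using s2(3)[OF q(1,2)] by simp
    moreover have "hi - t = (1 - p) * (s2 - q)"
      by (simp add: q(3) hi_def algebra_simps)
    then have "sgn (hi - t) = sgn (s2 - q)"
      using p by (simp add: sgn_mult)
    moreover have "sgn (hi - t) = - sgn (t - hi)" by (rule sgn_diff_swap)
    ultimately show ?thesis using False lo by simp
  qed
  then have "edge_pattern X Y (0, 1, - 1) lo hi"
    using lo hi by (simp add: edge_pattern_def)
  then show thesis by (rule that)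
qed

lemma edge_pattern_spacelike:
  assumes X: "mink X X > 0" and Y: "mink Y Y > 0" and g: "gram X Y \<noteq> 0"
  obtains lo hi where "edge_pattern X Y (0, edge_sign X Y, - edge_sign X Y) lo hi"
proof -
  let ?P = "\<lambda>t. (1 - t) *\<^sub>R X + t *\<^sub>R Y"
  consider t where "t \<in> {0..1}" "causal_rank (?P t) = 1"
    | t where "t \<in> {0..1}" "causal_rank (?P t) = - 1" "\<not> (\<exists>t\<in>{0..1}. causal_rank (?P t) = 1)"
    | "\<not> (\<exists>t\<in>{0..1}. causal_rank (?P t) = 1)" "\<not> (\<exists>t\<in>{0..1}. causal_rank (?P t) = - 1)"
    by blast
  then show thesis
  proof cases
    case 1
    then have "edge_sign X Y = 1" by (auto simp: edge_sign_def)
    moreover obtain lo hi where "edge_pattern X Y (0, 1, - 1) lo hi"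
      by (rule edge_pattern_spacelike_future[OF assms 1])
    ultimately show thesis using that by simp
  next
    case 2
    then have s: "edge_sign X Y = - 1" by (auto simp: edge_sign_def)
    have "(1 - t) *\<^sub>R (- X) + t *\<^sub>R (- Y) = - ?P t" by simp
    then have "causal_rank ((1 - t) *\<^sub>R (- X) + t *\<^sub>R (- Y)) = 1"
      using 2(2) by (simp only: causal_rank_uminus)
    then obtain lo hi where "edge_pattern (- X) (- Y) (0, 1, - 1) lo hi"
      using assms 2(1) edge_pattern_spacelike_future[of "- X" "- Y" t] by (auto simp: mink_minus gram_def)
    then have "edge_pattern X Y (0, - 1, 1) lo hi"
      using edge_pattern_minus[of X Y 0 1 "- 1" lo hi] by simp
    then show thesis using that s by simp
  next
    case none: 3
    then have s: "edge_sign X Y = 0" unfolding edge_sign_def by simp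
    have "\<bar>causal_rank (?P t)\<bar> \<noteq> 1" if "t \<in> {0..1}" for t
    proof -
      have "causal_rank (?P t) \<noteq> 1" "causal_rank (?P t) \<noteq> - 1"
        using none that by blast+
      then show ?thesis by linarith
    qed
    then have 3: "\<not> (\<exists>t\<in>{0..1}. \<bar>causal_rank (?P t)\<bar> = 1)" by blast
    \<comment> \<open>A timelike point on the edge would yield a null one, at the crossing between
      it and the spacelike end \<open>B\<close>.\<close>
    have no_future: "causal_rank ((1 - t) *\<^sub>R A + t *\<^sub>R B) \<noteq> 2"
      if t: "t \<in> {0..1}" and B: "mink B B > 0"
        and 3: "\<not> (\<exists>t\<in>{0..1}. \<bar>causal_rank ((1 - t) *\<^sub>R A + t *\<^sub>R B)\<bar> = 1)" for A B t
    proof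
      let ?C = "(1 - t) *\<^sub>R A + t *\<^sub>R B"
      assume C: "causal_rank ?C = 2"
      obtain q where q: "0 < q" "q < 1"
        "\<And>t. 0 \<le> t \<Longrightarrow> t \<le> 1 \<Longrightarrow> causal_rank ((1 - t) *\<^sub>R ?C + t *\<^sub>R B) = 1 + sgn (q - t)"
        by (rule single_crossing[OF C B]) blast
      have "(1 - q) *\<^sub>R ?C + q *\<^sub>R B = (1 - (t + q * (1 - t))) *\<^sub>R A + (t + q * (1 - t)) *\<^sub>R B"
        by (simp add: algebra_simps)
      then have "causal_rank ((1 - (t + q * (1 - t))) *\<^sub>R A + (t + q * (1 - t)) *\<^sub>R B) = 1"
        using q(3)[of q] q(1,2) by simp
      moreover have "t + q * (1 - t) \<in> {0..1}"
        using t q mult_left_le_one_le[of "1 - t" q] by auto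
      ultimately show False using 3 by force
    qed
    have "causal_rank (?P t) = 0" if t: "t \<in> {0..1}" for t
    proof -
      have m: "(1 - t) *\<^sub>R (- X) + t *\<^sub>R (- Y) = - ?P t" for t by simp
      have "causal_rank (?P t) \<noteq> 2"
        by (rule no_future[OF t Y 3])
      moreover have "causal_rank ((1 - t) *\<^sub>R (- X) + t *\<^sub>R (- Y)) \<noteq> 2"
      proof (rule no_future[OF t])
        show "mink (- Y) (- Y) > 0" using Y by (simp add: mink_minus)
        have "(1 - t) *\<^sub>R (- X) + t *\<^sub>R (- Y) = - ?P t" for t by simp
        then show "\<not> (\<exists>t\<in>{0..1}. \<bar>causal_rank ((1 - t) *\<^sub>R (- X) + t *\<^sub>R (- Y))\<bar> = 1)"
          using 3 by (simp only: causal_rank_uminus abs_minus_cancel) blast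
      qed
      then have "causal_rank (?P t) \<noteq> - 2"
        unfolding m causal_rank_uminus by simp
      moreover have "\<bar>causal_rank (?P t)\<bar> \<noteq> 1" using 3 t by blast
      ultimately show ?thesis
        by (cases rule: causal_rank_cases[of "?P t"]) auto
    qed
    then have "edge_pattern X Y (0, 0, 0) (1/3) (2/3)"
      by (simp add: edge_pattern_def)
    then show thesis using that s by simp
  qed
qed

lemma edge_pattern_exists:
  assumes X: "mink X X \<noteq> 0" and Y: "mink Y Y \<noteq> 0" and g: "gram X Y \<noteq> 0"
  obtains lo hi where "edge_pattern X Y (jumps (causal_rank X) (causal_rank Y) (edge_sign X Y)) lo hi"
proof -
  consider "causal_rank X \<noteq> 0" | "causal_rank X = 0" "causal_rank Y = 0" | "causal_rank X = 0" "causal_rank Y \<noteq> 0"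
    by blast
  then show thesis
  proof cases
    case 1
    then have "causal_rank X = 2 \<or> causal_rank X = - 2"
      using nonnull_rank[OF X] by auto
    then show thesis
      by (rule edge_pattern_timelike[OF _ Y g]) (rule that)
  next
    case 2
    then have "mink X X > 0" "mink Y Y > 0"
      using X Y by (auto simp: causal_rank_eq_0_iff)
    then obtain lo hi where "edge_pattern X Y (0, edge_sign X Y, - edge_sign X Y) lo hi"
      by (rule edge_pattern_spacelike[OF _ _ g])
    then have "edge_pattern X Y (jumps (causal_rank X) (causal_rank Y) (edge_sign X Y)) lo hi"
      by (simp only: jumps_def 2 simp_thms if_True)
    then show thesis by (rule that)
  next
    case 3
    have g': "gram Y X \<noteq> 0" using g by (simp add: gram_def mink_commute mult.commute)
    have "causal_rank Y = 2 \<or> causal_rank Y = - 2"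
      using nonnull_rank[OF Y] 3 by auto
    then obtain lo hi where "edge_pattern Y X (jumps (causal_rank Y) (causal_rank X) 0) lo hi"
      by (rule edge_pattern_timelike[OF _ X g'])
    then have "edge_pattern Y X (causal_rank Y / 2, - causal_rank Y / 2, 0) lo hi"
      using 3 by (simp add: jumps_def)
    then have "edge_pattern X Y (causal_rank Y / 2, - 0, - (- causal_rank Y / 2)) (1 - hi) (1 - lo)"
      by (rule edge_pattern_swap)
    moreover have "jumps (causal_rank X) (causal_rank Y) (edge_sign X Y) =
        (causal_rank Y / 2, - 0, - (- causal_rank Y / 2))"
      using 3 by (simp add: jumps_def)
    ultimately have "edge_pattern X Y (jumps (causal_rank X) (causal_rank Y) (edge_sign X Y)) (1 - hi) (1 - lo)"
      by (simp only:)
    then show thesis by (rule that)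
  qed
qed

subsection \<open>Frames with the same causal data\<close>

text \<open>The conditions that admissibility puts on the edge vectors at the apex. With cyclic
  indices the pairs \<open>i\<close>, \<open>i + 1\<close> exhaust the three faces there.\<close>

definition frame :: "(3 \<Rightarrow> real^3) \<Rightarrow> bool" where
  "frame u \<longleftrightarrow> (\<forall>a. comb u a = 0 \<longrightarrow> a = 0) \<and> (\<forall>i. mink (u i) (u i) \<noteq> 0) \<and>
     (\<forall>i. gram (u i) (u (i + 1)) \<noteq> 0)"

definition same_edge_pattern :: "(3 \<Rightarrow> real^3) \<Rightarrow> (3 \<Rightarrow> real^3) \<Rightarrow> bool" where
  "same_edge_pattern u u' \<longleftrightarrow> (\<forall>i. \<exists>K lo hi lo' hi'.
     edge_pattern (u i) (u (i + 1)) K lo hi \<and> edge_pattern (u' i) (u' (i + 1)) K lo' hi')"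

lemma comb_uminus: "comb (\<lambda>i. - u i) a = - comb u a"
  by (simp add: comb_def sum_negf)

lemma comb_axis: "comb u (axis i t) = t *\<^sub>R u i"
proof -
  have "comb u (axis i t) = (\<Sum>j\<in>UNIV. if j = i then t *\<^sub>R u i else 0)"
    unfolding comb_def by (rule sum.cong) (auto simp: axis_def)
  then show ?thesis by simp
qed

lemma axis_orthant: "0 \<le> t \<Longrightarrow> axis i t \<in> orthant"
  by (simp add: orthant_def axis_def)

lemma orthant_add: "a \<in> orthant \<Longrightarrow> b \<in> orthant \<Longrightarrow> a + b \<in> orthant"
  by (simp add: orthant_def)

lemma frame_uminus: "frame u \<Longrightarrow> frame (\<lambda>i. - u i)"
  by (simp add: frame_def comb_uminus mink_minus gram_def)

lemma same_edge_pattern_uminus: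
  assumes "same_edge_pattern u u'"
  shows "same_edge_pattern (\<lambda>i. - u i) (\<lambda>i. - u' i)"
  unfolding same_edge_pattern_def
proof
  fix i
  obtain K lo hi lo' hi' where "edge_pattern (u i) (u (i + 1)) K lo hi"
    "edge_pattern (u' i) (u' (i + 1)) K lo' hi'"
    using assms unfolding same_edge_pattern_def by blast
  moreover obtain k0 k1 k2 where "K = (k0, k1, k2)"
    by (rule prod_cases3)
  ultimately have "edge_pattern (- u i) (- u (i + 1)) (- k0, - k1, - k2) lo hi"
    "edge_pattern (- u' i) (- u' (i + 1)) (- k0, - k1, - k2) lo' hi'"
    by (auto intro!: edge_pattern_minus)
  then show "\<exists>K lo hi lo' hi'. edge_pattern (- u i) (- u (i + 1)) K lo hi \<and>
      edge_pattern (- u' i) (- u' (i + 1)) K lo' hi'"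
    by blast
qed

text \<open>A large multiple of a future timelike vector, added to an interior vector of the
  orthant, goes beyond both roots of the line; the sum is future timelike and still
  interior.\<close>

lemma future_interior:
  assumes "a \<in> orthant" "causal_rank (comb u a) = 2"
  obtains c where "\<And>i. c $ i > 0" "causal_rank (comb u c) = 2"
proof -
  let ?w = "(\<chi> i. 1) :: real^3"
  define m where "m = max 1 (future_root (comb u a) (comb u ?w) + 1)"
  have m: "m > 0" "m > future_root (comb u a) (comb u ?w)"
    by (auto simp: m_def)
  moreover have "past_root (comb u a) (comb u ?w) \<le> future_root (comb u a) (comb u ?w)"
    using assms(2) by (intro past_root_le_future_root) (simp add: causal_rank_eq_2_iff)
  ultimately have "causal_rank (comb u ?w + m *\<^sub>R comb u a) = 2"
    by (simp add: causal_rank_line[OF assms(2)])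
  then have "causal_rank (comb u (?w + m *\<^sub>R a)) = 2"
    by (simp add: comb_add comb_scale)
  moreover have "(?w + m *\<^sub>R a) $ i > 0" for i
    using assms(1) m(1) by (simp add: orthant_def add_pos_nonneg)
  ultimately show thesis using that by blast
qed

lemma frames_orthant_maps_future:
  assumes f: "frame u" "frame u'" and p: "same_edge_pattern u u'"
    and a: "a \<in> orthant" "causal_rank (comb u a) = 2"
    and a': "a' \<in> orthant" "causal_rank (comb u' a') = 2"
  obtains F G where "orthant_map F" "orthant_map G"
    "\<And>a. a \<in> orthant \<Longrightarrow> G (F a) = a" "\<And>a. a \<in> orthant \<Longrightarrow> F (G a) = a"
    "\<And>a. a \<in> orthant \<Longrightarrow> causal_rank (comb u' (F a)) = causal_rank (comb u a)"
proof -
  obtain c where c: "\<And>i. c $ i > 0" "causal_rank (comb u c) = 2"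
    by (rule future_interior[OF a]) blast
  obtain c' where c': "\<And>i. c' $ i > 0" "causal_rank (comb u' c') = 2"
    by (rule future_interior[OF a']) blast
  obtain K l h l' h' where pat: "\<forall>i. edge_pattern (u i) (u (i + 1)) (K i) (l i) (h i) \<and>
      edge_pattern (u' i) (u' (i + 1)) (K i) (l' i) (h' i)"
    using p unfolding same_edge_pattern_def choice_iff by blast
  have "matched_frames u u' l h l' h' K c c'"
  proof
    show "a = 0" if "comb u a = 0" for a using f(1) that unfolding frame_def by blast
    show "a = 0" if "comb u' a = 0" for a using f(2) that unfolding frame_def by blast
  qed (use pat in blast | rule c c')+
  then show thesis
    by (rule matched_frames_orthant_maps) (rule that)
qed

text \<open>The past case is the future case for the negated frames, with the same orthant
  coordinates.\<close>

lemma frames_orthant_maps: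
  assumes f: "frame u" "frame u'" and p: "same_edge_pattern u u'" and e: "e \<in> signs"
    and a: "a \<in> orthant" "causal_rank (comb u a) = 2 * e"
    and a': "a' \<in> orthant" "causal_rank (comb u' a') = 2 * e"
  obtains F G where "orthant_map F" "orthant_map G"
    "\<And>a. a \<in> orthant \<Longrightarrow> G (F a) = a" "\<And>a. a \<in> orthant \<Longrightarrow> F (G a) = a"
    "\<And>a. a \<in> orthant \<Longrightarrow> causal_rank (comb u' (F a)) = causal_rank (comb u a)"
proof (cases "e = 1")
  case True
  then have "causal_rank (comb u a) = 2" "causal_rank (comb u' a') = 2"
    using a a' by simp_all
  then show thesis
    by (rule frames_orthant_maps_future[OF f p a(1) _ a'(1)]) (rule that)
next
  case False
  then have e: "e = - 1" using e by simp
  obtain F G where "orthant_map F" "orthant_map G"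
    "\<And>a. a \<in> orthant \<Longrightarrow> G (F a) = a" "\<And>a. a \<in> orthant \<Longrightarrow> F (G a) = a"
    "\<And>a. a \<in> orthant \<Longrightarrow>
      causal_rank (comb (\<lambda>i. - u' i) (F a)) = causal_rank (comb (\<lambda>i. - u i) a)"
    by (rule frames_orthant_maps_future[OF frame_uminus[OF f(1)] frame_uminus[OF f(2)]
          same_edge_pattern_uminus[OF p] a(1) _ a'(1)])
      (simp_all add: comb_uminus causal_rank_uminus a a' e)
  then show thesis
    by (intro that[of F G]) (simp_all add: comb_uminus causal_rank_uminus)
qed

section \<open>From null to timelike vectors in the orthant\<close>

lemma comb_orthogonal:
  assumes "frame u" "\<And>i. mink x (u i) = 0"
  shows "x = 0"
proof -
  have "inj (comb u)"
    using assms(1) by (simp add: linear_injective_0[OF linear_comb] frame_def)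
  then have "surj (comb u)"
    by (rule linear_injective_imp_surjective[OF linear_comb _ refl])
  \<comment> \<open>The time reflection of \<open>x\<close>, whose product with \<open>x\<close> is
    the Euclidean square of \<open>x\<close>.\<close>
  then obtain a where a: "comb u a = (\<chi> i. if i = 1 then - x $ 1 else x $ i)"
    by (metis surjD)
  have "mink x (comb u a) = 0"
    using assms(2) by (simp add: comb_def sum_3 mink_add mink_scale)
  then have "(x $ 1)\<^sup>2 + (x $ 2)\<^sup>2 + (x $ 3)\<^sup>2 = 0"
    unfolding a by (simp add: mink_def power2_eq_square)
  then have "x $ 1 = 0 \<and> x $ 2 = 0 \<and> x $ 3 = 0"
    by (simp add: add_nonneg_eq_0_iff)
  then show ?thesis
    by (simp add: vec3_eq_iff)
qed

text \<open>A frame without null faces through the apex is never tangent to the light cone.\<close>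

lemma null_imp_future:
  assumes f: "frame u" and a: "a \<in> orthant" and r: "causal_rank (comb u a) = 1"
  obtains b where "b \<in> orthant" "causal_rank (comb u b) = 2"
proof (cases "\<exists>i. mink (comb u a) (u i) < 0")
  case True
  then obtain i where "mink (comb u a) (u i) < 0" ..
  then obtain d where "d > 0" "causal_rank (comb u a + d *\<^sub>R u i) = 2"
    by (rule causal_rank_push[OF r])
  then show thesis
    using that[of "a + axis i d"] a by (simp add: comb_add comb_axis orthant_add axis_orthant)
next
  case False
  let ?x = "comb u a"
  have x: "mink ?x ?x = 0" "?x \<noteq> 0"
    using r causal_rank_null_iff[of ?x] by auto
  have a0: "0 \<le> a $ i" for i
    using a by (simp add: orthant_def)
  \<comment> \<open>As no \<open>mink ?x (u i)\<close> is negative, all terms of this expansion of 0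
    vanish, so \<open>?x\<close> is orthogonal to each \<open>u i\<close> that occurs in it. With
    three, two or one such vectors this contradicts the nondegeneracy of the form, a face that is
    not null, or an edge that is not null.\<close>
  have "mink ?x ?x = (\<Sum>i\<in>UNIV. a $ i * mink ?x (u i))"
    by (subst (2) comb_def) (simp add: sum_3 mink_add mink_scale)
  then have "(\<Sum>i\<in>UNIV. a $ i * mink ?x (u i)) = 0"
    using x by simp
  moreover have "\<forall>i\<in>UNIV. 0 \<le> a $ i * mink ?x (u i)"
    using False a0 by (simp add: not_less)
  ultimately have "\<forall>i\<in>UNIV. a $ i * mink ?x (u i) = 0"
    using sum_nonneg_eq_0_iff[of UNIV "\<lambda>i. a $ i * mink ?x (u i)"] by simp
  then have z: "a $ i \<noteq> 0 \<Longrightarrow> mink ?x (u i) = 0" for i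
    by auto
  have "\<exists>k. a $ k = 0"
  proof (rule ccontr)
    assume "\<nexists>k. a $ k = 0"
    then have "mink ?x (u i) = 0" for i by (intro z) blast
    then show False using comb_orthogonal[OF f] x(2) by blast
  qed
  then obtain k where k: "a $ k = 0" ..
  define p q where "p = a $ (k + 1)" and "q = a $ (k + 2)"
  have eq: "?x = p *\<^sub>R u (k + 1) + q *\<^sub>R u (k + 2)"
    by (simp add: comb_def sum_index3[of _ k] k p_def q_def)
  have zz: "p \<noteq> 0 \<Longrightarrow> mink ?x (u (k + 1)) = 0" "q \<noteq> 0 \<Longrightarrow> mink ?x (u (k + 2)) = 0"
    unfolding p_def q_def by (blast intro: z)+
  have nn: "mink (u i) (u i) \<noteq> 0" for i
    using f by (simp add: frame_def)
  have "gram (u (k + 1)) (u (k + 1 + 1)) \<noteq> 0"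
    using f unfolding frame_def by blast
  then have g: "gram (u (k + 1)) (u (k + 2)) \<noteq> 0"
    by (simp only: index3_simps simp_thms)
  consider "p = 0" "q = 0" | "p = 0" "q \<noteq> 0" | "p \<noteq> 0" "q = 0" | "p \<noteq> 0" "q \<noteq> 0"
    by blast
  then have "p = 0 \<and> q = 0"
  proof cases
    case 2
    then show ?thesis using zz(2) nn[of "k + 2"] unfolding eq by (simp add: mink_scale)
  next
    case 3
    then show ?thesis using zz(1) nn[of "k + 1"] unfolding eq by (simp add: mink_scale)
  next
    case 4
    then show ?thesis using combination_orthogonal[OF _ _ g] zz unfolding eq by blast
  qed simp
  then show thesis using x(2) eq by simp
qed

lemma null_imp_timelike:
  assumes f: "frame u" and a: "a \<in> orthant" and e: "e \<in> signs" and r: "causal_rank (comb u a) = e"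
  obtains b where "b \<in> orthant" "causal_rank (comb u b) = 2 * e"
proof (cases "e = 1")
  case True
  then obtain b where "b \<in> orthant" "causal_rank (comb u b) = 2"
    using r by (auto intro: null_imp_future[OF f a])
  then show thesis by (intro that[of b]) (simp_all add: True)
next
  case False
  then have e: "e = - 1" using e by simp
  obtain b where "b \<in> orthant" "causal_rank (comb (\<lambda>i. - u i) b) = 2"
    by (rule null_imp_future[OF frame_uminus[OF f] a])
      (simp_all add: comb_uminus causal_rank_uminus r e)
  then show thesis
    using that[of b] by (simp add: comb_uminus causal_rank_uminus e)
qed

definition face_sign :: "(3 \<Rightarrow> real^3) \<Rightarrow> real" where
  "face_sign u = (if \<exists>a\<in>orthant. causal_rank (comb u a) = 1 then 1
     else if \<exists>a\<in>orthant. causal_rank (comb u a) = - 1 then - 1 else 0)"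

lemma same_edge_patternI:
  assumes f: "frame u" "frame u'"
    and r: "\<And>i. causal_rank (u' i) = causal_rank (u i)"
    and e: "\<And>i. causal_rank (u i) = 0 \<Longrightarrow> causal_rank (u (i + 1)) = 0 \<Longrightarrow>
      edge_sign (u' i) (u' (i + 1)) = edge_sign (u i) (u (i + 1))"
  shows "same_edge_pattern u u'"
  unfolding same_edge_pattern_def
proof
  fix i :: 3
  let ?K = "\<lambda>u :: 3 \<Rightarrow> real^3. jumps (causal_rank (u i)) (causal_rank (u (i + 1))) (edge_sign (u i) (u (i + 1)))"
  have f': "mink (u i) (u i) \<noteq> 0" "mink (u' i) (u' i) \<noteq> 0"
    "gram (u i) (u (i + 1)) \<noteq> 0" "gram (u' i) (u' (i + 1)) \<noteq> 0" for i
    using f by (simp_all add: frame_def)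
  obtain lo hi where "edge_pattern (u i) (u (i + 1)) (?K u) lo hi"
    using edge_pattern_exists[OF f'(1) f'(1) f'(3)] .
  moreover obtain lo' hi' where "edge_pattern (u' i) (u' (i + 1)) (?K u') lo' hi'"
    using edge_pattern_exists[OF f'(2) f'(2) f'(4)] .
  moreover have "?K u' = ?K u"
    using r[of i] r[of "i + 1"] e[of i] by (auto simp: jumps_def)
  ultimately show "\<exists>K lo hi lo' hi'. edge_pattern (u i) (u (i + 1)) K lo hi \<and>
      edge_pattern (u' i) (u' (i + 1)) K lo' hi'"
    by (intro exI[of _ "?K u"] exI conjI) (assumption, simp only:)
qed

lemma edge_sign_values: "edge_sign X Y \<in> {0, 1, - 1}"
  by (simp add: edge_sign_def)

lemma edge_sign_attained:
  assumes "edge_sign X Y = e" "e \<noteq> 0"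
  obtains t where "t \<in> {0..1}" "causal_rank ((1 - t) *\<^sub>R X + t *\<^sub>R Y) = e"
  using that assms unfolding edge_sign_def by metis

lemma face_sign_attained:
  assumes "face_sign u = e" "e \<noteq> 0"
  obtains a where "a \<in> orthant" "causal_rank (comb u a) = e"
  using that assms unfolding face_sign_def by metis

lemma edge_point:
  fixes i j :: 3
  assumes "t \<in> {0..1}"
  shows "axis i (1 - t) + axis j t \<in> orthant"
    "comb u (axis i (1 - t) + axis j t) = (1 - t) *\<^sub>R u i + t *\<^sub>R u j"
  using assms by (simp_all add: comb_add comb_axis orthant_add axis_orthant)

text \<open>A timelike vector in the orthant could be joined to the spacelike vector
  \<open>u 1\<close>, and the segment would cross a light cone inside the orthant.\<close>

lemma no_null_imp_spacelike:
  assumes f: "frame u" and r: "causal_rank (u 1) = 0" and s: "face_sign u = 0" and a: "a \<in> orthant"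
  shows "causal_rank (comb u a) = 0"
proof -
  have none: "causal_rank (comb u b) \<noteq> 1" "causal_rank (comb u b) \<noteq> - 1" if "b \<in> orthant" for b
    using s that by (auto simp: face_sign_def split: if_splits)
  have u1: "mink (u 1) (u 1) > 0"
  proof -
    have "mink (u 1) (u 1) \<noteq> 0" using f by (simp add: frame_def)
    then show ?thesis using r by (auto simp: causal_rank_eq_0_iff)
  qed
  have pt: "(1 - q) *\<^sub>R a + axis 1 q \<in> orthant"
    "comb u ((1 - q) *\<^sub>R a + axis 1 q) = (1 - q) *\<^sub>R comb u a + q *\<^sub>R u 1" if "0 < q" "q < 1" for q
    using that a by (simp_all add: orthant_add orthant_scale axis_orthant comb_add comb_scale comb_axis)
  have "causal_rank (comb u a) \<noteq> 2"
  proof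
    assume c: "causal_rank (comb u a) = 2"
    obtain q where q: "0 < q" "q < 1"
      "\<And>t. 0 \<le> t \<Longrightarrow> t \<le> 1 \<Longrightarrow> causal_rank ((1 - t) *\<^sub>R comb u a + t *\<^sub>R u 1) = 1 + sgn (q - t)"
      by (rule single_crossing[OF c u1]) blast
    show False
      using none(1)[OF pt(1)[OF q(1,2)]] q(3)[of q] q(1,2) pt(2)[OF q(1,2)] by simp
  qed
  moreover have "causal_rank (comb u a) \<noteq> - 2"
  proof
    assume "causal_rank (comb u a) = - 2"
    then have c: "causal_rank (- comb u a) = 2"
      by (simp add: causal_rank_uminus)
    have u1': "mink (- u 1) (- u 1) > 0" using u1 by (simp add: mink_minus)
    obtain q where q: "0 < q" "q < 1"
      "\<And>t. 0 \<le> t \<Longrightarrow> t \<le> 1 \<Longrightarrow> causal_rank ((1 - t) *\<^sub>R (- comb u a) + t *\<^sub>R (- u 1)) = 1 + sgn (q - t)"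
      by (rule single_crossing[OF c u1']) blast
    have "(1 - q) *\<^sub>R (- comb u a) + q *\<^sub>R (- u 1) = - ((1 - q) *\<^sub>R comb u a + q *\<^sub>R u 1)"
      by simp
    then have "causal_rank ((1 - q) *\<^sub>R comb u a + q *\<^sub>R u 1) = - 1"
      using q(3)[of q] q(1,2) causal_rank_uminus[of "(1 - q) *\<^sub>R comb u a + q *\<^sub>R u 1"] by simp
    then show False
      using none(2)[OF pt(1)[OF q(1,2)]] pt(2)[OF q(1,2)] by simp
  qed
  ultimately show ?thesis
    using none[OF a] by (cases rule: causal_rank_cases[of "comb u a"]) auto
qed

text \<open>What the extension to the interior still asks for is a timelike vector of the same sign
  on both sides. It comes from a timelike vertex, a crossed edge or a null vector inside, where a
  null vector is first improved to a timelike one.\<close>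

lemma same_data_orthant_maps:
  assumes f: "frame u" "frame u'"
    and r: "\<And>i. causal_rank (u' i) = causal_rank (u i)"
    and e: "\<And>i. causal_rank (u i) = 0 \<Longrightarrow> causal_rank (u (i + 1)) = 0 \<Longrightarrow>
      edge_sign (u' i) (u' (i + 1)) = edge_sign (u i) (u (i + 1))"
    and s: "(\<And>i. causal_rank (u i) = 0) \<Longrightarrow> (\<And>i. edge_sign (u i) (u (i + 1)) = 0) \<Longrightarrow>
      face_sign u' = face_sign u"
  obtains F G where "orthant_map F" "orthant_map G"
    "\<And>a. a \<in> orthant \<Longrightarrow> G (F a) = a" "\<And>a. a \<in> orthant \<Longrightarrow> F (G a) = a"
    "\<And>a. a \<in> orthant \<Longrightarrow> causal_rank (comb u' (F a)) = causal_rank (comb u a)"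
proof -
  note conclude = that
  have p: "same_edge_pattern u u'"
    by (rule same_edge_patternI[OF f r e])
  have null: thesis if g: "g \<in> signs" and a: "a \<in> orthant" "causal_rank (comb u a) = g"
    and a': "a' \<in> orthant" "causal_rank (comb u' a') = g" for g a a'
  proof -
    obtain b where b: "b \<in> orthant" "causal_rank (comb u b) = 2 * g"
      by (rule null_imp_timelike[OF f(1) a(1) g a(2)])
    obtain b' where b': "b' \<in> orthant" "causal_rank (comb u' b') = 2 * g"
      by (rule null_imp_timelike[OF f(2) a'(1) g a'(2)])
    show thesis
      by (rule frames_orthant_maps[OF f p g b b']) (rule conclude)
  qed
  consider i where "causal_rank (u i) \<noteq> 0"
    | i where "\<forall>i. causal_rank (u i) = 0" "edge_sign (u i) (u (i + 1)) \<noteq> 0"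
    | "\<forall>i. causal_rank (u i) = 0" "\<forall>i. edge_sign (u i) (u (i + 1)) = 0"
    by blast
  then show thesis
  proof cases
    case 1
    have "causal_rank (u i) \<in> {- 2, 0, 2}"
      using f(1) by (intro nonnull_rank) (simp add: frame_def)
    then have g: "causal_rank (u i) / 2 \<in> signs"
      using 1 by auto
    have ax: "axis i 1 \<in> orthant" "causal_rank (comb u (axis i 1)) = 2 * (causal_rank (u i) / 2)"
      "causal_rank (comb u' (axis i 1)) = 2 * (causal_rank (u i) / 2)"
      using r by (simp_all add: comb_axis axis_orthant)
    show thesis
      by (rule frames_orthant_maps[OF f p g ax(1,2) ax(1,3)]) (rule conclude)
  next
    case 2
    define g where "g = edge_sign (u i) (u (i + 1))"
    have g: "g \<in> signs" "g \<noteq> 0"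
      using 2(2) edge_sign_values[of "u i" "u (i + 1)"] by (auto simp: g_def)
    have "edge_sign (u' i) (u' (i + 1)) = g"
      using e 2(1) by (simp add: g_def)
    then obtain t' where "t' \<in> {0..1}" "causal_rank ((1 - t') *\<^sub>R u' i + t' *\<^sub>R u' (i + 1)) = g"
      using g(2) by (rule edge_sign_attained)
    moreover obtain t where "t \<in> {0..1}" "causal_rank ((1 - t) *\<^sub>R u i + t *\<^sub>R u (i + 1)) = g"
      using g_def[symmetric] g(2) by (rule edge_sign_attained)
    ultimately show thesis
      by (intro null[OF g(1) edge_point(1)[of t i "i + 1"] _ edge_point(1)[of t' i "i + 1"]])
        (simp_all only: edge_point(2))
  next
    case 3
    then have eq: "face_sign u' = face_sign u" using s by simp
    show thesis
    proof (cases "face_sign u = 0")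
      case True
      \<comment> \<open>Without any null vector both orthants have rank 0 throughout, and the
        identity serves as the map.\<close>
      have "causal_rank (comb u a) = 0" "causal_rank (comb u' a) = 0" if "a \<in> orthant" for a
        using no_null_imp_spacelike[OF f(1) _ _ that] no_null_imp_spacelike[OF f(2) _ _ that] 3 r eq True
        by simp_all
      then show thesis
        by (intro conclude[of "\<lambda>a. a" "\<lambda>a. a"]) (simp_all add: orthant_map_def)
    next
      case False
      moreover have "face_sign u \<in> {0, 1, - 1}" by (simp add: face_sign_def)
      ultimately have g: "face_sign u \<in> signs" by auto
      obtain a where "a \<in> orthant" "causal_rank (comb u a) = face_sign u"
        by (rule face_sign_attained[OF refl False])
      moreover obtain a' where "a' \<in> orthant" "causal_rank (comb u' a') = face_sign u"
        by (rule face_sign_attained[OF eq False])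
      ultimately show thesis using null[OF g] by blast
    qed
  qed
qed

subsection \<open>Tetrahedra in orthant coordinates\<close>

text \<open>In the index type \<open>3 = 0\<close>, whereas the opposite vertices carry the nonzero
  labels of type \<open>4\<close>; so the index 0 must become the label 3 and not that of the
  apex.\<close>

definition vert :: "3 \<Rightarrow> 4" where
  "vert i = (if i = 1 then 1 else if i = 2 then 2 else 3)"

definition apex_frame :: "vertices \<Rightarrow> 3 \<Rightarrow> real^3" where
  "apex_frame v i = v (vert i) - v 0"

definition chart :: "vertices \<Rightarrow> real^3 \<Rightarrow> real^3" where
  "chart v a = v 0 + comb (apex_frame v) a"

definition coord_sum :: "real^3 \<Rightarrow> real" where
  "coord_sum a = a $ 1 + a $ 2 + a $ 3"

text \<open>\<open>a\<close> lists the barycentric coordinates of the opposite vertices; that of the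
  apex is \<open>1 - coord_sum a\<close>. This is why \<open>0 \<notin> J\<close> becomes
  \<open>coord_sum a = 1\<close>.\<close>

definition coord_simplex :: "4 set \<Rightarrow> (real^3) set" where
  "coord_simplex J = {a \<in> orthant. coord_sum a \<le> 1 \<and> (\<forall>i. vert i \<notin> J \<longrightarrow> a $ i = 0) \<and>
     (0 \<notin> J \<longrightarrow> coord_sum a = 1)}"

lemma vert_simps [simp]: "vert 1 = 1" "vert 2 = 2" "vert 3 = 3"
  by (simp_all add: vert_def)

lemma index4_cases: "i = 0 \<or> i = 1 \<or> i = 2 \<or> i = 3" for i :: 4
  using exhaust_4[of i] by auto

lemma UNIV4: "(UNIV :: 4 set) = {0, 1, 2, 3}"
  using index4_cases by auto

lemma sum_index4: "(\<Sum>i\<in>UNIV. f i) = f 0 + f 1 + f 2 + f 3" for f :: "4 \<Rightarrow> 'a::comm_monoid_add"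
  unfolding UNIV4 by (simp add: add.assoc)

lemma chart_eq:
  "chart v a = (1 - coord_sum a) *\<^sub>R v 0 + a $ 1 *\<^sub>R v 1 + a $ 2 *\<^sub>R v 2 + a $ 3 *\<^sub>R v 3"
  by (simp add: chart_def comb_def sum_3 apex_frame_def coord_sum_def algebra_simps)

text \<open>Weights are indexed by labels rather than by points and are 0 off \<open>J\<close>, so
  that a single sum over all labels describes every face.\<close>

lemma convex_hull_inj_image:
  fixes v :: "'i::finite \<Rightarrow> 'a::real_vector"
  assumes "inj v"
  shows "convex hull (v ` J) =
    {\<Sum>i\<in>UNIV. w i *\<^sub>R v i |w. (\<forall>i. 0 \<le> w i) \<and> (\<forall>i. i \<notin> J \<longrightarrow> w i = 0) \<and> sum w UNIV = 1}"
    (is "?L = ?R")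
proof
  have inj: "inj_on v J"
    using assms by (rule inj_on_subset) simp
  show "?L \<subseteq> ?R"
  proof
    fix x assume "x \<in> ?L"
    then obtain u where u: "\<forall>y\<in>v ` J. 0 \<le> u y" "sum u (v ` J) = 1" "x = (\<Sum>y\<in>v ` J. u y *\<^sub>R y)"
      by (auto simp: convex_hull_finite)
    define w where "w i = (if i \<in> J then u (v i) else 0)" for i
    have "x = (\<Sum>i\<in>J. u (v i) *\<^sub>R v i)"
      unfolding u(3) by (simp add: sum.reindex[OF inj])
    also have "\<dots> = (\<Sum>i\<in>UNIV. w i *\<^sub>R v i)"
      by (rule sum.mono_neutral_cong_left) (auto simp: w_def)
    finally have "x = (\<Sum>i\<in>UNIV. w i *\<^sub>R v i)" .
    moreover have "sum w UNIV = (\<Sum>i\<in>J. u (v i))"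
      by (rule sum.mono_neutral_cong_right) (auto simp: w_def)
    then have "sum w UNIV = 1"
      using u(2) by (simp add: sum.reindex[OF inj])
    ultimately show "x \<in> ?R"
      using u(1) by (auto simp: w_def)
  qed
  show "?R \<subseteq> ?L"
  proof
    fix x assume "x \<in> ?R"
    then obtain w where w: "\<forall>i. 0 \<le> w i" "\<forall>i. i \<notin> J \<longrightarrow> w i = 0" "sum w UNIV = 1"
      "x = (\<Sum>i\<in>UNIV. w i *\<^sub>R v i)" by blast
    have "x = (\<Sum>i\<in>J. w i *\<^sub>R v i)"
      unfolding w(4) by (rule sum.mono_neutral_right) (use w(2) in auto)
    moreover have "sum w J = 1"
      unfolding w(3)[symmetric] by (rule sum.mono_neutral_left) (use w(2) in auto)
    then have "(\<Sum>i\<in>J. w i *\<^sub>R v i) \<in> ?L"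
      by (intro convex_sum convex_convex_hull finite) (use w(1) in \<open>auto intro: hull_inc\<close>)
    ultimately show "x \<in> ?L" by simp
  qed
qed

lemma face_chart:
  assumes "inj v"
  shows "face v J = chart v ` coord_simplex J"
proof
  show "face v J \<subseteq> chart v ` coord_simplex J"
  proof
    fix x assume "x \<in> face v J"
    then obtain w where w: "\<forall>i. 0 \<le> w i" "\<forall>i. i \<notin> J \<longrightarrow> w i = 0" "sum w UNIV = 1"
      "x = (\<Sum>i\<in>UNIV. w i *\<^sub>R v i)"
      unfolding face_def convex_hull_inj_image[OF assms] by blast
    define a :: "real^3" where "a = (\<chi> i. w (vert i))"
    have t: "coord_sum a = 1 - w 0"
      using w(3) by (simp add: coord_sum_def a_def sum_index4)
    have "x = chart v a"
      unfolding w(4) chart_eq t by (simp add: a_def sum_index4)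
    moreover have "a \<in> coord_simplex J"
      using w(1,2) t by (auto simp: coord_simplex_def orthant_def a_def)
    ultimately show "x \<in> chart v ` coord_simplex J" by blast
  qed
  show "chart v ` coord_simplex J \<subseteq> face v J"
  proof
    fix x assume "x \<in> chart v ` coord_simplex J"
    then obtain a where a: "a \<in> coord_simplex J" "x = chart v a" by blast
    define w :: "4 \<Rightarrow> real"
      where "w i = (if i = 0 then 1 - coord_sum a else if i = 1 then a $ 1 else if i = 2 then a $ 2 else a $ 3)" for i
    have w: "w 0 = 1 - coord_sum a" "w 1 = a $ 1" "w 2 = a $ 2" "w 3 = a $ 3"
      by (simp_all add: w_def)
    have a0: "0 \<le> a $ 1" "0 \<le> a $ 2" "0 \<le> a $ 3" "coord_sum a \<le> 1" "0 \<notin> J \<Longrightarrow> coord_sum a = 1"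
      "1 \<notin> J \<Longrightarrow> a $ 1 = 0" "2 \<notin> J \<Longrightarrow> a $ 2 = 0" "3 \<notin> J \<Longrightarrow> a $ 3 = 0"
      using a(1) unfolding coord_simplex_def orthant_def by (auto simp: forall_3)
    have "x = (\<Sum>i\<in>UNIV. w i *\<^sub>R v i)"
      unfolding a(2) chart_eq sum_index4 w ..
    moreover have "sum w UNIV = 1"
      unfolding sum_index4 w by (simp add: coord_sum_def)
    moreover have "0 \<le> w i" "i \<notin> J \<longrightarrow> w i = 0" for i
      using index4_cases[of i] a0 w by auto
    ultimately show "x \<in> face v J"
      unfolding face_def convex_hull_inj_image[OF assms] by blast
  qed
qed

text \<open>A linear relation among the edge vectors is an affine relation among the vertices once
  the apex receives minus the sum of the coefficients.\<close>

lemma tetrahedron_independent: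
  assumes t: "tetrahedron v" and z: "comb (apex_frame v) a = 0"
  shows "a = 0"
proof -
  have inj: "inj v" and nd: "\<not> affine_dependent (range v)"
    using t by (simp_all add: tetrahedron_def)
  define k :: "4 \<Rightarrow> real"
    where "k i = (if i = 0 then - coord_sum a else if i = 1 then a $ 1 else if i = 2 then a $ 2 else a $ 3)" for i
  have k: "k 0 = - coord_sum a" "k 1 = a $ 1" "k 2 = a $ 2" "k 3 = a $ 3"
    by (simp_all add: k_def)
  define U where "U x = k (inv v x)" for x
  have U: "U (v i) = k i" for i
    by (simp add: U_def inj)
  have "sum U (range v) = 0"
    by (simp add: sum.reindex[OF inj] U sum_index4 k coord_sum_def)
  moreover have "(\<Sum>x\<in>range v. U x *\<^sub>R x) = 0"
    using z by (simp add: sum.reindex[OF inj] U sum_index4 k coord_sum_def comb_def sum_3 apex_frame_def algebra_simps)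
  ultimately have "\<not> (\<exists>x\<in>range v. U x \<noteq> 0)"
    using nd unfolding affine_dependent_explicit_finite[OF finite_imageI[OF finite]] by blast
  then have "k i = 0" for i using U by auto
  then show "a = 0"
    using k by (metis vec3_eq_iff zero_index)
qed

lemma chart_inj:
  assumes "tetrahedron v"
  shows "inj (chart v)"
proof -
  have "inj (comb (apex_frame v))"
    using tetrahedron_independent[OF assms] by (simp add: linear_injective_0[OF linear_comb])
  then show ?thesis
    by (simp add: chart_def inj_def)
qed

section \<open>Rescaling to the coordinate simplex\<close>

lemma coord_sum_scale: "coord_sum (t *\<^sub>R a) = t * coord_sum a"
  by (simp add: coord_sum_def algebra_simps)

lemma coord_sum_pos:
  assumes "a \<in> orthant" "a \<noteq> 0"
  shows "coord_sum a > 0"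
proof -
  have "0 \<le> a $ 1" "0 \<le> a $ 2" "0 \<le> a $ 3" "a $ 1 \<noteq> 0 \<or> a $ 2 \<noteq> 0 \<or> a $ 3 \<noteq> 0"
    using assms by (auto simp: orthant_def vec3_eq_iff)
  then show ?thesis by (auto simp: coord_sum_def)
qed

text \<open>The factor restores the coordinate sum of \<open>a\<close>, so that for an orthant map
  every \<open>coord_simplex J\<close> is mapped to itself. At 0 the factor is
  \<open>0 / 0 = 0\<close> and the value is 0.\<close>

definition normalise :: "(real^3 \<Rightarrow> real^3) \<Rightarrow> real^3 \<Rightarrow> real^3" where
  "normalise F a = (coord_sum a / coord_sum (F a)) *\<^sub>R F a"

lemma orthant_map_zero:
  assumes "orthant_map F" "a \<in> orthant"
  shows "F a = 0 \<longleftrightarrow> a = 0"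
  using assms by (simp add: orthant_map_def vec_eq_iff)

lemma normalise_simps:
  assumes F: "orthant_map F" and a: "a \<in> orthant"
  shows "normalise F a \<in> orthant" "coord_sum (normalise F a) = coord_sum a"
    "normalise F a $ i = 0 \<longleftrightarrow> a $ i = 0"
    "causal_rank (comb u (normalise F a)) = causal_rank (comb u (F a))"
proof -
  have Fa: "F a \<in> orthant" "F a = 0 \<longleftrightarrow> a = 0" "F a $ i = 0 \<longleftrightarrow> a $ i = 0"
    using F a orthant_map_zero[OF F a] unfolding orthant_map_def by auto
  have "normalise F a \<in> orthant \<and> coord_sum (normalise F a) = coord_sum a \<and> (normalise F a $ i = 0 \<longleftrightarrow> a $ i = 0) \<and>
      causal_rank (comb u (normalise F a)) = causal_rank (comb u (F a))"
  proof (cases "a = 0")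
    case True
    then show ?thesis using Fa by (simp add: normalise_def orthant_def coord_sum_def)
  next
    case False
    then have "coord_sum a > 0" "coord_sum (F a) > 0"
      using Fa a by (simp_all add: coord_sum_pos)
    then show ?thesis
      using Fa by (simp add: normalise_def orthant_scale coord_sum_scale comb_scale causal_rank_scale)
  qed
  then show "normalise F a \<in> orthant" "coord_sum (normalise F a) = coord_sum a"
    "normalise F a $ i = 0 \<longleftrightarrow> a $ i = 0"
    "causal_rank (comb u (normalise F a)) = causal_rank (comb u (F a))"
    by simp_all
qed

text \<open>By homogeneity \<open>G\<close> undoes the rescaled \<open>F\<close> up to a positive
  factor, and the coordinate sum fixes that factor.\<close>

lemma normalise_inverse:
  assumes F: "orthant_map F" and G: "orthant_map G" and inv: "\<And>a. a \<in> orthant \<Longrightarrow> G (F a) = a"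
    and a: "a \<in> orthant"
  shows "normalise G (normalise F a) = a"
proof (cases "a = 0")
  case True
  then show ?thesis by (simp add: normalise_def coord_sum_def)
next
  case False
  have Fa: "F a \<in> orthant" "F a \<noteq> 0"
    using F a False orthant_map_zero[OF F a] unfolding orthant_map_def by auto
  have pos: "coord_sum a > 0" "coord_sum (F a) > 0"
    using Fa a False by (simp_all add: coord_sum_pos)
  define t where "t = coord_sum a / coord_sum (F a)"
  have t: "t > 0" using pos by (simp add: t_def)
  have "G (normalise F a) = t *\<^sub>R a"
    using G Fa(1) t inv[OF a] unfolding orthant_map_def normalise_def t_def by simp
  moreover have "coord_sum (normalise F a) = coord_sum a"
    by (rule normalise_simps(2)[OF F a])
  ultimately show ?thesis
    using pos t by (simp add: normalise_def[of G] coord_sum_scale)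
qed

text \<open>The factor has a vanishing denominator only at 0. Each coordinate of \<open>F a\<close>
  is bounded by their sum, so the lemma on bounded ratios covers this point.\<close>

lemma continuous_on_normalise:
  assumes F: "orthant_map F"
  shows "continuous_on orthant (normalise F)"
proof -
  have cF: "continuous_on orthant F" and o: "\<And>a. a \<in> orthant \<Longrightarrow> F a \<in> orthant"
    using F unfolding orthant_map_def by auto
  have ct: "continuous_on S coord_sum" for S
    unfolding coord_sum_def by (intro continuous_intros)
  have "continuous_on orthant (\<lambda>a. F a $ i * (coord_sum a / coord_sum (F a)))" for i
  proof (rule continuous_on_bounded_ratio)
    show "continuous_on orthant (\<lambda>a. F a $ i)"
      by (intro continuous_intros cF)
    show "continuous_on orthant (\<lambda>a. coord_sum (F a))"
      by (rule continuous_on_compose2[OF ct[of UNIV] cF]) simp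
    show "continuous_on orthant coord_sum" by (rule ct)
    fix a assume a: "a \<in> orthant"
    then have "0 \<le> F a $ 1" "0 \<le> F a $ 2" "0 \<le> F a $ 3"
      using o[OF a] by (simp_all add: orthant_def)
    then show "\<bar>F a $ i\<bar> \<le> coord_sum (F a)"
      using exhaust_3[of i] by (auto simp: coord_sum_def)
    show "coord_sum a = 0" if "coord_sum (F a) = 0"
      using that coord_sum_pos[OF o[OF a]] orthant_map_zero[OF F a] by (fastforce simp: coord_sum_def)
  qed
  then have "continuous_on orthant (\<lambda>a. \<chi> i. F a $ i * (coord_sum a / coord_sum (F a)))"
    by (intro continuous_on_vec_lambda)
  moreover have "normalise F a = (\<chi> i. F a $ i * (coord_sum a / coord_sum (F a)))" for a
    by (simp add: normalise_def vec_eq_iff mult.commute)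
  ultimately show ?thesis by presburger
qed

lemma compact_simplex: "compact (coord_simplex UNIV)"
proof -
  have eq: "coord_simplex UNIV = (\<Inter>i. {a. 0 \<le> a $ i}) \<inter> {a. coord_sum a \<le> 1}"
    by (auto simp: coord_simplex_def orthant_def)
  have "closed (coord_simplex UNIV)"
    unfolding eq coord_sum_def
    by (intro closed_Int closed_INT ballI closed_Collect_le continuous_intros)
  moreover have "bounded (coord_simplex UNIV)"
  proof (rule boundedI)
    fix a assume "a \<in> coord_simplex UNIV"
    then have "0 \<le> a $ 1" "0 \<le> a $ 2" "0 \<le> a $ 3" "a $ 1 + a $ 2 + a $ 3 \<le> 1"
      by (auto simp: coord_simplex_def orthant_def coord_sum_def)
    then have "(\<Sum>i\<in>UNIV. \<bar>a $ i\<bar>) \<le> 1"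
      by (simp add: sum_3)
    then show "norm a \<le> 1"
      using norm_le_l1_cart[of a] by linarith
  qed
  ultimately show ?thesis by (simp add: compact_eq_bounded_closed)
qed

text \<open>The normalised map of the coordinate simplex is carried to the tetrahedra by the two
  charts, which are homeomorphisms by compactness.\<close>

lemma orthant_maps_same_structure:
  assumes v: "tetrahedron v" and w: "tetrahedron w" and s: "s \<in> signs"
    and F: "orthant_map F" and G: "orthant_map G"
    and GF: "\<And>a. a \<in> orthant \<Longrightarrow> G (F a) = a" and FG: "\<And>a. a \<in> orthant \<Longrightarrow> F (G a) = a"
    and rank: "\<And>a. a \<in> orthant \<Longrightarrow>
      causal_rank (comb (apex_frame w) (F a)) = s * causal_rank (comb (apex_frame v) a)"
  shows "same_structure id s v w"
proof -
  let ?S = "coord_simplex UNIV" and ?f = "normalise F" and ?g = "normalise G"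
  have S: "?S \<subseteq> orthant" by (auto simp: coord_simplex_def)
  have iv: "inj v" "inj w" using v w by (simp_all add: tetrahedron_def)
  have face_map: "?f ` coord_simplex J = coord_simplex J" for J
  proof -
    have sub: "normalise H a \<in> coord_simplex J" if "orthant_map H" "a \<in> coord_simplex J" for H a
      using that normalise_simps[OF that(1), of a] by (simp add: coord_simplex_def)
    have "a \<in> ?f ` coord_simplex J" if "a \<in> coord_simplex J" for a
      using normalise_inverse[OF G F FG, of a] sub[OF G that] that
      by (intro image_eqI[of _ _ "?g a"]) (auto simp: coord_simplex_def)
    then show ?thesis using sub[OF F] by blast
  qed
  have hom: "homeomorphism ?S ?S ?f ?g"
    unfolding homeomorphism_def
  proof (intro conjI ballI)
    show "continuous_on ?S ?f" "continuous_on ?S ?g"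
      using continuous_on_normalise[OF F] continuous_on_normalise[OF G] S
      by (auto intro: continuous_on_subset)
    show fS: "?f ` ?S = ?S" by (rule face_map)
    show gf: "?g (?f a) = a" if "a \<in> ?S" for a
      using that S by (intro normalise_inverse[OF F G GF]) auto
    show fg: "?f (?g a) = a" if "a \<in> ?S" for a
      using that S by (intro normalise_inverse[OF G F FG]) auto
    show "?g ` ?S = ?S"
      using fS gf by (metis (no_types, lifting) image_cong image_ident image_image)
  qed
  have cc: "continuous_on ?S (chart x)" for x
    unfolding chart_def comb_def by (intro continuous_intros)
  obtain v' where v': "homeomorphism ?S (solid v) (chart v) v'"
    using homeomorphism_compact[OF compact_simplex cc _ inj_on_subset[OF chart_inj[OF v]]]
      face_chart[OF iv(1)] by blast
  obtain w' where w': "homeomorphism ?S (solid w) (chart w) w'"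
    using homeomorphism_compact[OF compact_simplex cc _ inj_on_subset[OF chart_inj[OF w]]]
      face_chart[OF iv(2)] by blast
  define h where "h = chart w \<circ> (?f \<circ> v')"
  have "homeomorphism (solid v) (solid w) (chart w \<circ> (?f \<circ> v')) ((chart v \<circ> ?g) \<circ> w')"
    by (rule homeomorphism_compose[OF homeomorphism_compose[OF homeomorphism_symD[OF v'] hom] w'])
  then have H: "homeomorphism (solid v) (solid w) h ((chart v \<circ> ?g) \<circ> w')"
    by (simp only: h_def)
  have h: "h (chart v a) = chart w (?f a)" if "a \<in> ?S" for a
    using that v' by (simp add: h_def homeomorphism_def)
  have img: "h ` (X \<inter> solid v) = Y \<inter> solid w"
    if XY: "\<And>a. a \<in> ?S \<Longrightarrow> chart v a \<in> X \<longleftrightarrow> chart w (?f a) \<in> Y" for X Y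
  proof -
    have "h ` (X \<inter> solid v) = h ` chart v ` {a \<in> ?S. chart v a \<in> X}"
      unfolding face_chart[OF iv(1)] by blast
    also have "\<dots> = (\<lambda>a. chart w (?f a)) ` {a \<in> ?S. chart w (?f a) \<in> Y}"
      using h XY by (auto simp: image_image intro!: image_cong)
    also have "\<dots> = Y \<inter> chart w ` ?f ` ?S"
      by blast
    also have "\<dots> = Y \<inter> solid w"
      by (simp only: face_map face_chart[OF iv(2)])
    finally show ?thesis .
  qed
  have r: "causal_rank (chart w (?f a) - w 0) = s * causal_rank (chart v a - v 0)" if "a \<in> ?S" for a
    using that S normalise_simps(4)[OF F, of a] rank[of a] by (auto simp: chart_def)
  have ss: "s * e \<in> signs" if "e \<in> signs" for e using that s by auto
  show ?thesis
    unfolding same_structure_def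
  proof (intro exI conjI allI ballI)
    show "homeomorphism (solid v) (solid w) h ((chart v \<circ> ?g) \<circ> w')" by (rule H)
    show "h ` face v J = face w (id ` J)" for J
    proof -
      have "coord_simplex J \<subseteq> ?S" by (auto simp: coord_simplex_def)
      then have "h ` chart v ` coord_simplex J = chart w ` ?f ` coord_simplex J"
        using h by (auto simp: image_image intro!: image_cong)
      then show ?thesis by (simp add: face_chart[OF iv(1)] face_chart[OF iv(2)] face_map)
    qed
    show "h ` (lightcone e (v 0) \<inter> solid v) = lightcone (s * e) (w 0) \<inter> solid w" if "e \<in> signs" for e
    proof (rule img)
      fix a assume "a \<in> ?S"
      then show "chart v a \<in> lightcone e (v 0) \<longleftrightarrow> chart w (?f a) \<in> lightcone (s * e) (w 0)"
        unfolding lightcone_iff[OF that] lightcone_iff[OF ss[OF that]] using s by (auto simp: r)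
    qed
    show "h ` (timecone e (v 0) \<inter> solid v) = timecone (s * e) (w 0) \<inter> solid w" if "e \<in> signs" for e
    proof (rule img)
      fix a assume "a \<in> ?S"
      then show "chart v a \<in> timecone e (v 0) \<longleftrightarrow> chart w (?f a) \<in> timecone (s * e) (w 0)"
        unfolding timecone_iff[OF that] timecone_iff[OF ss[OF that]] using s by (auto simp: r)
    qed
    show "h ` (spacelike_region (v 0) \<inter> solid v) = spacelike_region (w 0) \<inter> solid w"
    proof (rule img)
      fix a assume a: "a \<in> ?S"
      \<comment> \<open>The apex has rank 0 like the spacelike points but belongs to no region, so
        it must be shown separately that it goes to the apex.\<close>
      have z: "chart x b = x 0 \<longleftrightarrow> b = 0" if "tetrahedron x" for x b
        using tetrahedron_independent[OF that, of b] by (auto simp: chart_def)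
      have "?f a = 0 \<longleftrightarrow> a = 0"
        using a S normalise_simps(3)[OF F] by (auto simp: vec_eq_iff)
      then show "chart v a \<in> spacelike_region (v 0) \<longleftrightarrow> chart w (?f a) \<in> spacelike_region (w 0)"
        unfolding spacelike_region_iff using s by (auto simp: r[OF a] z[OF v] z[OF w])
    qed
  qed
qed

subsection \<open>Closed conics inside the opposite face\<close>

lemma causal_rank_sign: "e \<in> signs \<Longrightarrow> causal_rank (e *\<^sub>R x) = e * causal_rank x"
  using causal_rank_uminus[of x] by auto

lemma comb_sign: "comb (\<lambda>i. e *\<^sub>R u i) a = e *\<^sub>R comb u a"
  by (simp add: comb_def scaleR_sum_right mult.commute)

lemma frame_sign: "e \<in> signs \<Longrightarrow> frame u \<Longrightarrow> frame (\<lambda>i. e *\<^sub>R u i)"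
  using frame_uminus[of u] by auto

text \<open>By the edge pattern, the ranks along the edge are 0, one fixed sign or twice that sign,
  so the two light cones cannot both be met.\<close>

lemma edge_sign_iff:
  assumes X: "mink X X > 0" and Y: "mink Y Y > 0" and g: "gram X Y \<noteq> 0" and e: "e \<in> signs"
  shows "(\<exists>t\<in>{0..1}. causal_rank ((1 - t) *\<^sub>R X + t *\<^sub>R Y) = e) \<longleftrightarrow> edge_sign X Y = e"
proof -
  obtain lo hi where P: "edge_pattern X Y (0, edge_sign X Y, - edge_sign X Y) lo hi"
    by (rule edge_pattern_spacelike[OF X Y g])
  have "causal_rank ((1 - t) *\<^sub>R X + t *\<^sub>R Y) = edge_sign X Y * (sgn (t - lo) - sgn (t - hi))"
    if "t \<in> {0..1}" for t
    using P that by (simp add: edge_pattern_def right_diff_distrib)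
  moreover have "lo < hi" using P by (simp add: edge_pattern_def)
  moreover have "sgn (t - lo) - sgn (t - hi) \<in> {0, 1, 2}" if "lo < hi" for t
    using that by (auto simp: sgn_real_def)
  ultimately have "causal_rank ((1 - t) *\<^sub>R X + t *\<^sub>R Y) \<in> {0, edge_sign X Y, 2 * edge_sign X Y}"
    if "t \<in> {0..1}" for t
    using that by fastforce
  then have "edge_sign X Y = e" if "t \<in> {0..1}" "causal_rank ((1 - t) *\<^sub>R X + t *\<^sub>R Y) = e" for t
    using that e edge_sign_values[of X Y] by fastforce
  moreover have "\<exists>t\<in>{0..1}. causal_rank ((1 - t) *\<^sub>R X + t *\<^sub>R Y) = e" if "edge_sign X Y = e"
  proof -
    have "e \<noteq> 0" using e by auto
    then show ?thesis using edge_sign_attained[OF that] by blast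
  qed
  ultimately show ?thesis by blast
qed

lemma spacelike_boundary:
  assumes f: "frame u" and r: "\<And>i. causal_rank (u i) = 0"
    and e: "\<And>i. edge_sign (u i) (u (i + 1)) = 0" and b: "b \<in> orthant_boundary"
  shows "causal_rank (comb u b) = 0"
proof -
  have q: "mink (u i) (u i) > 0" for i
  proof -
    have "mink (u i) (u i) \<noteq> 0" using f by (simp add: frame_def)
    then show ?thesis using r[of i] by (auto simp: causal_rank_eq_0_iff)
  qed
  obtain k where k: "b $ k = 0" and n: "0 \<le> b $ i" for i
    using b by (auto simp: orthant_boundary_def orthant_def)
  have eq: "comb u b = b $ (k + 1) *\<^sub>R u (k + 1) + b $ (k + 2) *\<^sub>R u (k + 1 + 1)"
    by (simp add: comb_def sum_index3[of _ k] k index3_simps)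
  show ?thesis
  proof (cases "b $ (k + 1) + b $ (k + 2) = 0")
    case True
    then have "b $ (k + 1) = 0" "b $ (k + 2) = 0"
      using n[of "k + 1"] n[of "k + 2"] by linarith+
    then show ?thesis by (simp add: eq)
  next
    case False
    then have pos: "b $ (k + 1) + b $ (k + 2) > 0"
      using n[of "k + 1"] n[of "k + 2"] by linarith
    have "gram (u (k + 1)) (u (k + 1 + 1)) \<noteq> 0" using f unfolding frame_def by blast
    then obtain lo hi where "edge_pattern (u (k + 1)) (u (k + 1 + 1))
        (0, edge_sign (u (k + 1)) (u (k + 1 + 1)), - edge_sign (u (k + 1)) (u (k + 1 + 1))) lo hi"
      by (rule edge_pattern_spacelike[OF q q])
    from edge_pattern_cone[OF this n n pos] show ?thesis
      unfolding eq e by simp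
  qed
qed

text \<open>Write \<open>x\<close> as b + m c with \<open>b\<close> in the boundary, hence of rank
  0, and \<open>c\<close> future timelike. The rank grows with m: rank at least 1 forces m > 0 and
  so positive coordinates, and a nonnegative m forces rank at least 0. The first claim concerns
  arbitrary vectors, which later confines the whole conic and not only its part in the
  triangle.\<close>

lemma future_inside:
  assumes f: "frame u" and bd: "\<And>b. b \<in> orthant_boundary \<Longrightarrow> causal_rank (comb u b) = 0"
    and a: "a \<in> orthant" "causal_rank (comb u a) = 1"
  shows "causal_rank (comb u x) \<ge> 1 \<Longrightarrow> x $ i > 0" and "x \<in> orthant \<Longrightarrow> causal_rank (comb u x) \<ge> 0"
proof -
  obtain a' where "a' \<in> orthant" "causal_rank (comb u a') = 2"
    by (rule null_imp_future[OF f a])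
  then obtain c where c: "\<And>i. c $ i > 0" "causal_rank (comb u c) = 2"
    by (rule future_interior) blast
  let ?b = "base_point c x" and ?m = "apex_coord c x"
  have b: "?b \<in> orthant_boundary"
    by (rule base_point_boundary[OF c(1)])
  have x: "comb u x = comb u ?b + ?m *\<^sub>R comb u c"
    by (simp only: comb_add[symmetric] comb_scale[symmetric] base_point_apex)
  have z: "causal_rank (comb u ?b + 0 *\<^sub>R comb u c) = 0"
    using bd[OF b] by simp
  show "x $ i > 0" if 1: "causal_rank (comb u x) \<ge> 1"
  proof -
    have "?m > 0"
    proof (rule ccontr)
      assume "\<not> ?m > 0"
      then have "causal_rank (comb u x) \<le> causal_rank (comb u ?b + 0 *\<^sub>R comb u c)"
        unfolding x by (intro causal_rank_line_mono[OF c(2)]) simp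
      with z 1 show False by simp
    qed
    then have "?m * c $ i > 0" using c(1)[of i] by simp
    moreover have "x $ i = ?b $ i + ?m * c $ i"
      by (simp add: base_point_def)
    moreover have "?b $ i \<ge> 0"
      using b by (simp add: orthant_boundary_def orthant_def)
    ultimately show ?thesis by linarith
  qed
  show "causal_rank (comb u x) \<ge> 0" if "x \<in> orthant"
  proof -
    have "causal_rank (comb u ?b + 0 *\<^sub>R comb u c) \<le> causal_rank (comb u x)"
      unfolding x using apex_coord_nonneg[OF c(1) that] by (intro causal_rank_line_mono[OF c(2)])
    with z show ?thesis by simp
  qed
qed

lemma signed_inside:
  assumes f: "frame u" and bd: "\<And>b. b \<in> orthant_boundary \<Longrightarrow> causal_rank (comb u b) = 0"
    and e: "e \<in> signs" and a: "a \<in> orthant" "causal_rank (comb u a) = e"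
  shows "causal_rank (comb u x) = e \<Longrightarrow> x $ i > 0" and "x \<in> orthant \<Longrightarrow> causal_rank (comb u x) \<noteq> - e"
proof -
  have ee: "e * e = 1" "e \<noteq> 0" using e by auto
  have r: "causal_rank (comb (\<lambda>i. e *\<^sub>R u i) b) = e * causal_rank (comb u b)" for b
    by (simp add: comb_sign causal_rank_sign[OF e])
  have 1: "causal_rank (comb (\<lambda>i. e *\<^sub>R u i) b) = 0" if "b \<in> orthant_boundary" for b
    using bd[OF that] by (simp add: r)
  have 2: "causal_rank (comb (\<lambda>i. e *\<^sub>R u i) a) = 1"
    by (simp add: r a ee)
  note inside = future_inside[OF frame_sign[OF e f] 1 a(1) 2, unfolded r]
  show "causal_rank (comb u x) = e \<Longrightarrow> x $ i > 0"
    by (rule inside(1)) (simp_all add: ee)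
  show "x \<in> orthant \<Longrightarrow> causal_rank (comb u x) \<noteq> - e"
    using inside(2)[of x] ee by auto
qed

lemma future_or_zero_sum:
  assumes "x = 0 \<or> causal_rank x = 2" "y = 0 \<or> causal_rank y = 2"
  shows "x + y = 0 \<or> causal_rank (x + y) = 2"
  using assms causal_rank_add_future[of x y] by auto

lemma future_or_zero_scale:
  assumes "causal_rank x = 2" "0 \<le> t"
  shows "t *\<^sub>R x = 0 \<or> causal_rank (t *\<^sub>R x) = 2"
  using assms causal_rank_scale[of t x] by (cases "t = 0") auto

lemma timelike_comb:
  assumes e: "e \<in> signs" and r: "\<And>i. causal_rank (u i) = 2 * e" and a: "a \<in> orthant"
  shows "comb u a = 0 \<or> causal_rank (comb u a) = 2 * e"
proof -
  have ee: "e * e = 1" using e by auto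
  have "causal_rank (e *\<^sub>R u i) = 2" for i
    using r[of i] ee by (simp add: causal_rank_sign[OF e])
  moreover have "0 \<le> a $ i" for i using a by (simp add: orthant_def)
  ultimately have "comb (\<lambda>i. e *\<^sub>R u i) a = 0 \<or> causal_rank (comb (\<lambda>i. e *\<^sub>R u i) a) = 2"
    unfolding comb_def sum_3 by (intro future_or_zero_sum future_or_zero_scale)
  moreover have "e \<noteq> 0" using e by auto
  ultimately have "comb u a = 0 \<or> e * causal_rank (comb u a) = 2"
    by (simp add: comb_sign causal_rank_sign[OF e])
  then show ?thesis using e by auto
qed

text \<open>If the future cone meets two edges at a vertex and the past cone meets the opposite edge, then
  that vertex is a positive combination of future timelike vectors.\<close>

lemma no_mixed_crossing:
  assumes e: "e \<in> signs"
    and xy: "causal_rank (x1 *\<^sub>R X + y1 *\<^sub>R Y) = 2 * e" "x1 > 0" "y1 > 0"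
    and xz: "causal_rank (x2 *\<^sub>R X + z2 *\<^sub>R Z) = 2 * e" "x2 > 0" "z2 > 0"
    and yz: "causal_rank (y3 *\<^sub>R Y + z3 *\<^sub>R Z) = - 2 * e" "y3 > 0" "z3 > 0"
  shows "causal_rank X = 2 * e"
proof -
  have ee: "e * e = 1" "e \<noteq> 0" using e by auto
  define A B C where "A = x1 *\<^sub>R X + y1 *\<^sub>R Y" and "B = x2 *\<^sub>R X + z2 *\<^sub>R Z" and "C = y3 *\<^sub>R Y + z3 *\<^sub>R Z"
  have c: "causal_rank (e *\<^sub>R A) = 2" "causal_rank (e *\<^sub>R B) = 2" "causal_rank (- (e *\<^sub>R C)) = 2"
    using xy(1) xz(1) yz(1) ee by (simp_all add: causal_rank_uminus causal_rank_sign[OF e] A_def B_def C_def)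
  \<comment> \<open>These weights cancel \<open>Y\<close> and \<open>Z\<close> in the positive
    combination of \<open>A\<close>, \<open>B\<close> and \<open>- C\<close>.\<close>
  have p: "y3 / y1 > 0" "z3 / z2 > 0" using xy xz yz by simp_all
  have "causal_rank ((y3 / y1) *\<^sub>R (e *\<^sub>R A) + (z3 / z2) *\<^sub>R (e *\<^sub>R B) + - (e *\<^sub>R C)) = 2"
    by (intro causal_rank_add_future c(3)) (simp_all only: causal_rank_scale[OF p(1)] causal_rank_scale[OF p(2)] c)
  also have "(y3 / y1) *\<^sub>R (e *\<^sub>R A) + (z3 / z2) *\<^sub>R (e *\<^sub>R B) + - (e *\<^sub>R C) =
      (y3 / y1 * x1 + z3 / z2 * x2) *\<^sub>R (e *\<^sub>R X)"
    using xy(3) xz(3) by (simp add: A_def B_def C_def algebra_simps)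
  also have "causal_rank ((y3 / y1 * x1 + z3 / z2 * x2) *\<^sub>R (e *\<^sub>R X)) = causal_rank (e *\<^sub>R X)"
    using p xy(2) xz(2) by (intro causal_rank_scale add_pos_pos mult_pos_pos)
  finally have "e * causal_rank X = 2"
    by (simp add: causal_rank_sign[OF e])
  then show ?thesis using e by auto
qed

lemma edge_sign_timelike:
  assumes X: "mink X X > 0" and Y: "mink Y Y > 0" and g: "gram X Y \<noteq> 0"
    and e: "edge_sign X Y = e" "e \<noteq> 0"
  obtains x y where "x > 0" "y > 0" "causal_rank (x *\<^sub>R X + y *\<^sub>R Y) = 2 * e"
proof -
  obtain lo hi where P: "edge_pattern X Y (0, e, - e) lo hi"
    using edge_pattern_spacelike[OF X Y g] e(1) by blast
  define t where "t = (lo + hi) / 2"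
  have t: "0 < t" "t < 1" "lo < t" "t < hi"
    using P by (auto simp: edge_pattern_def t_def)
  then have "causal_rank ((1 - t) *\<^sub>R X + t *\<^sub>R Y) = 2 * e"
    using P by (simp add: edge_pattern_def)
  then show thesis using that[of "1 - t" t] t by simp
qed

subsection \<open>The signs attached to a tetrahedron\<close>

text \<open>A vertex of an admissible tetrahedron is not null relative to the apex, so half its rank
  is 0 or the sign of its time cone.\<close>

definition vertex_sign :: "vertices \<Rightarrow> 4 \<Rightarrow> real" where
  "vertex_sign v i = causal_rank (v i - v 0) / 2"

definition meeting_sign :: "vertices \<Rightarrow> 4 set \<Rightarrow> real" where
  "meeting_sign v J = (if meets v 1 J then 1 else if meets v (- 1) J then - 1 else 0)"

text \<open>The crossings of an edge with a timelike end are determined by its ends, and those of the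
  triangle by its edges as soon as one of them is crossed; the signs below are \<open>0\<close> in these cases.\<close>

definition link_sign :: "vertices \<Rightarrow> 4 \<Rightarrow> 4 \<Rightarrow> real" where
  "link_sign v i j =
     (if vertex_sign v i = 0 \<and> vertex_sign v j = 0 then meeting_sign v {i, j} else 0)"

definition opposite_sign :: "vertices \<Rightarrow> real" where
  "opposite_sign v =
     (if (\<forall>i\<in>{1, 2, 3}. vertex_sign v i = 0) \<and> link_sign v 1 2 = 0 \<and> link_sign v 1 3 = 0 \<and> link_sign v 2 3 = 0
      then meeting_sign v {1, 2, 3} else 0)"

lemma link_sign_commute: "link_sign v i j = link_sign v j i"
  by (simp add: link_sign_def insert_commute conj_commute)

lemma link_sign_values: "link_sign v i j \<in> {0, 1, - 1}"
  by (simp add: link_sign_def meeting_sign_def)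

lemma opposite_sign_values: "opposite_sign v \<in> {0, 1, - 1}"
  by (simp add: opposite_sign_def meeting_sign_def)

lemma admissible_vertex:
  assumes "admissible v" "i \<noteq> 0"
  shows "mink (v i - v 0) (v i - v 0) \<noteq> 0"
proof -
  have "no_null_edges v" using assms(1) by (simp add: admissible_def)
  then have "sq_length (v 0) (v i) \<noteq> 0"
    using assms(2)[symmetric] unfolding no_null_edges_def by blast
  then show ?thesis by (simp add: sq_length_def)
qed

lemma admissible_pair:
  assumes "admissible v" "i \<noteq> 0" "j \<noteq> 0" "i \<noteq> j"
  shows "gram (v i - v 0) (v j - v 0) \<noteq> 0"
proof -
  have "no_null_faces v" using assms(1) by (simp add: admissible_def)
  then have "sq_area (v 0) (v i) (v j) \<noteq> 0"
    using assms(2,3)[symmetric] assms(4) unfolding no_null_faces_def by blast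
  then show ?thesis by (simp add: sq_area_def gram_def)
qed

lemma numeral_mod_3 [simp]: "(4 :: 3) = 1" "(5 :: 3) = 2"
  by simp_all

lemma vert_neq: "vert i \<noteq> 0" "vert i \<noteq> vert (i + 1)"
  using exhaust_3[of i] by auto

lemma admissible_frame:
  assumes "admissible v"
  shows "frame (apex_frame v)"
  unfolding frame_def apex_frame_def[of v]
proof (intro conjI allI impI)
  fix i
  show "mink (v (vert i) - v 0) (v (vert i) - v 0) \<noteq> 0"
    by (rule admissible_vertex[OF assms vert_neq(1)])
  show "gram (v (vert i) - v 0) (v (vert (i + 1)) - v 0) \<noteq> 0"
    by (rule admissible_pair[OF assms vert_neq(1) vert_neq(1) vert_neq(2)])
next
  fix a assume "comb (\<lambda>i. v (vert i) - v 0) a = 0"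
  then show "a = 0"
    using assms tetrahedron_independent[of v a] by (simp add: admissible_def apex_frame_def[abs_def])
qed

lemma vertex_sign_values:
  assumes "admissible v" "i \<noteq> 0"
  shows "vertex_sign v i \<in> {0, 1, - 1}"
proof -
  have "causal_rank (v i - v 0) \<in> {- 2, 0, 2}"
    by (intro nonnull_rank admissible_vertex assms)
  then show ?thesis by (auto simp: vertex_sign_def)
qed

lemma timelike_vertex_iff: "e \<in> signs \<Longrightarrow> timelike_vertex v e i \<longleftrightarrow> vertex_sign v i = e"
  by (auto simp: timelike_vertex_def timecone_iff vertex_sign_def)

lemma spacelike_vertex_iff:
  assumes "admissible v" "i \<noteq> 0"
  shows "spacelike_vertex v i \<longleftrightarrow> vertex_sign v i = 0"
proof -
  have "inj v" using assms(1) by (simp add: admissible_def tetrahedron_def)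
  then have "v i \<noteq> v 0" using assms(2) by (metis injD)
  then show ?thesis
    by (simp add: spacelike_vertex_def spacelike_region_iff vertex_sign_def)
qed

lemma face_pair: "face v {i, j} = (\<lambda>t. (1 - t) *\<^sub>R v i + t *\<^sub>R v j) ` {0..1}"
  by (auto simp: face_def segment_convex_hull[symmetric] closed_segment_def)

lemma segment_diff: "(1 - t) *\<^sub>R x + t *\<^sub>R y - z = (1 - t) *\<^sub>R (x - z) + t *\<^sub>R (y - z)"
  for x y z :: "'a::real_vector"
  by (simp add: algebra_simps)

lemma meets_pair:
  assumes "e \<in> signs"
  shows "meets v e {i, j} \<longleftrightarrow>
    (\<exists>t\<in>{0..1}. causal_rank ((1 - t) *\<^sub>R (v i - v 0) + t *\<^sub>R (v j - v 0)) = e)"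
  unfolding meets_def face_pair segment_diff[symmetric]
  using lightcone_iff[OF assms] by blast

text \<open>A null vector of the orthant is nonzero, so it can be rescaled to coordinate sum 1, that
  is, into the triangle.\<close>

lemma meets_opposite:
  assumes v: "admissible v" and e: "e \<in> signs"
  shows "meets v e {1, 2, 3} \<longleftrightarrow> (\<exists>a\<in>orthant. causal_rank (comb (apex_frame v) a) = e)"
proof -
  have iv: "inj v" using v by (simp add: admissible_def tetrahedron_def)
  have s: "coord_simplex {1, 2, 3} = {a \<in> orthant. coord_sum a = 1}"
  proof -
    have "vert i \<in> {1, 2, 3}" for i using exhaust_3[of i] by auto
    then show ?thesis by (auto simp: coord_simplex_def)
  qed
  have "meets v e {1, 2, 3} \<longleftrightarrow> (\<exists>a\<in>orthant. coord_sum a = 1 \<and> causal_rank (comb (apex_frame v) a) = e)"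
  proof -
    have "meets v e {1, 2, 3} \<longleftrightarrow> (\<exists>a\<in>{a \<in> orthant. coord_sum a = 1}. chart v a \<in> lightcone e (v 0))"
      unfolding meets_def face_chart[OF iv] s by blast
    then show ?thesis
      unfolding lightcone_iff[OF e] by (simp add: chart_def Bex_def conj_assoc)
  qed
  moreover have "\<exists>b\<in>orthant. coord_sum b = 1 \<and> causal_rank (comb (apex_frame v) b) = e"
    if a: "a \<in> orthant" "causal_rank (comb (apex_frame v) a) = e" for a
  proof -
    have "a \<noteq> 0" using a(2) e by auto
    then have t: "coord_sum a > 0" using a(1) by (simp add: coord_sum_pos)
    then show ?thesis
      using a by (intro bexI[of _ "(1 / coord_sum a) *\<^sub>R a"])
        (simp_all add: coord_sum_scale comb_scale causal_rank_scale orthant_scale)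
  qed
  ultimately show ?thesis by blast
qed

lemma edge_sign_meeting: "edge_sign (v i - v 0) (v j - v 0) = meeting_sign v {i, j}"
  using meets_pair[of 1 v i j] meets_pair[of "- 1" v i j] by (simp add: edge_sign_def meeting_sign_def)

lemma face_sign_meeting: "admissible v \<Longrightarrow> face_sign (apex_frame v) = meeting_sign v {1, 2, 3}"
  using meets_opposite[of v 1] meets_opposite[of v "- 1"] by (simp add: face_sign_def meeting_sign_def)

text \<open>The five values belong to the parameters before \<open>lo\<close>, at \<open>lo\<close>,
  between, at \<open>hi\<close> and after \<open>hi\<close>, none of which ranges is empty.\<close>

lemma edge_pattern_attains:
  assumes "edge_pattern X Y (k0, k1, k2) lo hi"
  shows "(\<exists>t\<in>{0..1}. causal_rank ((1 - t) *\<^sub>R X + t *\<^sub>R Y) = e) \<longleftrightarrow>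
    e \<in> {k0 - k1 - k2, k0 - k2, k0 + k1 - k2, k0 + k1, k0 + k1 + k2}"
proof -
  have P: "0 < lo" "lo < hi" "hi < 1"
    and eq: "\<And>t. t \<in> {0..1} \<Longrightarrow>
      causal_rank ((1 - t) *\<^sub>R X + t *\<^sub>R Y) = k0 + k1 * sgn (t - lo) + k2 * sgn (t - hi)"
    using assms by (auto simp: edge_pattern_def)
  let ?R = "\<lambda>t. causal_rank ((1 - t) *\<^sub>R X + t *\<^sub>R Y)"
  define m where "m = (lo + hi) / 2"
  have m: "lo < m" "m < hi" using P(2) by (simp_all add: m_def)
  have val: "?R t =
      (if t < lo then k0 - k1 - k2 else if t = lo then k0 - k2 else if t < hi then k0 + k1 - k2
       else if t = hi then k0 + k1 else k0 + k1 + k2)" if "t \<in> {0..1}" for t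
    unfolding eq[OF that] using P(2) by (simp add: sgn_real_def)
  have v: "?R 0 = k0 - k1 - k2" "?R 1 = k0 + k1 + k2"
    using P val[of 0] val[of 1] by simp_all
  have "?R lo = k0 - k2" "?R m = k0 + k1 - k2" "?R hi = k0 + k1"
    using P m by (simp_all add: val)
  moreover have "0 \<in> {0..1::real}" "lo \<in> {0..1}" "m \<in> {0..1}" "hi \<in> {0..1}" "1 \<in> {0..1::real}"
    using P m by simp_all
  ultimately have "\<exists>t\<in>{0..1}. ?R t = e"
    if "e \<in> {k0 - k1 - k2, k0 - k2, k0 + k1 - k2, k0 + k1, k0 + k1 + k2}"
    using that v by (elim insertE emptyE) blast+
  moreover have "?R t \<in> {k0 - k1 - k2, k0 - k2, k0 + k1 - k2, k0 + k1, k0 + k1 + k2}"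
    if "t \<in> {0..1}" for t
    unfolding val[OF that] by simp
  ultimately show ?thesis by blast
qed

lemma jumps_attain:
  fixes r s :: real
  assumes "jumps (2 * r) (2 * s) x = (k0, k1, k2)" "r \<in> {0, 1, - 1}" "s \<in> {0, 1, - 1}"
    "\<not> (r = 0 \<and> s = 0)" "e \<in> signs"
  shows "e \<in> {k0 - k1 - k2, k0 - k2, k0 + k1 - k2, k0 + k1, k0 + k1 + k2} \<longleftrightarrow>
    r \<noteq> s \<and> (r = e \<or> s = e)"
proof -
  have "r = 0 \<or> r = 1 \<or> r = - 1" "s = 0 \<or> s = 1 \<or> s = - 1" "e = 1 \<or> e = - 1"
    using assms by auto
  then show ?thesis
    using assms(1,4) unfolding jumps_def by (elim disjE; hypsubst) (clarsimp+)?
qed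

text \<open>With all intersections of edges and light cones expressed by signs, the clauses of the
  types become a finite case analysis.\<close>

lemma meets_pair_iff:
  assumes v: "admissible v" and ij: "i \<noteq> 0" "j \<noteq> 0" "i \<noteq> j" and e: "e \<in> signs"
  shows "meets v e {i, j} \<longleftrightarrow>
    (if vertex_sign v i = 0 \<and> vertex_sign v j = 0 then link_sign v i j = e
     else vertex_sign v i \<noteq> vertex_sign v j \<and> (vertex_sign v i = e \<or> vertex_sign v j = e))"
proof -
  let ?X = "v i - v 0" and ?Y = "v j - v 0"
  have ne: "mink ?X ?X \<noteq> 0" "mink ?Y ?Y \<noteq> 0" "gram ?X ?Y \<noteq> 0"
    by (rule admissible_vertex[OF v ij(1)] admissible_vertex[OF v ij(2)] admissible_pair[OF v ij])+
  have r: "causal_rank ?X = 2 * vertex_sign v i" "causal_rank ?Y = 2 * vertex_sign v j"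
    by (simp_all add: vertex_sign_def)
  show ?thesis
  proof (cases "vertex_sign v i = 0 \<and> vertex_sign v j = 0")
    case True
    then have "mink ?X ?X > 0" "mink ?Y ?Y > 0"
      using ne r by (auto simp: causal_rank_eq_0_iff)
    from edge_sign_iff[OF this ne(3) e] show ?thesis
      using True by (simp add: meets_pair[OF e] edge_sign_meeting link_sign_def)
  next
    case False
    obtain lo hi where P: "edge_pattern ?X ?Y (jumps (causal_rank ?X) (causal_rank ?Y) (edge_sign ?X ?Y)) lo hi"
      using edge_pattern_exists[OF ne] .
    obtain k0 k1 k2 where K: "jumps (causal_rank ?X) (causal_rank ?Y) (edge_sign ?X ?Y) = (k0, k1, k2)"
      by (rule prod_cases3)
    have "meets v e {i, j} \<longleftrightarrow> e \<in> {k0 - k1 - k2, k0 - k2, k0 + k1 - k2, k0 + k1, k0 + k1 + k2}"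
      unfolding meets_pair[OF e] by (rule edge_pattern_attains[OF P[unfolded K]])
    also have "\<dots> \<longleftrightarrow> vertex_sign v i \<noteq> vertex_sign v j \<and> (vertex_sign v i = e \<or> vertex_sign v j = e)"
      by (rule jumps_attain[OF K[unfolded r] vertex_sign_values[OF v ij(1)]
            vertex_sign_values[OF v ij(2)] False e])
    finally show ?thesis using False by (simp only: if_False)
  qed
qed

lemma signs_eqI:
  fixes x y :: real
  assumes "x \<in> {0, 1, - 1}" "y \<in> {0, 1, - 1}" "\<And>e. e \<in> signs \<Longrightarrow> x = e \<longleftrightarrow> y = e"
  shows "x = y"
  using assms(1,2) assms(3)[of 1] assms(3)[of "- 1"] by auto

lemma sign_mult_eq_iff: "s \<in> signs \<Longrightarrow> s * x = e \<longleftrightarrow> x = s * e" for s x e :: real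
  by auto

lemma sign_mult_values: "s \<in> signs \<Longrightarrow> x \<in> {0, 1, - 1} \<Longrightarrow> s * x \<in> {0, 1, - 1}" for s x :: real
  by auto

lemma sign_mult_signs: "s \<in> signs \<Longrightarrow> e \<in> signs \<Longrightarrow> s * e \<in> signs" for s e :: real
  by auto

text \<open>The definition of \<open>edge_sign\<close> tests the future cone first and is not
  visibly symmetric under time reversal; the symmetry rests on the fact that only one cone can be
  met.\<close>

lemma edge_sign_scale:
  assumes X: "mink X X > 0" and Y: "mink Y Y > 0" and g: "gram X Y \<noteq> 0" and s: "s \<in> signs"
  shows "edge_sign (s *\<^sub>R X) (s *\<^sub>R Y) = s * edge_sign X Y"
proof (rule signs_eqI[OF edge_sign_values sign_mult_values[OF s edge_sign_values]])
  have ss: "s * s = 1" "s \<noteq> 0" using s by auto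
  fix e :: real assume e: "e \<in> signs"
  have eq: "(1 - t) *\<^sub>R (s *\<^sub>R X) + t *\<^sub>R (s *\<^sub>R Y) = s *\<^sub>R ((1 - t) *\<^sub>R X + t *\<^sub>R Y)" for t
    by (simp add: scaleR_add_right mult.commute)
  have m: "mink (s *\<^sub>R X) (s *\<^sub>R Y) = mink X Y" for X Y
    by (simp only: mink_scale mult.assoc[symmetric] ss mult_1)
  have "edge_sign (s *\<^sub>R X) (s *\<^sub>R Y) = e \<longleftrightarrow>
      (\<exists>t\<in>{0..1}. causal_rank ((1 - t) *\<^sub>R (s *\<^sub>R X) + t *\<^sub>R (s *\<^sub>R Y)) = e)"
    by (rule edge_sign_iff[symmetric, OF _ _ _ e]) (simp_all only: m gram_def X Y g[unfolded gram_def] not_False_eq_True)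
  also have "\<dots> \<longleftrightarrow> (\<exists>t\<in>{0..1}. causal_rank ((1 - t) *\<^sub>R X + t *\<^sub>R Y) = s * e)"
    unfolding eq causal_rank_sign[OF s] sign_mult_eq_iff[OF s] ..
  also have "\<dots> \<longleftrightarrow> edge_sign X Y = s * e"
    by (rule edge_sign_iff[OF X Y g sign_mult_signs[OF s e]])
  finally show "edge_sign (s *\<^sub>R X) (s *\<^sub>R Y) = e \<longleftrightarrow> s * edge_sign X Y = e"
    unfolding sign_mult_eq_iff[OF s] .
qed

lemma face_sign_values: "face_sign u \<in> {0, 1, - 1}"
  by (simp add: face_sign_def)

lemma face_sign_iff:
  assumes f: "frame u" and bd: "\<And>b. b \<in> orthant_boundary \<Longrightarrow> causal_rank (comb u b) = 0" and e: "e \<in> signs"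
  shows "(\<exists>a\<in>orthant. causal_rank (comb u a) = e) \<longleftrightarrow> face_sign u = e"
proof
  assume "face_sign u = e"
  moreover have "e \<noteq> 0" using e by auto
  ultimately obtain a where "a \<in> orthant" "causal_rank (comb u a) = e"
    by (rule face_sign_attained)
  then show "\<exists>a\<in>orthant. causal_rank (comb u a) = e" by blast
next
  assume ex: "\<exists>a\<in>orthant. causal_rank (comb u a) = e"
  then obtain a where a: "a \<in> orthant" "causal_rank (comb u a) = e" by blast
  have no: "\<not> (\<exists>x\<in>orthant. causal_rank (comb u x) = - e)"
    using signed_inside(2)[OF f bd e a] by blast
  consider "e = 1" | "e = - 1" using e by blast
  then show "face_sign u = e"
  proof cases
    case 1
    then show ?thesis using ex unfolding face_sign_def by simp
  next
    case 2
    then show ?thesis using ex no unfolding face_sign_def by simp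
  qed
qed

lemma face_sign_scale:
  assumes f: "frame u" and bd: "\<And>b. b \<in> orthant_boundary \<Longrightarrow> causal_rank (comb u b) = 0" and s: "s \<in> signs"
  shows "face_sign (\<lambda>i. s *\<^sub>R u i) = s * face_sign u"
proof (rule signs_eqI[OF face_sign_values sign_mult_values[OF s face_sign_values]])
  fix e :: real assume e: "e \<in> signs"
  have r: "causal_rank (comb (\<lambda>i. s *\<^sub>R u i) a) = s * causal_rank (comb u a)" for a
    by (simp add: comb_sign causal_rank_sign[OF s])
  have "face_sign (\<lambda>i. s *\<^sub>R u i) = e \<longleftrightarrow> (\<exists>a\<in>orthant. s * causal_rank (comb u a) = e)"
    by (rule face_sign_iff[OF frame_sign[OF s f] _ e, unfolded r, symmetric]) (simp add: bd)
  also have "\<dots> \<longleftrightarrow> face_sign u = s * e"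
    unfolding sign_mult_eq_iff[OF s] by (rule face_sign_iff[OF f bd sign_mult_signs[OF s e]])
  finally show "face_sign (\<lambda>i. s *\<^sub>R u i) = e \<longleftrightarrow> s * face_sign u = e"
    unfolding sign_mult_eq_iff[OF s] .
qed

text \<open>For admissible tetrahedra this is a complete invariant of the labelled structure:
  \<open>same_structure id s v w\<close> holds precisely when the list of \<open>w\<close> is
  \<open>s\<close> times the list of \<open>v\<close>.\<close>

definition signature :: "vertices \<Rightarrow> real list" where
  "signature v = [vertex_sign v 1, vertex_sign v 2, vertex_sign v 3,
     link_sign v 1 2, link_sign v 1 3, link_sign v 2 3, opposite_sign v]"

text \<open>The time sign is absorbed into the second frame: \<open>s\<close> times the frame of
  \<open>w\<close> has the same causal data as the frame of \<open>v\<close>.\<close>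

lemma signature_same_structure:
  assumes v: "admissible v" and w: "admissible w" and s: "s \<in> signs"
    and sig: "signature w = map ((*) s) (signature v)"
  shows "same_structure id s v w"
proof -
  let ?u = "apex_frame v" and ?w = "apex_frame w"
  let ?u' = "\<lambda>i. s *\<^sub>R ?w i"
  have ss: "s * s = 1" "s \<noteq> 0" using s by auto
  have fv: "frame ?u" and fw: "frame ?w"
    by (rule admissible_frame[OF v], rule admissible_frame[OF w])
  have sg: "vertex_sign w (vert i) = s * vertex_sign v (vert i)"
    "link_sign w (vert i) (vert (i + 1)) = s * link_sign v (vert i) (vert (i + 1))"
    "opposite_sign w = s * opposite_sign v" for i
    using sig exhaust_3[of i] link_sign_commute[of v 3 1] link_sign_commute[of w 3 1]
    by (auto simp: signature_def)
  have rv: "causal_rank (?u i) = 2 * vertex_sign v (vert i)"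
    and rw: "causal_rank (?w i) = 2 * vertex_sign w (vert i)" for i
    by (simp_all add: vertex_sign_def apex_frame_def)
  have r: "causal_rank (?u' i) = causal_rank (?u i)" for i
    using ss by (simp add: causal_rank_sign[OF s] rv rw sg)
  have pos: "mink (u i) (u i) > 0" if "frame u" "causal_rank (u i) = 0" for u i
  proof -
    have "mink (u i) (u i) \<noteq> 0" using that by (simp add: frame_def)
    then show ?thesis using that(2) by (auto simp: causal_rank_eq_0_iff)
  qed
  have ew: "edge_sign (?w i) (?w (i + 1)) = link_sign w (vert i) (vert (i + 1))"
    and ev: "edge_sign (?u i) (?u (i + 1)) = link_sign v (vert i) (vert (i + 1))"
    if "causal_rank (?u i) = 0" "causal_rank (?u (i + 1)) = 0" for i
  proof -
    have "vertex_sign v (vert i) = 0" "vertex_sign v (vert (i + 1)) = 0"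
      using that rv[of i] rv[of "i + 1"] by simp_all
    then show "edge_sign (?w i) (?w (i + 1)) = link_sign w (vert i) (vert (i + 1))"
      "edge_sign (?u i) (?u (i + 1)) = link_sign v (vert i) (vert (i + 1))"
      by (simp_all add: sg(1) link_sign_def edge_sign_meeting apex_frame_def)
  qed
  have e: "edge_sign (?u' i) (?u' (i + 1)) = edge_sign (?u i) (?u (i + 1))"
    if z: "causal_rank (?u i) = 0" "causal_rank (?u (i + 1)) = 0" for i
  proof -
    have "causal_rank (?w i) = 0" "causal_rank (?w (i + 1)) = 0"
      using z by (simp_all add: rv rw sg)
    moreover have "gram (?w i) (?w (i + 1)) \<noteq> 0" using fw unfolding frame_def by blast
    ultimately have "edge_sign (?u' i) (?u' (i + 1)) = s * edge_sign (?w i) (?w (i + 1))"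
      by (intro edge_sign_scale pos fw s)
    then show ?thesis
      using ss by (simp add: ew[OF z] ev[OF z] sg(2))
  qed
  have f: "face_sign ?u' = face_sign ?u"
    if z: "\<And>i. causal_rank (?u i) = 0" "\<And>i. edge_sign (?u i) (?u (i + 1)) = 0"
  proof -
    have zw: "causal_rank (?w i) = 0" "edge_sign (?w i) (?w (i + 1)) = 0" for i
      using z(1)[of i] z(2)[of i] z(1)[of "i + 1"] by (simp_all add: rv rw sg ew ev)
    have "face_sign ?u' = s * face_sign ?w"
      by (intro face_sign_scale spacelike_boundary fw s zw)
    moreover have "face_sign (apex_frame x) = opposite_sign x"
      if x: "admissible x" "\<And>i. causal_rank (apex_frame x i) = 0"
        "\<And>i. edge_sign (apex_frame x i) (apex_frame x (i + 1)) = 0" for x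
    proof -
      have "vertex_sign x (vert i) = 0" "meeting_sign x {vert i, vert (i + 1)} = 0" for i
        using x(2)[of i] x(3)[of i] by (simp_all add: vertex_sign_def apex_frame_def edge_sign_meeting)
      from this[of 1] this[of 2] this[of 3]
      have "vertex_sign x 1 = 0" "vertex_sign x 2 = 0" "vertex_sign x 3 = 0"
        "meeting_sign x {1, 2} = 0" "meeting_sign x {2, 3} = 0" "meeting_sign x {1, 3} = 0"
        by (simp_all add: insert_commute)
      then show ?thesis
        using x(1) by (simp add: face_sign_meeting opposite_sign_def link_sign_def insert_commute)
    qed
    ultimately show ?thesis
      using v w z zw sg(3) ss by simp
  qed
  obtain F G where FG: "orthant_map F" "orthant_map G"
    "\<And>a. a \<in> orthant \<Longrightarrow> G (F a) = a" "\<And>a. a \<in> orthant \<Longrightarrow> F (G a) = a"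
    "\<And>a. a \<in> orthant \<Longrightarrow> causal_rank (comb ?u' (F a)) = causal_rank (comb ?u a)"
    by (rule same_data_orthant_maps[OF fv frame_sign[OF s fw] r e f]) blast+
  have "causal_rank (comb ?w (F a)) = s * causal_rank (comb ?u a)" if "a \<in> orthant" for a
    using FG(5)[OF that] s by (auto simp: comb_sign causal_rank_sign[OF s])
  then show ?thesis
    using v w by (intro orthant_maps_same_structure[OF _ _ s FG(1-4)]) (simp_all add: admissible_def)
qed

section \<open>Triangles with spacelike boundary\<close>

lemma spacelike_frame_boundary:
  assumes v: "admissible v" and r: "\<forall>i\<in>{1, 2, 3}. vertex_sign v i = 0"
    and l: "link_sign v 1 2 = 0" "link_sign v 1 3 = 0" "link_sign v 2 3 = 0"
    and b: "b \<in> orthant_boundary"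
  shows "causal_rank (comb (apex_frame v) b) = 0"
proof (rule spacelike_boundary[OF admissible_frame[OF v] _ _ b])
  have vr: "vertex_sign v (vert i) = 0" for i
    using r exhaust_3[of i] by auto
  then show "causal_rank (apex_frame v i) = 0" for i
    by (simp add: vertex_sign_def apex_frame_def)
  have "link_sign v (vert i) (vert (i + 1)) = 0" for i
    using exhaust_3[of i] l link_sign_commute[of v 3 1] by auto
  then show "edge_sign (apex_frame v i) (apex_frame v (i + 1)) = 0" for i
    using vr by (simp add: apex_frame_def edge_sign_meeting link_sign_def)
qed

lemma opposite_sign_iff:
  assumes v: "admissible v" and r: "\<forall>i\<in>{1, 2, 3}. vertex_sign v i = 0"
    and l: "link_sign v 1 2 = 0" "link_sign v 1 3 = 0" "link_sign v 2 3 = 0" and e: "e \<in> signs"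
  shows "meets v e {1, 2, 3} \<longleftrightarrow> opposite_sign v = e"
proof -
  have "opposite_sign v = face_sign (apex_frame v)"
    using r l by (simp add: opposite_sign_def face_sign_meeting[OF v])
  then show ?thesis
    unfolding meets_opposite[OF v e]
    using face_sign_iff[OF admissible_frame[OF v] spacelike_frame_boundary[OF v r l] e] by simp
qed

lemma opposite_vertices: "v ` {1, 2, 3} = {v 1, v 2, v 3}" for v :: vertices
  by simp

lemma affine_hull_opposite:
  assumes "x \<in> affine hull (opposite v)"
  obtains a where "coord_sum a = 1" "x = chart v a"
proof -
  have "x \<in> affine hull {v 1, v 2, v 3}"
    using assms by (simp add: face_def affine_hull_convex_hull)
  then obtain p q r where "p + q + r = 1" "x = p *\<^sub>R v 1 + q *\<^sub>R v 2 + r *\<^sub>R v 3"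
    unfolding affine_hull_3 by blast
  then show thesis
    by (intro that[of "vector [p, q, r]"]) (simp_all add: coord_sum_def chart_eq)
qed

lemma rel_interior_opposite:
  assumes v: "tetrahedron v" and t: "coord_sum a = 1" and pos: "\<And>i. a $ i > 0"
  shows "chart v a \<in> rel_interior (opposite v)"
proof -
  have inj: "inj v" and nd: "\<not> affine_dependent (range v)"
    using v by (simp_all add: tetrahedron_def)
  have ne: "v 1 \<noteq> v 2" "v 1 \<noteq> v 3" "v 2 \<noteq> v 3"
    using inj by (simp_all add: inj_eq)
  have "\<not> affine_dependent {v 1, v 2, v 3}"
    using nd affine_dependent_subset[of "{v 1, v 2, v 3}" "range v"] by auto
  then have ri: "rel_interior (opposite v) =
      {y. \<exists>u. (\<forall>x\<in>{v 1, v 2, v 3}. 0 < u x) \<and> sum u {v 1, v 2, v 3} = 1 \<and>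
        (\<Sum>x\<in>{v 1, v 2, v 3}. u x *\<^sub>R x) = y}"
    unfolding face_def opposite_vertices by (rule rel_interior_convex_hull_explicit)
  define w where "w x = (if x = v 1 then a $ 1 else if x = v 2 then a $ 2 else a $ 3)" for x
  have w: "w (v 1) = a $ 1" "w (v 2) = a $ 2" "w (v 3) = a $ 3"
    using ne by (auto simp: w_def)
  have "(\<Sum>x\<in>{v 1, v 2, v 3}. w x) = 1" "(\<Sum>x\<in>{v 1, v 2, v 3}. w x *\<^sub>R x) = chart v a"
    using ne t[unfolded coord_sum_def] by (simp_all add: w chart_eq t add.assoc)
  moreover have "\<forall>x\<in>{v 1, v 2, v 3}. 0 < w x"
    using pos by (simp add: w)
  ultimately show ?thesis
    unfolding ri by blast
qed

lemma opposite_chart: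
  assumes v: "tetrahedron v" and x: "x \<in> opposite v"
  obtains a where "a \<in> orthant" "coord_sum a = 1" "x = chart v a"
proof -
  have "inj v" using v by (simp add: tetrahedron_def)
  then have "x \<in> chart v ` coord_simplex {1, 2, 3}"
    using x face_chart by blast
  then obtain a where "a \<in> coord_simplex {1, 2, 3}" "x = chart v a" by blast
  then show thesis by (intro that[of a]) (auto simp: coord_simplex_def)
qed

text \<open>\<open>signed_inside\<close> controls all vectors, so the whole conic in the plane of
  the triangle has positive barycentric coordinates. It lies in the relative interior and is
  bounded; compactness then asks only for closedness.\<close>

lemma closed_conic:
  assumes v: "admissible v" and r: "\<forall>i\<in>{1, 2, 3}. vertex_sign v i = 0"
    and l: "link_sign v 1 2 = 0" "link_sign v 1 3 = 0" "link_sign v 2 3 = 0"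
    and e: "e \<in> signs" and m: "meets v e {1, 2, 3}"
  shows "closed_conic_inside v e" "lightcone (- e) (v 0) \<inter> rel_interior (opposite v) = {}"
proof -
  let ?u = "apex_frame v"
  have t: "tetrahedron v" using v by (simp add: admissible_def)
  obtain a where a: "a \<in> orthant" "causal_rank (comb ?u a) = e"
    using m unfolding meets_opposite[OF v e] by blast
  have bd: "causal_rank (comb ?u b) = 0" if "b \<in> orthant_boundary" for b
    by (rule spacelike_frame_boundary[OF v r l that])
  have inside: "x $ i > 0" if "causal_rank (comb ?u x) = e" for x i
    by (rule signed_inside(1)[OF admissible_frame[OF v] _ e a that]) (rule bd)
  have outside: "causal_rank (comb ?u x) \<noteq> - e" if "x \<in> orthant" for x
    by (rule signed_inside(2)[OF admissible_frame[OF v] _ e a that]) (rule bd)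
  have me: "- e \<in> signs" using e by auto
  show "lightcone (- e) (v 0) \<inter> rel_interior (opposite v) = {}"
  proof (rule ccontr)
    assume "lightcone (- e) (v 0) \<inter> rel_interior (opposite v) \<noteq> {}"
    then obtain x where x: "x \<in> lightcone (- e) (v 0)" "x \<in> rel_interior (opposite v)" by blast
    then have "x \<in> opposite v" using rel_interior_subset by blast
    then obtain b where b: "b \<in> orthant" "coord_sum b = 1" "x = chart v b" by (rule opposite_chart[OF t])
    then show False
      using outside[OF b(1)] x(1) unfolding lightcone_iff[OF me] b(3) chart_def by simp
  qed
  let ?A = "affine hull (opposite v)"
  define C where "C = lightcone e (v 0) \<inter> ?A"
  have sub: "C \<subseteq> rel_interior (opposite v)"
  proof
    fix x assume x: "x \<in> C"
    then have "x \<in> ?A" by (simp add: C_def)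
    then obtain b where b: "coord_sum b = 1" "x = chart v b"
      by (rule affine_hull_opposite)
    have "causal_rank (comb ?u b) = e"
      using x unfolding C_def Int_iff lightcone_iff[OF e] b(2) chart_def by simp
    then show "x \<in> rel_interior (opposite v)"
      unfolding b(2) by (intro rel_interior_opposite[OF t b(1)] inside)
  qed
  have "v 0 \<notin> ?A"
  proof
    assume "v 0 \<in> ?A"
    then obtain b where b: "coord_sum b = 1" "v 0 = chart v b"
      by (rule affine_hull_opposite)
    from b(2) have "comb ?u b = 0"
      unfolding chart_def add_cancel_right_right .
    then have "b = 0"
      by (rule tetrahedron_independent[OF t])
    then show False using b(1) by (simp add: coord_sum_def)
  qed
  \<comment> \<open>A light cone is not closed, since it omits its apex. The plane misses
    \<open>v 0\<close>, and a nonzero null vector has nonzero time component, so the strict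
    inequality can be weakened to a closed condition.\<close>
  then have eq: "C = {x. mink (x - v 0) (x - v 0) = 0} \<inter> {x. 0 \<le> e * (x $ 1 - v 0 $ 1)} \<inter> ?A"
  proof -
    have "e * (x $ 1 - v 0 $ 1) > 0"
      if x: "x \<in> ?A" "mink (x - v 0) (x - v 0) = 0" "0 \<le> e * (x $ 1 - v 0 $ 1)" for x
    proof -
      have "x - v 0 \<noteq> 0" using x(1) \<open>v 0 \<notin> ?A\<close> by auto
      then have "(x - v 0) $ 1 \<noteq> 0" using x(2) by (intro time_component_nonzero) auto
      then show ?thesis using x(3) e by auto
    qed
    moreover have "x \<noteq> v 0" if "x \<in> ?A" for x
      using that \<open>v 0 \<notin> ?A\<close> by auto
    ultimately show ?thesis
      unfolding C_def lightcone_def null_rel_def set_eq_iff Int_iff mem_Collect_eq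
      by (intro allI iffI conjI; elim conjE; (assumption | rule less_imp_le | simp)?)
  qed
  have "closed {x. mink (x - v 0) (x - v 0) = 0}" "closed {x. 0 \<le> e * (x $ 1 - v 0 $ 1)}"
    unfolding mink_def by (intro closed_Collect_eq closed_Collect_le continuous_intros)+
  then have "closed C"
    unfolding eq by (intro closed_Int closed_affine_hull)
  moreover have "bounded (opposite v)"
    unfolding face_def by (intro compact_imp_bounded finite_imp_compact_convex_hull) simp
  then have "bounded C"
    using sub rel_interior_subset bounded_subset by blast
  ultimately have "compact C" by (simp add: compact_eq_bounded_closed)
  moreover have "C \<noteq> {}"
  proof -
    obtain x where x: "x \<in> lightcone e (v 0)" "x \<in> opposite v"
      using m unfolding meets_def by blast
    then have "x \<in> C" unfolding C_def by (intro IntI hull_inc)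
    then show ?thesis by blast
  qed
  ultimately show "closed_conic_inside v e"
    using sub unfolding closed_conic_inside_def C_def[symmetric] Let_def by (intro conjI)
qed

text \<open>Along the edge the rank is \<open>e\<close> exactly at the two jumps; it is 0 outside
  and \<open>2 * e\<close> between them.\<close>

lemma pair_card:
  assumes v: "admissible v" and ij: "i \<noteq> 0" "j \<noteq> 0" "i \<noteq> j"
    and r: "vertex_sign v i = 0" "vertex_sign v j = 0" and e: "e \<in> signs" "link_sign v i j = e"
  shows "card (lightcone e (v 0) \<inter> face v {i, j}) = 2"
proof -
  let ?X = "v i - v 0" and ?Y = "v j - v 0"
  let ?P = "\<lambda>t. (1 - t) *\<^sub>R v i + t *\<^sub>R v j"
  have "causal_rank ?X = 0" "causal_rank ?Y = 0"
    using r by (simp_all add: vertex_sign_def)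
  then have pos: "mink ?X ?X > 0" "mink ?Y ?Y > 0"
    using admissible_vertex[OF v ij(1)] admissible_vertex[OF v ij(2)]
    by (auto simp: causal_rank_eq_0_iff)
  have es: "edge_sign ?X ?Y = e"
    using e(2) r by (simp add: edge_sign_meeting link_sign_def)
  obtain lo hi where P: "edge_pattern ?X ?Y (0, e, - e) lo hi"
    by (rule edge_pattern_spacelike[OF pos admissible_pair[OF v ij], unfolded es])
  have lh: "0 < lo" "lo < hi" "hi < 1" using P by (auto simp: edge_pattern_def)
  have "?P t \<in> lightcone e (v 0) \<longleftrightarrow> t = lo \<or> t = hi" if t: "t \<in> {0..1}" for t
  proof -
    have "causal_rank (?P t - v 0) = e * (sgn (t - lo) - sgn (t - hi))"
      unfolding segment_diff using P t by (simp add: edge_pattern_def right_diff_distrib)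
    moreover have "e \<noteq> 0" using e by auto
    ultimately have "?P t \<in> lightcone e (v 0) \<longleftrightarrow> sgn (t - lo) - sgn (t - hi) = 1"
      by (simp add: lightcone_iff[OF e(1)])
    then show ?thesis using lh by (auto simp: sgn_real_def split: if_splits)
  qed
  then have "lightcone e (v 0) \<inter> face v {i, j} = ?P ` {lo, hi}"
    unfolding face_pair using lh by (auto simp: image_iff)
  moreover have "?P lo \<noteq> ?P hi"
  proof
    assume "?P lo = ?P hi"
    then have "(hi - lo) *\<^sub>R (v i - v j) = 0" by (simp add: algebra_simps)
    moreover have "inj v" using v by (simp add: admissible_def tetrahedron_def)
    ultimately show False using lh ij(3) by (simp add: inj_eq)
  qed
  ultimately show ?thesis by simp
qed

section \<open>From intersections to signs\<close>

lemma meets_none_iff: "meets_none v J \<longleftrightarrow> meeting_sign v J = 0"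
  by (simp add: meets_none_def meeting_sign_def)

lemma meets_mono: "meets v e J \<Longrightarrow> J \<subseteq> L \<Longrightarrow> meets v e L"
  unfolding meets_def face_def using hull_mono[of "v ` J" "v ` L" convex] by blast

lemma meets_none_timelike:
  assumes v: "admissible v" and e: "e \<in> signs" and r: "\<forall>i\<in>{1, 2, 3}. vertex_sign v i = e"
  shows "meets_none v {1, 2, 3}"
proof -
  have "causal_rank (apex_frame v i) = 2 * e" for i
    using r exhaust_3[of i] by (auto simp: apex_frame_def vertex_sign_def)
  then have "comb (apex_frame v) a = 0 \<or> causal_rank (comb (apex_frame v) a) = 2 * e"
    if "a \<in> orthant" for a
    by (rule timelike_comb[OF e _ that])
  then have "causal_rank (comb (apex_frame v) a) \<noteq> f" if "a \<in> orthant" "f \<in> signs" for a f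
    using that e by fastforce
  then show ?thesis
    using meets_opposite[OF v] unfolding meets_none_def by blast
qed

text \<open>The clauses of \<open>representative\<close> in terms of signs; those that follow from
  the vertex signs, such as the crossings of an edge with a timelike end, are gone. In
  \<open>D6\<close> the third edge is left open as in \<open>representative\<close>; its sign is
  forced to be 0 by the exclusion of mixed crossings.\<close>

fun sign_pattern :: "causal_type \<Rightarrow> real \<Rightarrow> real \<Rightarrow> real \<Rightarrow> real \<Rightarrow> real \<Rightarrow> real \<Rightarrow> real \<Rightarrow> bool" where
  "sign_pattern A1 r1 r2 r3 m12 m13 m23 f \<longleftrightarrow> r1 \<noteq> 0 \<and> r2 = r1 \<and> r3 = r1"
| "sign_pattern A2 r1 r2 r3 m12 m13 m23 f \<longleftrightarrow> r1 \<noteq> 0 \<and> r2 = r1 \<and> r3 = - r1"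
| "sign_pattern B1 r1 r2 r3 m12 m13 m23 f \<longleftrightarrow> r1 \<noteq> 0 \<and> r2 = r1 \<and> r3 = 0"
| "sign_pattern B2 r1 r2 r3 m12 m13 m23 f \<longleftrightarrow> r1 \<noteq> 0 \<and> r2 = - r1 \<and> r3 = 0"
| "sign_pattern C1 r1 r2 r3 m12 m13 m23 f \<longleftrightarrow> r1 \<noteq> 0 \<and> r2 = 0 \<and> r3 = 0 \<and> m23 = 0"
| "sign_pattern C2 r1 r2 r3 m12 m13 m23 f \<longleftrightarrow> r1 \<noteq> 0 \<and> r2 = 0 \<and> r3 = 0 \<and> m23 = r1"
| "sign_pattern C3 r1 r2 r3 m12 m13 m23 f \<longleftrightarrow> r1 \<noteq> 0 \<and> r2 = 0 \<and> r3 = 0 \<and> m23 = - r1"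
| "sign_pattern D1 r1 r2 r3 m12 m13 m23 f \<longleftrightarrow>
     r1 = 0 \<and> r2 = 0 \<and> r3 = 0 \<and> m12 = 0 \<and> m13 = 0 \<and> m23 = 0 \<and> f = 0"
| "sign_pattern D2 r1 r2 r3 m12 m13 m23 f \<longleftrightarrow>
     r1 = 0 \<and> r2 = 0 \<and> r3 = 0 \<and> m12 = 0 \<and> m13 = 0 \<and> m23 = 0 \<and> f \<noteq> 0"
| "sign_pattern D3 r1 r2 r3 m12 m13 m23 f \<longleftrightarrow>
     r1 = 0 \<and> r2 = 0 \<and> r3 = 0 \<and> m12 \<noteq> 0 \<and> m13 = 0 \<and> m23 = 0"
| "sign_pattern D4 r1 r2 r3 m12 m13 m23 f \<longleftrightarrow>
     r1 = 0 \<and> r2 = 0 \<and> r3 = 0 \<and> m12 \<noteq> 0 \<and> m13 = m12 \<and> m23 = 0"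
| "sign_pattern D5 r1 r2 r3 m12 m13 m23 f \<longleftrightarrow>
     r1 = 0 \<and> r2 = 0 \<and> r3 = 0 \<and> m12 \<noteq> 0 \<and> m13 = m12 \<and> m23 = m12"
| "sign_pattern D6 r1 r2 r3 m12 m13 m23 f \<longleftrightarrow>
     r1 = 0 \<and> r2 = 0 \<and> r3 = 0 \<and> m12 \<noteq> 0 \<and> m13 = - m12"

lemma ex_signs: "(\<exists>e\<in>signs. P e) \<longleftrightarrow> P 1 \<or> P (- 1)" and all_signs: "(\<forall>e\<in>signs. P e) \<longleftrightarrow> P 1 \<and> P (- 1)"
  by auto

lemma representative_iff:
  assumes v: "admissible v"
  shows "representative t v \<longleftrightarrow> sign_pattern t (vertex_sign v 1) (vertex_sign v 2) (vertex_sign v 3)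
    (link_sign v 1 2) (link_sign v 1 3) (link_sign v 2 3) (opposite_sign v)"
proof -
  have s1: "(1::real) \<in> signs" and s2: "(- 1::real) \<in> signs" by simp_all
  define r1 r2 r3 m12 m13 m23 where defs: "r1 = vertex_sign v 1" "r2 = vertex_sign v 2" "r3 = vertex_sign v 3"
    "m12 = link_sign v 1 2" "m13 = link_sign v 1 3" "m23 = link_sign v 2 3"
  have rv: "r1 = 0 \<or> r1 = 1 \<or> r1 = - 1" "r2 = 0 \<or> r2 = 1 \<or> r2 = - 1" "r3 = 0 \<or> r3 = 1 \<or> r3 = - 1"
    using vertex_sign_values[OF v, of 1] vertex_sign_values[OF v, of 2] vertex_sign_values[OF v, of 3]
    by (simp_all add: defs)
  have mv: "m12 = 0 \<or> m12 = 1 \<or> m12 = - 1" "m13 = 0 \<or> m13 = 1 \<or> m13 = - 1" "m23 = 0 \<or> m23 = 1 \<or> m23 = - 1"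
    using link_sign_values[of v 1 2] link_sign_values[of v 1 3] link_sign_values[of v 2 3]
    by (simp_all add: defs)
  have mp: "meets v e {1, 2} \<longleftrightarrow> (if r1 = 0 \<and> r2 = 0 then m12 = e else r1 \<noteq> r2 \<and> (r1 = e \<or> r2 = e))"
    "meets v e {1, 3} \<longleftrightarrow> (if r1 = 0 \<and> r3 = 0 then m13 = e else r1 \<noteq> r3 \<and> (r1 = e \<or> r3 = e))"
    "meets v e {2, 3} \<longleftrightarrow> (if r2 = 0 \<and> r3 = 0 then m23 = e else r2 \<noteq> r3 \<and> (r2 = e \<or> r3 = e))"
    if "e \<in> signs" for e
    using meets_pair_iff[OF v _ _ _ that, of 1 2] meets_pair_iff[OF v _ _ _ that, of 1 3]
      meets_pair_iff[OF v _ _ _ that, of 2 3] unfolding defs by simp_all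
  have sl: "spacelike_vertex v 1 \<longleftrightarrow> r1 = 0" "spacelike_vertex v 2 \<longleftrightarrow> r2 = 0" "spacelike_vertex v 3 \<longleftrightarrow> r3 = 0"
    using spacelike_vertex_iff[OF v, of 1] spacelike_vertex_iff[OF v, of 2] spacelike_vertex_iff[OF v, of 3]
    unfolding defs by simp_all
  note tl = timelike_vertex_iff[OF s1] timelike_vertex_iff[OF s2]
  note basic = tl sl mp[OF s1] mp[OF s2] meets_none_def ex_signs all_signs defs[symmetric]
  show ?thesis
  proof (cases t)
    case A1
    have N: "meets_none v {1, 2, 3}" if "r1 \<in> signs" "r2 = r1" "r3 = r1"
      by (rule meets_none_timelike[OF v that(1)]) (simp add: defs[symmetric] that(2,3))
    have "representative A1 v \<longleftrightarrow>
        (r1 = 1 \<and> r2 = 1 \<and> r3 = 1 \<or> r1 = - 1 \<and> r2 = - 1 \<and> r3 = - 1) \<and> meets_none v {1, 2, 3}"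
      unfolding representative.simps ex_signs tl defs[symmetric] ..
    also have "\<dots> \<longleftrightarrow> r1 \<noteq> 0 \<and> r2 = r1 \<and> r3 = r1"
      using rv(1) N by (elim disjE) auto
    finally show ?thesis
      unfolding A1 sign_pattern.simps defs[symmetric] .
  next
    case A2
    have N: "\<forall>e\<in>signs. meets v e {1, 2, 3}" if "r1 = 1 \<or> r1 = - 1" "r3 = - r1"
    proof
      fix e :: real assume e: "e \<in> signs"
      \<comment> \<open>An edge between opposite time cones meets both light cones.\<close>
      have "meets v e {1, 3}"
        unfolding mp(2)[OF e] using that e by auto
      then show "meets v e {1, 2, 3}" by (rule meets_mono) auto
    qed
    have "representative A2 v \<longleftrightarrow>
        (r1 = 1 \<and> r2 = 1 \<and> r3 = - 1 \<or> r1 = - 1 \<and> r2 = - 1 \<and> r3 = 1) \<and> (\<forall>e\<in>signs. meets v e {1, 2, 3})"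
      unfolding representative.simps ex_signs tl minus_minus defs[symmetric] ..
    also have "\<dots> \<longleftrightarrow> r1 \<noteq> 0 \<and> r2 = r1 \<and> r3 = - r1"
      using rv(1) N by (elim disjE) auto
    finally show ?thesis
      unfolding A2 sign_pattern.simps defs[symmetric] .
  next
    case B1
    show ?thesis
    proof (cases "r3 = 0")
      case True
      then have z: "r3 = 0" by simp_all
      show ?thesis
        unfolding B1 representative.simps sign_pattern.simps
        using rv(1,2) by (elim disjE; simp add: basic z)
    next
      case False
      then show ?thesis
        unfolding B1 representative.simps sign_pattern.simps sl defs[symmetric] by blast
    qed
  next
    case B2
    show ?thesis
    proof (cases "r3 = 0")
      case True
      then have z: "r3 = 0" by simp_all
      show ?thesis
        unfolding B2 representative.simps sign_pattern.simps
        using rv(1,2) by (elim disjE; simp add: basic z)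
    next
      case False
      then show ?thesis
        unfolding B2 representative.simps sign_pattern.simps sl defs[symmetric] by blast
    qed
  next
    case C1
    show ?thesis
    proof (cases "r2 = 0 \<and> r3 = 0")
      case True
      then have z: "r2 = 0" "r3 = 0" by simp_all
      show ?thesis
        unfolding C1 representative.simps sign_pattern.simps
        using rv(1) mv(3) by (elim disjE; simp add: basic z)
    next
      case False
      then show ?thesis
        unfolding C1 representative.simps sign_pattern.simps sl defs[symmetric] by blast
    qed
  next
    case C2
    have card: "card (lightcone e (v 0) \<inter> face v {2, 3}) = 2 \<longleftrightarrow> m23 = e"
      if "r2 = 0" "r3 = 0" "e \<in> signs" for e
    proof
      assume "card (lightcone e (v 0) \<inter> face v {2, 3}) = 2"
      then have "meets v e {2, 3}" unfolding meets_def by auto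
      then show "m23 = e" using that by (simp add: mp(3)[OF that(3)])
    next
      assume "m23 = e"
      then show "card (lightcone e (v 0) \<inter> face v {2, 3}) = 2"
        using that by (intro pair_card[OF v]) (simp_all add: defs)
    qed
    have "representative C2 v \<longleftrightarrow> (r1 = 1 \<or> r1 = - 1) \<and> r2 = 0 \<and> r3 = 0 \<and>
        (meets v 1 {1, 2} \<and> meets v 1 {1, 3} \<and> m23 = 1 \<or> meets v (- 1) {1, 2} \<and> meets v (- 1) {1, 3} \<and> m23 = - 1)"
      unfolding representative.simps ex_signs tl sl defs[symmetric]
      using card[OF _ _ s1] card[OF _ _ s2] by blast
    also have "\<dots> \<longleftrightarrow> r1 \<noteq> 0 \<and> r2 = 0 \<and> r3 = 0 \<and> m23 = r1"
    proof (cases "r2 = 0 \<and> r3 = 0")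
      case True
      then have z: "r2 = 0" "r3 = 0" by simp_all
      show ?thesis
        using rv(1) by (elim disjE; simp add: mp[OF s1] mp[OF s2] z)
    qed blast
    finally show ?thesis by (simp add: C2 defs)
  next
    case C3
    show ?thesis
    proof (cases "r2 = 0 \<and> r3 = 0")
      case True
      then have z: "r2 = 0" "r3 = 0" by simp_all
      show ?thesis
        unfolding C3 representative.simps sign_pattern.simps
        using rv(1) mv(3) by (elim disjE; simp add: basic z)
    next
      case False
      then show ?thesis
        unfolding C3 representative.simps sign_pattern.simps sl defs[symmetric] by blast
    qed
  next
    case D1
    have "meets_none v {1, 2, 3} \<longleftrightarrow> m12 = 0 \<and> m13 = 0 \<and> m23 = 0 \<and> opposite_sign v = 0"
      if z: "r1 = 0" "r2 = 0" "r3 = 0"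
    proof
      assume n: "meets_none v {1, 2, 3}"
      have "meets_none v {i, j}" if "{i, j} \<subseteq> {1, 2, 3}" for i j
        using n that meets_mono[of v _ "{i, j}" "{1, 2, 3}"] unfolding meets_none_def by blast
      from this[of 1 2] this[of 1 3] this[of 2 3]
      have "m12 = 0 \<and> m13 = 0 \<and> m23 = 0"
        using z by (simp add: meets_none_iff link_sign_def defs)
      moreover have "opposite_sign v = 0"
        using n by (simp add: meets_none_iff opposite_sign_def)
      ultimately show "m12 = 0 \<and> m13 = 0 \<and> m23 = 0 \<and> opposite_sign v = 0" by simp
    next
      assume "m12 = 0 \<and> m13 = 0 \<and> m23 = 0 \<and> opposite_sign v = 0"
      then have "m12 = 0" "m13 = 0" "m23 = 0" "opposite_sign v = 0" by simp_all
      then show "meets_none v {1, 2, 3}"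
        using z by (simp add: meets_none_iff opposite_sign_def defs)
    qed
    then show ?thesis by (auto simp: D1 sl defs[symmetric])
  next
    case D2
    have "representative D2 v \<longleftrightarrow> r1 = 0 \<and> r2 = 0 \<and> r3 = 0 \<and> m12 = 0 \<and> m13 = 0 \<and> m23 = 0 \<and>
        (\<exists>e\<in>signs. closed_conic_inside v e \<and> lightcone (- e) (v 0) \<inter> rel_interior (opposite v) = {})"
      by (auto simp: sl meets_none_iff link_sign_def defs)
    also have "\<dots> \<longleftrightarrow> r1 = 0 \<and> r2 = 0 \<and> r3 = 0 \<and> m12 = 0 \<and> m13 = 0 \<and> m23 = 0 \<and> opposite_sign v \<noteq> 0"
    proof (intro conj_cong refl)
      assume z: "r1 = 0" "r2 = 0" "r3 = 0" "m12 = 0" "m13 = 0" "m23 = 0"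
      have z': "\<forall>i\<in>{1, 2, 3}. vertex_sign v i = 0" "link_sign v 1 2 = 0" "link_sign v 1 3 = 0" "link_sign v 2 3 = 0"
        using z by (simp_all add: defs)
      \<comment> \<open>A closed conic inside is nonempty and lies in the triangle; the converse is
        \<open>closed_conic\<close>.\<close>
      have "meets v e {1, 2, 3}" if "closed_conic_inside v e" for e
        using that rel_interior_subset[of "opposite v"]
        unfolding closed_conic_inside_def meets_def Let_def by blast
      then have "(\<exists>e\<in>signs. closed_conic_inside v e \<and> lightcone (- e) (v 0) \<inter> rel_interior (opposite v) = {}) \<longleftrightarrow>
          (\<exists>e\<in>signs. meets v e {1, 2, 3})"
        using closed_conic[OF v z'] by blast
      also have "\<dots> \<longleftrightarrow> (\<exists>e\<in>signs. opposite_sign v = e)"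
        using opposite_sign_iff[OF v z'] by blast
      also have "\<dots> \<longleftrightarrow> opposite_sign v \<noteq> 0"
        using opposite_sign_values[of v] by auto
      finally show "(\<exists>e\<in>signs. closed_conic_inside v e \<and> lightcone (- e) (v 0) \<inter> rel_interior (opposite v) = {}) \<longleftrightarrow>
          opposite_sign v \<noteq> 0" .
    qed
    finally show ?thesis by (simp add: D2 defs)
  next
    case D3
    show ?thesis
    proof (cases "r1 = 0 \<and> r2 = 0 \<and> r3 = 0")
      case True
      then have z: "r1 = 0" "r2 = 0" "r3 = 0" by simp_all
      show ?thesis
        unfolding D3 representative.simps sign_pattern.simps
        using mv by (elim disjE; simp add: basic z)
    next
      case False
      then show ?thesis
        unfolding D3 representative.simps sign_pattern.simps sl defs[symmetric] by blast
    qed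
  next
    case D4
    show ?thesis
    proof (cases "r1 = 0 \<and> r2 = 0 \<and> r3 = 0")
      case True
      then have z: "r1 = 0" "r2 = 0" "r3 = 0" by simp_all
      show ?thesis
        unfolding D4 representative.simps sign_pattern.simps
        using mv by (elim disjE; simp add: basic z)
    next
      case False
      then show ?thesis
        unfolding D4 representative.simps sign_pattern.simps sl defs[symmetric] by blast
    qed
  next
    case D5
    show ?thesis
    proof (cases "r1 = 0 \<and> r2 = 0 \<and> r3 = 0")
      case True
      then have z: "r1 = 0" "r2 = 0" "r3 = 0" by simp_all
      show ?thesis
        unfolding D5 representative.simps sign_pattern.simps
        using mv by (elim disjE; simp add: basic z)
    next
      case False
      then show ?thesis
        unfolding D5 representative.simps sign_pattern.simps sl defs[symmetric] by blast
    qed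
  next
    case D6
    show ?thesis
    proof (cases "r1 = 0 \<and> r2 = 0 \<and> r3 = 0")
      case True
      then have z: "r1 = 0" "r2 = 0" "r3 = 0" by simp_all
      show ?thesis
        unfolding D6 representative.simps sign_pattern.simps
        using mv by (elim disjE; simp add: basic z)
    next
      case False
      then show ?thesis
        unfolding D6 representative.simps sign_pattern.simps sl defs[symmetric] by blast
    qed
  qed
qed

subsection \<open>Classification of the sign patterns\<close>

text \<open>A crossed edge contains a timelike point of its sign. Mixed signs would make
  \<open>v i\<close> timelike by \<open>no_mixed_crossing\<close>, whereas a nonzero link sign is
  given only to edges with spacelike ends.\<close>

lemma link_sign_mixed:
  assumes v: "admissible v" and ijk: "i \<noteq> 0" "j \<noteq> 0" "k \<noteq> 0" "i \<noteq> j" "i \<noteq> k" "j \<noteq> k"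
    and e: "e \<in> signs" and l: "link_sign v i j = e" "link_sign v i k = e"
  shows "link_sign v j k \<noteq> - e"
proof
  assume l3: "link_sign v j k = - e"
  have e0: "e \<noteq> 0" using e by auto
  have z: "vertex_sign v i = 0" "vertex_sign v j = 0" "vertex_sign v k = 0"
    using l e0 by (auto simp: link_sign_def split: if_splits)
  have pos: "mink (v n - v 0) (v n - v 0) > 0" if "n \<noteq> 0" "vertex_sign v n = 0" for n
  proof -
    have "causal_rank (v n - v 0) = 0" using that(2) by (simp add: vertex_sign_def)
    then show ?thesis
      using admissible_vertex[OF v that(1)] by (auto simp: causal_rank_eq_0_iff)
  qed
  have es: "edge_sign (v n - v 0) (v m - v 0) = link_sign v n m"
    if "vertex_sign v n = 0" "vertex_sign v m = 0" for n m
    using that by (simp add: edge_sign_meeting link_sign_def)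
  obtain x1 y1 where 1: "x1 > 0" "y1 > 0" "causal_rank (x1 *\<^sub>R (v i - v 0) + y1 *\<^sub>R (v j - v 0)) = 2 * e"
    by (rule edge_sign_timelike[OF pos[OF ijk(1) z(1)] pos[OF ijk(2) z(2)] admissible_pair[OF v ijk(1,2,4)]
          trans[OF es[OF z(1,2)] l(1)] e0])
  obtain x2 z2 where 2: "x2 > 0" "z2 > 0" "causal_rank (x2 *\<^sub>R (v i - v 0) + z2 *\<^sub>R (v k - v 0)) = 2 * e"
    by (rule edge_sign_timelike[OF pos[OF ijk(1) z(1)] pos[OF ijk(3) z(3)] admissible_pair[OF v ijk(1,3,5)]
          trans[OF es[OF z(1,3)] l(2)] e0])
  have "- e \<noteq> 0" using e0 by simp
  then obtain y3 z3 where 3: "y3 > 0" "z3 > 0"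
    "causal_rank (y3 *\<^sub>R (v j - v 0) + z3 *\<^sub>R (v k - v 0)) = 2 * - e"
    by (rule edge_sign_timelike[OF pos[OF ijk(2) z(2)] pos[OF ijk(3) z(3)] admissible_pair[OF v ijk(2,3,6)]
          trans[OF es[OF z(2,3)] l3]])
  have "causal_rank (v i - v 0) = 2 * e"
    by (rule no_mixed_crossing[OF e 1(3,1,2) 2(3,1,2) _ 3(1,2)]) (use 3(3) in simp)
  then show False
    using z(1) e0 by (simp add: vertex_sign_def)
qed

text \<open>The arithmetic constraints on a signature. The last clause excludes crossings of mixed
  sign; the others fix the possible values and the convention that signs determined by others are
  0.\<close>

definition valid_signs :: "real \<Rightarrow> real \<Rightarrow> real \<Rightarrow> real \<Rightarrow> real \<Rightarrow> real \<Rightarrow> real \<Rightarrow> bool" where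
  "valid_signs r1 r2 r3 m12 m13 m23 f \<longleftrightarrow>
     r1 \<in> {0, 1, - 1} \<and> r2 \<in> {0, 1, - 1} \<and> r3 \<in> {0, 1, - 1} \<and>
     m12 \<in> {0, 1, - 1} \<and> m13 \<in> {0, 1, - 1} \<and> m23 \<in> {0, 1, - 1} \<and> f \<in> {0, 1, - 1} \<and>
     (r1 \<noteq> 0 \<or> r2 \<noteq> 0 \<longrightarrow> m12 = 0) \<and> (r1 \<noteq> 0 \<or> r3 \<noteq> 0 \<longrightarrow> m13 = 0) \<and> (r2 \<noteq> 0 \<or> r3 \<noteq> 0 \<longrightarrow> m23 = 0) \<and>
     (r1 \<noteq> 0 \<or> r2 \<noteq> 0 \<or> r3 \<noteq> 0 \<or> m12 \<noteq> 0 \<or> m13 \<noteq> 0 \<or> m23 \<noteq> 0 \<longrightarrow> f = 0) \<and>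
     (m12 \<noteq> 0 \<and> m13 \<noteq> 0 \<and> m23 \<noteq> 0 \<longrightarrow> m12 = m13 \<and> m13 = m23)"

lemma admissible_valid_signs:
  assumes v: "admissible v"
  shows "valid_signs (vertex_sign v 1) (vertex_sign v 2) (vertex_sign v 3)
    (link_sign v 1 2) (link_sign v 1 3) (link_sign v 2 3) (opposite_sign v)"
proof -
  have s: "link_sign v i j \<in> signs" if "link_sign v i j \<noteq> 0" for i j
    using link_sign_values[of v i j] that by simp
  have 1: "link_sign v 1 2 = link_sign v 1 3 \<and> link_sign v 1 3 = link_sign v 2 3"
    if n: "link_sign v 1 2 \<noteq> 0 \<and> link_sign v 1 3 \<noteq> 0 \<and> link_sign v 2 3 \<noteq> 0"
  proof -
    \<comment> \<open>Of three signs two agree. Each of the three cases is settled by the common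
      vertex of the two edges that agree.\<close>
    have pure: "x = y \<and> y = z"
      if "x \<in> signs" "y \<in> signs" "z \<in> signs" "y = x \<Longrightarrow> z \<noteq> - x" "z = x \<Longrightarrow> y \<noteq> - x" "z = y \<Longrightarrow> x \<noteq> - y"
      for x y z :: real
      using that by (elim insertE emptyE) simp_all
    show ?thesis
    proof (rule pure)
      show sg: "link_sign v 1 2 \<in> signs" "link_sign v 1 3 \<in> signs" "link_sign v 2 3 \<in> signs"
        by (rule s, use n in blast)+
      show "link_sign v 2 3 \<noteq> - link_sign v 1 2" if "link_sign v 1 3 = link_sign v 1 2"
        by (rule link_sign_mixed[OF v, of 1]) (use sg that in simp_all)
      show "link_sign v 1 3 \<noteq> - link_sign v 1 2" if "link_sign v 2 3 = link_sign v 1 2"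
        by (rule link_sign_mixed[OF v, of 2])
          (use sg that link_sign_commute[of v 2 1] in simp_all)
      show "link_sign v 1 2 \<noteq> - link_sign v 1 3" if "link_sign v 2 3 = link_sign v 1 3"
        by (rule link_sign_mixed[OF v, of 3])
          (use sg that link_sign_commute[of v 3 1] link_sign_commute[of v 3 2] in simp_all)
    qed
  qed
  have 4: "vertex_sign v i \<noteq> 0 \<or> vertex_sign v j \<noteq> 0 \<longrightarrow> link_sign v i j = 0" for i j
    by (simp add: link_sign_def)
  have 5: "vertex_sign v 1 \<noteq> 0 \<or> vertex_sign v 2 \<noteq> 0 \<or> vertex_sign v 3 \<noteq> 0 \<or> link_sign v 1 2 \<noteq> 0 \<or>
      link_sign v 1 3 \<noteq> 0 \<or> link_sign v 2 3 \<noteq> 0 \<longrightarrow> opposite_sign v = 0"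
    by (simp add: opposite_sign_def)
  have 6: "vertex_sign v 1 \<in> {0, 1, - 1}" "vertex_sign v 2 \<in> {0, 1, - 1}" "vertex_sign v 3 \<in> {0, 1, - 1}"
    by (rule vertex_sign_values[OF v], simp)+
  show ?thesis
    unfolding valid_signs_def
    using 1 4 5 6 link_sign_values opposite_sign_values by simp
qed

text \<open>The absolute values below are invariant under permutations of the vertices and under a common
  change of sign.\<close>

definition classify_sums :: "real \<Rightarrow> real \<Rightarrow> real \<Rightarrow> real \<Rightarrow> real \<Rightarrow> real \<Rightarrow> causal_type" where
  "classify_sums p q a b c f =
     (if p = 3 then (if q = 3 then A1 else A2)
      else if p = 2 then (if q = 2 then B1 else B2)
      else if p = 1 then (if a = 0 then C1 else if c = 2 then C2 else C3)
      else if a = 0 then (if f = 0 then D1 else D2)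
      else if a = 1 then D3
      else if a = 2 then (if b = 2 then D4 else D6)
      else D5)"

text \<open>The sums are the number of timelike vertices and their net sign, the number of nonzero
  link signs and their net sign, and a mixed sum that tells \<open>C2\<close> (value 2) from
  \<open>C3\<close> (value 0).\<close>

definition classify :: "real \<Rightarrow> real \<Rightarrow> real \<Rightarrow> real \<Rightarrow> real \<Rightarrow> real \<Rightarrow> real \<Rightarrow> causal_type" where
  "classify r1 r2 r3 m12 m13 m23 f =
     classify_sums (\<bar>r1\<bar> + \<bar>r2\<bar> + \<bar>r3\<bar>) \<bar>r1 + r2 + r3\<bar> (\<bar>m12\<bar> + \<bar>m13\<bar> + \<bar>m23\<bar>) \<bar>m12 + m13 + m23\<bar>
       \<bar>r1 + r2 + r3 + (m12 + m13 + m23)\<bar> f"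

text \<open>One disjunct for each permutation of the three vertices; the link signs move with their
  pairs of ends.\<close>

definition has_pattern :: "causal_type \<Rightarrow> real \<Rightarrow> real \<Rightarrow> real \<Rightarrow> real \<Rightarrow> real \<Rightarrow> real \<Rightarrow> real \<Rightarrow> bool" where
  "has_pattern t r1 r2 r3 m12 m13 m23 f \<longleftrightarrow>
     sign_pattern t r1 r2 r3 m12 m13 m23 f \<or> sign_pattern t r1 r3 r2 m13 m12 m23 f \<or>
     sign_pattern t r2 r1 r3 m12 m23 m13 f \<or> sign_pattern t r2 r3 r1 m23 m12 m13 f \<or>
     sign_pattern t r3 r1 r2 m13 m23 m12 f \<or> sign_pattern t r3 r2 r1 m23 m13 m12 f"

text \<open>These two transpositions generate all permutations of the vertices.\<close>

lemma valid_signs_perm: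
  assumes "valid_signs r1 r2 r3 m12 m13 m23 f"
  shows "valid_signs r2 r1 r3 m12 m23 m13 f" "valid_signs r1 r3 r2 m13 m12 m23 f"
  using assms unfolding valid_signs_def by - (elim conjE, intro conjI; (assumption | blast | metis))+

lemma classify_perm:
  "classify r2 r1 r3 m12 m23 m13 f = classify r1 r2 r3 m12 m13 m23 f"
  "classify r1 r3 r2 m13 m12 m23 f = classify r1 r2 r3 m12 m13 m23 f"
  unfolding classify_def by (simp_all only: add.commute add.left_commute add.assoc)

lemma valid_signs_opposite:
  assumes "valid_signs r1 r2 r3 m12 m13 m23 f" "m12 \<noteq> 0" "m13 = - m12"
  shows "m23 = 0"
proof -
  have "m12 \<noteq> 0 \<and> m13 \<noteq> 0 \<and> m23 \<noteq> 0 \<longrightarrow> m12 = m13 \<and> m13 = m23"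
    using assms(1) unfolding valid_signs_def by blast
  then show ?thesis using assms(2,3) by auto
qed

lemma sign_pattern_classify:
  assumes v: "valid_signs r1 r2 r3 m12 m13 m23 f" and s: "sign_pattern t r1 r2 r3 m12 m13 m23 f"
  shows "classify r1 r2 r3 m12 m13 m23 f = t"
proof -
  have r: "r1 = 0 \<or> r1 = 1 \<or> r1 = - 1" and m: "m12 = 0 \<or> m12 = 1 \<or> m12 = - 1"
    using v by (simp_all add: valid_signs_def)
  have zm: "r1 \<noteq> 0 \<Longrightarrow> m12 = 0 \<and> m13 = 0" "r1 \<noteq> 0 \<Longrightarrow> r2 \<noteq> 0 \<Longrightarrow> m23 = 0"
    using v by (simp_all add: valid_signs_def)
  show ?thesis
  proof (cases t)
    case A1 with s zm r show ?thesis by (elim disjE; simp add: classify_def classify_sums_def)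
  next
    case A2 with s zm r show ?thesis by (elim disjE; simp add: classify_def classify_sums_def)
  next
    case B1 with s zm r show ?thesis by (elim disjE; simp add: classify_def classify_sums_def)
  next
    case B2 with s zm r show ?thesis by (elim disjE; simp add: classify_def classify_sums_def)
  next
    case C1 with s zm r show ?thesis by (elim disjE; simp add: classify_def classify_sums_def)
  next
    case C2 with s zm r show ?thesis by (elim disjE; simp add: classify_def classify_sums_def)
  next
    case C3 with s zm r show ?thesis by (elim disjE; simp add: classify_def classify_sums_def)
  next
    case D1 with s show ?thesis by (simp add: classify_def classify_sums_def)
  next
    case D2 with s show ?thesis by (simp add: classify_def classify_sums_def)
  next
    case D3 with s m show ?thesis by (elim disjE; simp add: classify_def classify_sums_def)
  next
    case D4 with s m show ?thesis by (elim disjE; simp add: classify_def classify_sums_def)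
  next
    case D5 with s m show ?thesis by (elim disjE; simp add: classify_def classify_sums_def)
  next
    case D6 with s m valid_signs_opposite[OF v] show ?thesis
      by (elim disjE; simp add: classify_def classify_sums_def)
  qed
qed

lemma has_pattern_classify:
  assumes v: "valid_signs r1 r2 r3 m12 m13 m23 f" and s: "has_pattern t r1 r2 r3 m12 m13 m23 f"
  shows "classify r1 r2 r3 m12 m13 m23 f = t"
proof -
  note v1 = valid_signs_perm(1)[OF v] and v2 = valid_signs_perm(2)[OF v]
  note v3 = valid_signs_perm(2)[OF v1] and v4 = valid_signs_perm(1)[OF v2]
  note v5 = valid_signs_perm(1)[OF v3]
  from s consider "sign_pattern t r1 r2 r3 m12 m13 m23 f" | "sign_pattern t r1 r3 r2 m13 m12 m23 f"
    | "sign_pattern t r2 r1 r3 m12 m23 m13 f" | "sign_pattern t r2 r3 r1 m23 m12 m13 f"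
    | "sign_pattern t r3 r1 r2 m13 m23 m12 f" | "sign_pattern t r3 r2 r1 m23 m13 m12 f"
    unfolding has_pattern_def by blast
  then show ?thesis
  proof cases
    case 1 then show ?thesis by (rule sign_pattern_classify[OF v])
  next
    case 2 then show ?thesis
      using sign_pattern_classify[OF v2] by (simp only: classify_perm(2))
  next
    case 3 then show ?thesis
      using sign_pattern_classify[OF v1] by (simp only: classify_perm(1))
  next
    case 4 then show ?thesis
      using sign_pattern_classify[OF v3 4] classify_perm(2)[of r2 r1 r3 m12 m23 m13 f]
        classify_perm(1)[of r1 r2 r3 m12 m13 m23 f] by simp
  next
    case 5 then show ?thesis
      using sign_pattern_classify[OF v4 5] classify_perm(1)[of r1 r3 r2 m13 m12 m23 f]
        classify_perm(2)[of r1 r2 r3 m12 m13 m23 f] by simp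
  next
    case 6 then show ?thesis
      using sign_pattern_classify[OF v5 6] classify_perm(1)[of r2 r3 r1 m23 m12 m13 f]
        classify_perm(2)[of r2 r1 r3 m12 m23 m13 f] classify_perm(1)[of r1 r2 r3 m12 m13 m23 f] by simp
  qed
qed

text \<open>The split by timelike vertices keeps the enumeration small: with exactly one of them a
  single link sign may be nonzero, and with two or more none.\<close>

lemma classify_has_pattern:
  assumes v: "valid_signs r1 r2 r3 m12 m13 m23 f"
  shows "has_pattern (classify r1 r2 r3 m12 m13 m23 f) r1 r2 r3 m12 m13 m23 f"
proof -
  have r: "r1 = 0 \<or> r1 = 1 \<or> r1 = - 1" "r2 = 0 \<or> r2 = 1 \<or> r2 = - 1" "r3 = 0 \<or> r3 = 1 \<or> r3 = - 1"
    and m: "m12 = 0 \<or> m12 = 1 \<or> m12 = - 1" "m13 = 0 \<or> m13 = 1 \<or> m13 = - 1" "m23 = 0 \<or> m23 = 1 \<or> m23 = - 1"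
    using v by (simp_all add: valid_signs_def)
  have z: "r1 \<noteq> 0 \<or> r2 \<noteq> 0 \<longrightarrow> m12 = 0" "r1 \<noteq> 0 \<or> r3 \<noteq> 0 \<longrightarrow> m13 = 0" "r2 \<noteq> 0 \<or> r3 \<noteq> 0 \<longrightarrow> m23 = 0"
    and x: "m12 \<noteq> 0 \<and> m13 \<noteq> 0 \<and> m23 \<noteq> 0 \<longrightarrow> m12 = m13 \<and> m13 = m23"
    using v unfolding valid_signs_def by blast+
  consider "r1 = 0" "r2 = 0" "r3 = 0" | "r1 \<noteq> 0" "r2 = 0" "r3 = 0" | "r1 = 0" "r2 \<noteq> 0" "r3 = 0"
    | "r1 = 0" "r2 = 0" "r3 \<noteq> 0" | "r1 \<noteq> 0" "r2 \<noteq> 0" | "r1 \<noteq> 0" "r3 \<noteq> 0" | "r2 \<noteq> 0" "r3 \<noteq> 0"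
    by blast
  then show ?thesis
  proof cases
    case 1
    from m x show ?thesis
      unfolding has_pattern_def 1 by (elim disjE; simp add: classify_def classify_sums_def)
  next
    case 2
    with r(1) m(3) z show ?thesis
      unfolding has_pattern_def by (elim disjE; simp add: classify_def classify_sums_def)
  next
    case 3
    with r(2) m(2) z show ?thesis
      unfolding has_pattern_def by (elim disjE; simp add: classify_def classify_sums_def)
  next
    case 4
    with r(3) m(1) z show ?thesis
      unfolding has_pattern_def by (elim disjE; simp add: classify_def classify_sums_def)
  next
    case 5
    then have "m12 = 0" "m13 = 0" "m23 = 0" using z by simp_all
    with 5 r show ?thesis
      unfolding has_pattern_def by (elim disjE; simp add: classify_def classify_sums_def)
  next
    case 6
    then have "m12 = 0" "m13 = 0" "m23 = 0" using z by simp_all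
    with 6 r show ?thesis
      unfolding has_pattern_def by (elim disjE; simp add: classify_def classify_sums_def)
  next
    case 7
    then have "m12 = 0" "m13 = 0" "m23 = 0" using z by simp_all
    with 7 r show ?thesis
      unfolding has_pattern_def by (elim disjE; simp add: classify_def classify_sums_def)
  qed
qed

subsection \<open>Relabelling the vertices\<close>

lemma relabelling_cases:
  assumes "relabelling p"
  obtains "p 1 = 1" "p 2 = 2" "p 3 = 3" | "p 1 = 1" "p 2 = 3" "p 3 = 2" | "p 1 = 2" "p 2 = 1" "p 3 = 3"
    | "p 1 = 2" "p 2 = 3" "p 3 = 1" | "p 1 = 3" "p 2 = 1" "p 3 = 2" | "p 1 = 3" "p 2 = 2" "p 3 = 1"
proof -
  have inj: "inj p" and p0: "p 0 = 0"
    using assms by (auto simp: relabelling_def bij_def)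
  have "p i \<in> {1, 2, 3}" if "i \<noteq> 0" for i
  proof -
    have "p i \<noteq> 0" using inj_eq[OF inj, of i 0] p0 that by simp
    then show ?thesis using index4_cases[of "p i"] by blast
  qed
  from this[of 1] this[of 2] this[of 3]
  have "p 1 \<in> {1, 2, 3}" "p 2 \<in> {1, 2, 3}" "p 3 \<in> {1, 2, 3}" by simp_all
  moreover have "p 1 \<noteq> p 2" "p 1 \<noteq> p 3" "p 2 \<noteq> p 3"
    using inj by (simp_all add: inj_eq)
  ultimately show thesis
    using that by (elim insertE emptyE) simp_all
qed

definition perm3 :: "4 \<Rightarrow> 4 \<Rightarrow> 4 \<Rightarrow> 4 \<Rightarrow> 4" where
  "perm3 a b c i = (if i = 1 then a else if i = 2 then b else if i = 3 then c else 0)"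

lemma perm3_simps [simp]: "perm3 a b c 0 = 0" "perm3 a b c 1 = a" "perm3 a b c 2 = b" "perm3 a b c 3 = c"
  by (simp_all add: perm3_def)

lemma relabelling_perm3:
  assumes "{a, b, c} = {1, 2, 3}"
  shows "relabelling (perm3 a b c)"
proof -
  have "range (perm3 a b c) = perm3 a b c ` {0, 1, 2, 3}" by (simp only: UNIV4)
  also have "\<dots> = insert 0 {a, b, c}" by simp
  also have "\<dots> = UNIV" unfolding assms UNIV4 by simp
  finally have "surj (perm3 a b c)" .
  moreover from this have "inj (perm3 a b c)" by (intro finite_UNIV_surj_inj) simp_all
  ultimately show ?thesis by (simp add: relabelling_def bij_def)
qed

lemma relabelling_comp: "relabelling p \<Longrightarrow> relabelling q \<Longrightarrow> relabelling (p \<circ> q)"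
  by (simp add: relabelling_def bij_comp)

lemma admissible_comp:
  assumes p: "relabelling p" and v: "admissible v"
  shows "admissible (v \<circ> p)"
proof -
  have p': "inj p" "range p = UNIV"
    using p by (simp_all add: relabelling_def bij_def)
  have "range (v \<circ> p) = range v" by (metis image_comp p'(2))
  then have "tetrahedron (v \<circ> p)"
    using v p'(1) by (simp add: admissible_def tetrahedron_def inj_compose)
  moreover have "no_null_edges (v \<circ> p)" "no_null_faces (v \<circ> p)"
    using v p'(1) unfolding admissible_def no_null_edges_def no_null_faces_def by (simp_all add: inj_eq)
  ultimately show ?thesis by (simp add: admissible_def)
qed

lemma face_comp: "face (v \<circ> p) J = face v (p ` J)"
  by (simp only: face_def image_comp)

lemma comp_signs:
  assumes p: "relabelling p"
  shows "vertex_sign (v \<circ> p) i = vertex_sign v (p i)" "meets (v \<circ> p) e J \<longleftrightarrow> meets v e (p ` J)"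
    "link_sign (v \<circ> p) i j = link_sign v (p i) (p j)" "opposite_sign (v \<circ> p) = opposite_sign v"
proof -
  have p0: "p 0 = 0" using p by (simp add: relabelling_def)
  show vs: "vertex_sign (v \<circ> p) i = vertex_sign v (p i)" for i by (simp add: vertex_sign_def p0)
  show m: "meets (v \<circ> p) e J \<longleftrightarrow> meets v e (p ` J)" for e J by (simp add: meets_def face_comp p0)
  have ms: "meeting_sign (v \<circ> p) J = meeting_sign v (p ` J)" for J by (simp add: meeting_sign_def m)
  show ls: "link_sign (v \<circ> p) i j = link_sign v (p i) (p j)" for i j by (simp add: link_sign_def vs ms)
  have l: "link_sign v 2 1 = link_sign v 1 2" "link_sign v 3 1 = link_sign v 1 3" "link_sign v 3 2 = link_sign v 2 3"
    by (rule link_sign_commute)+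
  have img: "p ` {1, 2, 3} = {1, 2, 3}"
    by (rule relabelling_cases[OF p]) auto
  have "(\<forall>i\<in>{1, 2, 3}. vertex_sign v (p i) = 0) \<longleftrightarrow> (\<forall>i\<in>{1, 2, 3}. vertex_sign v i = 0)"
    by (rule relabelling_cases[OF p]) auto
  moreover have "link_sign v (p 1) (p 2) = 0 \<and> link_sign v (p 1) (p 3) = 0 \<and> link_sign v (p 2) (p 3) = 0 \<longleftrightarrow>
      link_sign v 1 2 = 0 \<and> link_sign v 1 3 = 0 \<and> link_sign v 2 3 = 0"
    by (rule relabelling_cases[OF p]) (simp_all add: l, auto)
  ultimately show "opposite_sign (v \<circ> p) = opposite_sign v"
    unfolding opposite_sign_def vs ls ms img by presburger
qed

definition vertex_type :: "vertices \<Rightarrow> causal_type" where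
  "vertex_type v = classify (vertex_sign v 1) (vertex_sign v 2) (vertex_sign v 3)
     (link_sign v 1 2) (link_sign v 1 3) (link_sign v 2 3) (opposite_sign v)"

lemma has_type_iff_pattern:
  assumes v: "admissible v"
  shows "has_type t v \<longleftrightarrow> has_pattern t (vertex_sign v 1) (vertex_sign v 2) (vertex_sign v 3)
     (link_sign v 1 2) (link_sign v 1 3) (link_sign v 2 3) (opposite_sign v)" (is "_ \<longleftrightarrow> ?P")
proof -
  have l: "link_sign v 2 1 = link_sign v 1 2" "link_sign v 3 1 = link_sign v 1 3" "link_sign v 3 2 = link_sign v 2 3"
    by (rule link_sign_commute)+
  have rep: "representative t (v \<circ> p) \<longleftrightarrow> sign_pattern t (vertex_sign v (p 1)) (vertex_sign v (p 2))
      (vertex_sign v (p 3)) (link_sign v (p 1) (p 2)) (link_sign v (p 1) (p 3)) (link_sign v (p 2) (p 3))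
      (opposite_sign v)" if "relabelling p" for p
    unfolding representative_iff[OF admissible_comp[OF that v]] comp_signs[OF that] ..
  show ?thesis
  proof
    assume "has_type t v"
    then obtain p where p: "relabelling p" "representative t (v \<circ> p)"
      by (auto simp: has_type_def)
    from p(2)[unfolded rep[OF p(1)]] show ?P
      unfolding has_pattern_def by - (rule relabelling_cases[OF p(1)]; simp add: l)
  next
    assume ?P
    have ht: "has_type t v" if "{a, b, c} = {1, 2, 3}" "sign_pattern t (vertex_sign v a) (vertex_sign v b)
      (vertex_sign v c) (link_sign v a b) (link_sign v a c) (link_sign v b c) (opposite_sign v)" for a b c
      unfolding has_type_def using that rep[OF relabelling_perm3[OF that(1)]] relabelling_perm3[OF that(1)]
      by (intro exI[of _ "perm3 a b c"]) simp
    from \<open>?P\<close> show "has_type t v"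
      unfolding has_pattern_def
      using ht[of 1 2 3] ht[of 1 3 2] ht[of 2 1 3] ht[of 2 3 1] ht[of 3 1 2] ht[of 3 2 1]
      by (elim disjE) (simp_all add: l insert_commute)
  qed
qed

lemma has_type_iff:
  assumes v: "admissible v"
  shows "has_type t v \<longleftrightarrow> vertex_type v = t"
  unfolding has_type_iff_pattern[OF v] vertex_type_def
  using has_pattern_classify[OF admissible_valid_signs[OF v]] classify_has_pattern[OF admissible_valid_signs[OF v]]
  by blast

text \<open>Types are defined up to relabelling, and relabellings compose; uniqueness of the type
  does the rest, without any computation.\<close>

lemma vertex_type_comp:
  assumes v: "admissible v" and p: "relabelling p"
  shows "vertex_type (v \<circ> p) = vertex_type v"
proof -
  have "has_type (vertex_type (v \<circ> p)) (v \<circ> p)"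
    using has_type_iff[OF admissible_comp[OF p v]] by blast
  then obtain q where "relabelling q" "representative (vertex_type (v \<circ> p)) (v \<circ> p \<circ> q)"
    by (auto simp: has_type_def)
  then have "has_type (vertex_type (v \<circ> p)) v"
    unfolding has_type_def using relabelling_comp[OF p] by (metis comp_assoc)
  then show ?thesis using has_type_iff[OF v] by simp
qed

subsection \<open>Transfer of the signs\<close>

text \<open>The relabelling is moved into \<open>w\<close>, so that signs can be compared label by
  label.\<close>

lemma same_structure_relabel:
  assumes "relabelling p"
  shows "same_structure p s v w \<longleftrightarrow> same_structure id s v (w \<circ> p)"
proof -
  have "p 0 = 0" "range p = UNIV"
    using assms by (simp_all add: relabelling_def bij_def)
  then show ?thesis
    by (simp add: same_structure_def face_comp)
qed

text \<open>The signs depend only on the time cones of the vertices and on which light cones meet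
  which faces of the opposite triangle. In this form the lemma serves homeomorphisms of the
  tetrahedra and of the opposite triangles alike.\<close>

lemma matching_signature:
  assumes v: "admissible v" and w: "admissible w" and s: "s \<in> signs"
    and r: "\<And>i. i \<in> {1, 2, 3} \<Longrightarrow> vertex_sign w i = s * vertex_sign v i"
    and m: "\<And>e J. e \<in> signs \<Longrightarrow> J \<subseteq> {1, 2, 3} \<Longrightarrow> meets w (s * e) J \<longleftrightarrow> meets v e J"
  shows "signature w = map ((*) s) (signature v)"
proof -
  have s0: "s \<noteq> 0" using s by auto
  have m': "meets w e J \<longleftrightarrow> meets v (s * e) J" if "e \<in> signs" "J \<subseteq> {1, 2, 3}" for e J
  proof -
    have ss: "s * (s * e) = e" using s by auto
    show ?thesis using m[OF sign_mult_signs[OF s that(1)] that(2)] unfolding ss .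
  qed
  have l: "link_sign w i j = s * link_sign v i j"
    if ij: "i \<in> {1, 2, 3}" "j \<in> {1, 2, 3}" "i \<noteq> j" for i j
  proof (cases "vertex_sign v i = 0 \<and> vertex_sign v j = 0")
    case True
    have nz: "i \<noteq> 0" "j \<noteq> 0" using ij by auto
    show ?thesis
    proof (rule signs_eqI[OF link_sign_values sign_mult_values[OF s link_sign_values]])
      fix e :: real assume e: "e \<in> signs"
      have "link_sign w i j = e \<longleftrightarrow> meets w e {i, j}"
        using meets_pair_iff[OF w nz ij(3) e] True r ij by simp
      also have "\<dots> \<longleftrightarrow> meets v (s * e) {i, j}"
        using ij by (intro m' e) auto
      also have "\<dots> \<longleftrightarrow> link_sign v i j = s * e"
        using meets_pair_iff[OF v nz ij(3) sign_mult_signs[OF s e]] True by simp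
      finally show "link_sign w i j = e \<longleftrightarrow> s * link_sign v i j = e"
        unfolding sign_mult_eq_iff[OF s] .
    qed
  next
    case False
    then show ?thesis using r ij s0 by (auto simp: link_sign_def)
  qed
  note ls = l[of 1 2, simplified] l[of 1 3, simplified] l[of 2 3, simplified]
  have "opposite_sign w = s * opposite_sign v"
  proof (cases "(\<forall>i\<in>{1, 2, 3}. vertex_sign v i = 0) \<and> link_sign v 1 2 = 0 \<and> link_sign v 1 3 = 0 \<and> link_sign v 2 3 = 0")
    case True
    then have zv: "\<forall>i\<in>{1, 2, 3}. vertex_sign v i = 0" "link_sign v 1 2 = 0" "link_sign v 1 3 = 0" "link_sign v 2 3 = 0"
      by blast+
    have zw: "\<forall>i\<in>{1, 2, 3}. vertex_sign w i = 0" "link_sign w 1 2 = 0" "link_sign w 1 3 = 0" "link_sign w 2 3 = 0"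
      using zv r ls by simp_all
    show ?thesis
    proof (rule signs_eqI[OF opposite_sign_values sign_mult_values[OF s opposite_sign_values]])
      fix e :: real assume e: "e \<in> signs"
      have "opposite_sign w = e \<longleftrightarrow> meets w e {1, 2, 3}"
        by (rule opposite_sign_iff[OF w zw e, symmetric])
      also have "\<dots> \<longleftrightarrow> meets v (s * e) {1, 2, 3}"
        by (intro m' e subset_refl)
      also have "\<dots> \<longleftrightarrow> opposite_sign v = s * e"
        by (rule opposite_sign_iff[OF v zv sign_mult_signs[OF s e]])
      finally show "opposite_sign w = e \<longleftrightarrow> s * opposite_sign v = e"
        unfolding sign_mult_eq_iff[OF s] .
    qed
  next
    case False
    then have "opposite_sign v = 0" unfolding opposite_sign_def by (rule if_not_P)
    moreover have "\<not> ((\<forall>i\<in>{1, 2, 3}. vertex_sign w i = 0) \<and> link_sign w 1 2 = 0 \<and> link_sign w 1 3 = 0 \<and> link_sign w 2 3 = 0)"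
      using False r ls s0 by simp
    then have "opposite_sign w = 0" unfolding opposite_sign_def by (rule if_not_P)
    ultimately show ?thesis by simp
  qed
  then show ?thesis
    using r ls by (simp add: signature_def)
qed

lemma homeomorphism_image_Int:
  assumes h: "homeomorphism S T h h'" and sub: "F \<subseteq> S" and L: "h ` (L \<inter> S) = L' \<inter> T" and F: "h ` F = F'"
  shows "L \<inter> F = {} \<longleftrightarrow> L' \<inter> F' = {}"
proof -
  have inj: "inj_on h S"
    by (rule inj_on_inverseI[of _ h']) (use h in \<open>simp add: homeomorphism_def\<close>)
  have "h ` (L \<inter> F) = h ` ((L \<inter> S) \<inter> F)"
    using sub by (intro arg_cong[of _ _ "\<lambda>A. h ` A"]) blast
  also have "\<dots> = h ` (L \<inter> S) \<inter> h ` F"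
    by (rule inj_on_image_Int[OF inj]) (use sub in auto)
  also have "\<dots> = L' \<inter> F'"
  proof -
    have "F' \<subseteq> T" using F sub h by (auto simp: homeomorphism_def)
    then show ?thesis unfolding L F by blast
  qed
  finally have eq: "h ` (L \<inter> F) = L' \<inter> F'" .
  show ?thesis
    unfolding image_is_empty[of h "L \<inter> F", symmetric] eq ..
qed

text \<open>Vertices are not null, so membership in the two time cones determines the sign.\<close>

lemma vertex_sign_transfer:
  assumes v: "admissible v" and w: "admissible w" and i: "i \<noteq> 0" and s: "s \<in> signs"
    and t: "\<And>e. e \<in> signs \<Longrightarrow> v i \<in> timecone e (v 0) \<longleftrightarrow> w i \<in> timecone (s * e) (w 0)"
  shows "vertex_sign w i = s * vertex_sign v i"
proof (rule signs_eqI[OF vertex_sign_values[OF w i] sign_mult_values[OF s vertex_sign_values[OF v i]]])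
  fix e :: real assume e: "e \<in> signs"
  note se = sign_mult_signs[OF s e]
  have ss: "s * (s * e) = e" using s by auto
  have "vertex_sign v i = s * e \<longleftrightarrow> vertex_sign w i = e"
    using t[OF se] timelike_vertex_iff[OF se, of v i] timelike_vertex_iff[OF e, of w i]
    unfolding ss timelike_vertex_def by blast
  then show "vertex_sign w i = e \<longleftrightarrow> s * vertex_sign v i = e"
    unfolding sign_mult_eq_iff[OF s] by blast
qed

lemma face_singleton: "face v {i} = {v i}"
  by (simp add: face_def)

lemma face_mono: "J \<subseteq> L \<Longrightarrow> face v J \<subseteq> face v L"
  unfolding face_def by (intro hull_mono image_mono)

lemma same_structure_signature:
  assumes v: "admissible v" and w: "admissible w" and s: "s \<in> signs" and st: "same_structure id s v w"
  shows "signature w = map ((*) s) (signature v)"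
proof -
  obtain h h' where h: "homeomorphism (solid v) (solid w) h h'"
    and f': "\<forall>J. h ` face v J = face w (id ` J)"
    and l': "\<forall>e\<in>signs. h ` (lightcone e (v 0) \<inter> solid v) = lightcone (s * e) (w 0) \<inter> solid w"
    and t': "\<forall>e\<in>signs. h ` (timecone e (v 0) \<inter> solid v) = timecone (s * e) (w 0) \<inter> solid w"
    using st unfolding same_structure_def by (elim exE conjE)
  have f: "h ` face v J = face w J" for J
    using spec[OF f', of J] unfolding image_id id_apply .
  note l = bspec[OF l'] and t = bspec[OF t']
  show ?thesis
  proof (rule matching_signature[OF v w s])
    show "meets w (s * e) J \<longleftrightarrow> meets v e J" if "e \<in> signs" for e J
    proof -
      have "lightcone e (v 0) \<inter> face v J = {} \<longleftrightarrow> lightcone (s * e) (w 0) \<inter> face w J = {}"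
        by (rule homeomorphism_image_Int[OF h face_mono[OF subset_UNIV] l[OF that] f])
      then show ?thesis by (simp add: meets_def)
    qed
    show "vertex_sign w i = s * vertex_sign v i" if "i \<in> {1, 2, 3}" for i
    proof (rule vertex_sign_transfer[OF v w _ s])
      show "i \<noteq> 0" using that by auto
      show "v i \<in> timecone e (v 0) \<longleftrightarrow> w i \<in> timecone (s * e) (w 0)" if "e \<in> signs" for e
      proof -
        have "timecone e (v 0) \<inter> {v i} = {} \<longleftrightarrow> timecone (s * e) (w 0) \<inter> {w i} = {}"
          unfolding face_singleton[symmetric]
          by (rule homeomorphism_image_Int[OF h face_mono[OF subset_UNIV] t[OF that] f])
        then show ?thesis by simp
      qed
    qed
  qed
qed

text \<open>The hypotheses determine the signature up to \<open>s\<close>, and the signature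
  determines the structure. The given homeomorphism of the triangles only tells which faces are met;
  it is not extended to the tetrahedra.\<close>

lemma same_positions_structure:
  assumes v: "admissible v" and w: "admissible w" and p: "relabelling p" and s: "s \<in> signs"
    and pos: "same_vertex_positions p s v w" and opp: "same_opposite_intersection p s v w"
  shows "same_structure p s v w"
proof -
  have w': "admissible (w \<circ> p)" by (rule admissible_comp[OF p w])
  have p0: "p 0 = 0" using p by (simp add: relabelling_def)
  have img: "p ` {1, 2, 3} = {1, 2, 3}"
    by (rule relabelling_cases[OF p]) auto
  obtain g g' where g: "homeomorphism (opposite v) (opposite w) g g'"
    and f': "\<forall>J. J \<subseteq> {1, 2, 3} \<longrightarrow> g ` face v J = face w (p ` J)"
    and l': "\<forall>e\<in>signs. g ` (lightcone e (v 0) \<inter> opposite v) = lightcone (s * e) (w 0) \<inter> opposite w"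
    using opp unfolding same_opposite_intersection_def by (elim exE conjE)
  note f = f'[rule_format] and l = bspec[OF l']
  have "signature (w \<circ> p) = map ((*) s) (signature v)"
  proof (rule matching_signature[OF v w' s])
    show "meets (w \<circ> p) (s * e) J \<longleftrightarrow> meets v e J" if "e \<in> signs" "J \<subseteq> {1, 2, 3}" for e J
    proof -
      have "lightcone e (v 0) \<inter> face v J = {} \<longleftrightarrow> lightcone (s * e) (w 0) \<inter> face w (p ` J) = {}"
        by (rule homeomorphism_image_Int[OF g face_mono[OF that(2)] l[OF that(1)] f[OF that(2)]])
      then show ?thesis unfolding comp_signs(2)[OF p] by (simp add: meets_def)
    qed
    show "vertex_sign (w \<circ> p) i = s * vertex_sign v i" if i: "i \<in> {1, 2, 3}" for i
    proof (rule vertex_sign_transfer[OF v w' _ s])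
      show "i \<noteq> 0" using i by auto
      show "v i \<in> timecone e (v 0) \<longleftrightarrow> (w \<circ> p) i \<in> timecone (s * e) ((w \<circ> p) 0)" if "e \<in> signs" for e
      proof -
        have "v i \<in> timecone e (v 0) \<longleftrightarrow> w (p i) \<in> timecone (s * e) (w 0)"
          using pos i that unfolding same_vertex_positions_def by blast
        then show ?thesis unfolding comp_def p0 .
      qed
    qed
  qed
  then show ?thesis
    unfolding same_structure_relabel[OF p] by (rule signature_same_structure[OF v w' s])
qed

section \<open>The type as a complete invariant\<close>

lemma classify_scale:
  assumes "s \<in> signs"
  shows "classify (s * r1) (s * r2) (s * r3) (s * m12) (s * m13) (s * m23) (s * f) =
    classify r1 r2 r3 m12 m13 m23 f"
proof -
  have "\<bar>s\<bar> = 1" "s \<noteq> 0" using assms by auto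
  then have a: "\<bar>s * x\<bar> = \<bar>x\<bar>" "s * f = 0 \<longleftrightarrow> f = 0" for x by (simp_all add: abs_mult)
  have "classify_sums p q a b c (s * f) = classify_sums p q a b c f" for p q a b c
    by (simp only: classify_sums_def a)
  then show ?thesis
    unfolding classify_def by (simp only: a(1) distrib_left[symmetric])
qed

lemma vertex_type_signature:
  assumes "s \<in> signs" "signature w = map ((*) s) (signature v)"
  shows "vertex_type w = vertex_type v"
  using assms classify_scale[OF assms(1)] by (simp add: signature_def vertex_type_def)

text \<open>Within one pattern all entries are fixed multiples of a single leading sign, so two
  instances differ by a common factor.\<close>

lemma sign_pattern_scale:
  assumes v: "valid_signs r1 r2 r3 m12 m13 m23 f" "valid_signs r1' r2' r3' m12' m13' m23' f'"
    and t: "sign_pattern t r1 r2 r3 m12 m13 m23 f" "sign_pattern t r1' r2' r3' m12' m13' m23' f'"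
  obtains s where "s \<in> signs"
    "[r1', r2', r3', m12', m13', m23', f'] = map ((*) s) [r1, r2, r3, m12, m13, m23, f]"
proof -
  have r: "r1 = 0 \<or> r1 = 1 \<or> r1 = - 1" "r1' = 0 \<or> r1' = 1 \<or> r1' = - 1"
    and m: "m12 = 0 \<or> m12 = 1 \<or> m12 = - 1" "m12' = 0 \<or> m12' = 1 \<or> m12' = - 1"
    and f: "f = 0 \<or> f = 1 \<or> f = - 1" "f' = 0 \<or> f' = 1 \<or> f' = - 1"
    using v by (simp_all add: valid_signs_def)
  have z: "r1 \<noteq> 0 \<Longrightarrow> m12 = 0 \<and> m13 = 0 \<and> f = 0" "r1 \<noteq> 0 \<Longrightarrow> r2 \<noteq> 0 \<Longrightarrow> m23 = 0" "m12 \<noteq> 0 \<Longrightarrow> f = 0"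
    "r1' \<noteq> 0 \<Longrightarrow> m12' = 0 \<and> m13' = 0 \<and> f' = 0" "r1' \<noteq> 0 \<Longrightarrow> r2' \<noteq> 0 \<Longrightarrow> m23' = 0" "m12' \<noteq> 0 \<Longrightarrow> f' = 0"
    using v by (simp_all add: valid_signs_def)
  \<comment> \<open>In each pattern at most one of \<open>r1\<close>, \<open>m12\<close>,
    \<open>f\<close> is nonzero, and this is the leading sign. The sum compares the two leading
    signs; for \<open>D1\<close> it is 0.\<close>
  define s where "s = (if r1 * r1' + m12 * m12' + f * f' \<ge> 0 then 1 else - 1 :: real)"
  have "[r1', r2', r3', m12', m13', m23', f'] = map ((*) s) [r1, r2, r3, m12, m13, m23, f]"
  proof (cases t)
    case A1 with t z r show ?thesis by (elim disjE; simp add: s_def)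
  next
    case A2 with t z r show ?thesis by (elim disjE; simp add: s_def)
  next
    case B1 with t z r show ?thesis by (elim disjE; simp add: s_def)
  next
    case B2 with t z r show ?thesis by (elim disjE; simp add: s_def)
  next
    case C1 with t z r show ?thesis by (elim disjE; simp add: s_def)
  next
    case C2 with t z r show ?thesis by (elim disjE; simp add: s_def)
  next
    case C3 with t z r show ?thesis by (elim disjE; simp add: s_def)
  next
    case D1 with t show ?thesis by simp
  next
    case D2 with t f show ?thesis by (elim disjE; simp add: s_def)
  next
    case D3 with t z m show ?thesis by (elim disjE; simp add: s_def)
  next
    case D4 with t z m show ?thesis by (elim disjE; simp add: s_def)
  next
    case D5 with t z m show ?thesis by (elim disjE; simp add: s_def)
  next
    case D6 with t z m valid_signs_opposite[OF v(1)] valid_signs_opposite[OF v(2)] show ?thesis by (elim disjE; simp add: s_def)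
  qed
  then show thesis using that[of s] by (auto simp: s_def)
qed

lemma same_causal_type_iff:
  assumes v: "admissible v" and w: "admissible w"
  shows "same_causal_type v w \<longleftrightarrow> vertex_type v = vertex_type w"
proof
  assume "same_causal_type v w"
  then obtain p s where p: "relabelling p" and s: "s \<in> signs" and st: "same_structure p s v w"
    unfolding same_causal_type_def by blast
  have "vertex_type (w \<circ> p) = vertex_type v"
    by (rule vertex_type_signature[OF s same_structure_signature[OF v admissible_comp[OF p w] s
          st[unfolded same_structure_relabel[OF p]]]])
  then show "vertex_type v = vertex_type w"
    using vertex_type_comp[OF w p] by simp
next
  assume eq: "vertex_type v = vertex_type w"
  obtain p where p: "relabelling p" "representative (vertex_type v) (v \<circ> p)"
    using has_type_iff[OF v] unfolding has_type_def by blast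
  obtain q where q: "relabelling q" "representative (vertex_type v) (w \<circ> q)"
    using has_type_iff[OF w] eq unfolding has_type_def by metis
  have vp: "admissible (v \<circ> p)" and wq: "admissible (w \<circ> q)"
    by (rule admissible_comp[OF p(1) v], rule admissible_comp[OF q(1) w])
  obtain s where s: "s \<in> signs" "signature (w \<circ> q) = map ((*) s) (signature (v \<circ> p))"
    unfolding signature_def
    by (rule sign_pattern_scale[OF admissible_valid_signs[OF vp] admissible_valid_signs[OF wq]
          p(2)[unfolded representative_iff[OF vp]] q(2)[unfolded representative_iff[OF wq]]])
  \<comment> \<open>Both tetrahedra are first brought to the labelling of the representative;
    \<open>v\<close> and \<open>w\<close> are then joined through these relabelled copies.\<close>
  have "same_causal_type (v \<circ> p) (w \<circ> q)"
    unfolding same_causal_type_def using s signature_same_structure[OF vp wq s]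
    by (intro exI[of _ id] exI[of _ s]) (simp add: relabelling_def)
  moreover have "same_causal_type (x \<circ> r) x" if "relabelling r" for x r
    unfolding same_causal_type_def using that same_structure_relabel[OF that, of 1 "x \<circ> r" x] same_structure_refl
    by (intro exI[of _ r] exI[of _ 1]) simp
  ultimately have "(v \<circ> p, w \<circ> q) \<in> causal_type_rel" "(v \<circ> p, v) \<in> causal_type_rel" "(w \<circ> q, w) \<in> causal_type_rel"
    using v w vp wq p(1) q(1) by (simp_all add: causal_type_rel_def)
  then have "(v, w) \<in> causal_type_rel"
    using equiv_causal_type_rel by (meson equivE symD transD)
  then show "same_causal_type v w" by (simp add: causal_type_rel_def)
qed

subsection \<open>A tetrahedron of every type\<close>

definition det3 :: "real^3 \<Rightarrow> real^3 \<Rightarrow> real^3 \<Rightarrow> real" where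
  "det3 a b c = a $ 1 * (b $ 2 * c $ 3 - b $ 3 * c $ 2) - a $ 2 * (b $ 1 * c $ 3 - b $ 3 * c $ 1)
     + a $ 3 * (b $ 1 * c $ 2 - b $ 2 * c $ 1)"

lemma det3_independent:
  assumes d: "det3 a b c \<noteq> 0" and z: "x *\<^sub>R a + y *\<^sub>R b + z *\<^sub>R c = 0"
  shows "x = 0" "y = 0" "z = 0"
proof -
  have e: "x * a $ i + y * b $ i + z * c $ i = 0" for i
    using arg_cong[OF z, of "\<lambda>v. v $ i"] by simp
  note e' = e[of 1] e[of 2] e[of 3]
  have "x * det3 a b c = 0" "y * det3 a b c = 0" "z * det3 a b c = 0"
    using e' unfolding det3_def by algebra+
  with d show "x = 0" "y = 0" "z = 0" by simp_all
qed

definition tet :: "real^3 \<Rightarrow> real^3 \<Rightarrow> real^3 \<Rightarrow> vertices" where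
  "tet a b c i = (if i = 1 then a else if i = 2 then b else if i = 3 then c else 0)"

lemma tet_simps [simp]: "tet a b c 0 = 0" "tet a b c 1 = a" "tet a b c 2 = b" "tet a b c 3 = c"
  by (simp_all add: tet_def)

lemma all_index4: "(\<forall>i::4. P i) \<longleftrightarrow> P 0 \<and> P 1 \<and> P 2 \<and> P 3"
  by (metis index4_cases)

lemma tetrahedron_tet:
  assumes d: "det3 a b c \<noteq> 0"
  shows "tetrahedron (tet a b c)"
proof -
  note ind = det3_independent[OF d]
  have ne: "a \<noteq> 0" "b \<noteq> 0" "c \<noteq> 0" "a \<noteq> b" "a \<noteq> c" "b \<noteq> c"
    using ind(1)[of 1 0 0] ind(2)[of 0 1 0] ind(3)[of 0 0 1] ind(1)[of 1 "- 1" 0]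
      ind(1)[of 1 0 "- 1"] ind(2)[of 0 1 "- 1"] by auto
  have inj: "inj (tet a b c)"
    unfolding inj_def all_index4 using ne by auto
  have "\<not> affine_dependent (range (tet a b c))"
  proof
    assume "affine_dependent (range (tet a b c))"
    then obtain U where U: "sum U (range (tet a b c)) = 0" "\<exists>x\<in>range (tet a b c). U x \<noteq> 0"
      "(\<Sum>x\<in>range (tet a b c). U x *\<^sub>R x) = 0"
      unfolding affine_dependent_explicit_finite[OF finite_imageI[OF finite]] by blast
    have "U a *\<^sub>R a + U b *\<^sub>R b + U c *\<^sub>R c = 0"
      using U(3) by (simp add: sum.reindex[OF inj] sum_index4)
    then have "U a = 0" "U b = 0" "U c = 0" by (rule ind)+
    moreover from this have "U 0 = 0"
      using U(1) by (simp add: sum.reindex[OF inj] sum_index4)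
    ultimately show False
      using U(2) unfolding bex_simps(7)[of U] by (auto simp: tet_def)
  qed
  with inj show ?thesis by (simp add: tetrahedron_def)
qed

lemma sq_area_permute: "sq_area a b c = sq_area b a c" "sq_area a b c = sq_area a c b"
  by (simp_all add: sq_area_def mink_diff mink_commute[of b a] mink_commute[of c a] mink_commute[of c b]
      power2_eq_square algebra_simps)

text \<open>With the apex at the origin, admissibility reduces to finitely many numerical
  inequalities; the other orders of the labels give the same lengths and areas.\<close>

lemma admissible_tet:
  assumes d: "det3 a b c \<noteq> 0" and q: "mink a a \<noteq> 0" "mink b b \<noteq> 0" "mink c c \<noteq> 0"
    and l: "mink (b - a) (b - a) \<noteq> 0" "mink (c - a) (c - a) \<noteq> 0" "mink (c - b) (c - b) \<noteq> 0"
    and g: "gram a b \<noteq> 0" "gram a c \<noteq> 0" "gram b c \<noteq> 0" "gram (b - a) (c - a) \<noteq> 0"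
  shows "admissible (tet a b c)"
proof -
  have sl: "sq_length x y = sq_length y x" for x y
    by (simp add: sq_length_def mink_def algebra_simps)
  have l': "sq_length 0 a \<noteq> 0" "sq_length 0 b \<noteq> 0" "sq_length 0 c \<noteq> 0"
    "sq_length a b \<noteq> 0" "sq_length a c \<noteq> 0" "sq_length b c \<noteq> 0"
    using q l by (simp_all add: sq_length_def)
  have "no_null_edges (tet a b c)"
    unfolding no_null_edges_def all_index4
    using l' sl[of a 0] sl[of b 0] sl[of c 0] sl[of b a] sl[of c a] sl[of c b] by simp
  moreover have "no_null_faces (tet a b c)"
  proof -
    have A: "sq_area 0 a b \<noteq> 0" "sq_area 0 a c \<noteq> 0" "sq_area 0 b c \<noteq> 0" "sq_area a b c \<noteq> 0"
      using g by (simp_all add: sq_area_def gram_def)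
    have perm: "sq_area x y z \<noteq> 0 \<Longrightarrow> sq_area x z y \<noteq> 0 \<and> sq_area y x z \<noteq> 0 \<and> sq_area y z x \<noteq> 0 \<and>
        sq_area z x y \<noteq> 0 \<and> sq_area z y x \<noteq> 0" for x y z
      by (metis sq_area_permute)
    show ?thesis
      unfolding no_null_faces_def all_index4
      using A perm[OF A(1)] perm[OF A(2)] perm[OF A(3)] perm[OF A(4)] by simp
  qed
  ultimately show ?thesis
    using tetrahedron_tet[OF d] by (simp add: admissible_def)
qed

text \<open>One timelike vector in the cone over the edge is enough, because the rank there is
  always 0, the link sign or twice the link sign.\<close>

lemma link_sign_witness:
  assumes v: "admissible v" and ij: "i \<noteq> 0" "j \<noteq> 0" "i \<noteq> j"
    and z: "vertex_sign v i = 0" "vertex_sign v j = 0" and e: "e \<in> signs"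
    and xy: "0 \<le> x" "0 \<le> y" "causal_rank (x *\<^sub>R (v i - v 0) + y *\<^sub>R (v j - v 0)) = 2 * e"
  shows "link_sign v i j = e"
proof -
  let ?X = "v i - v 0" and ?Y = "v j - v 0"
  have "causal_rank ?X = 0" "causal_rank ?Y = 0"
    using z by (simp_all add: vertex_sign_def)
  then have pos: "mink ?X ?X > 0" "mink ?Y ?Y > 0"
    using admissible_vertex[OF v ij(1)] admissible_vertex[OF v ij(2)]
    by (auto simp: causal_rank_eq_0_iff)
  have l: "link_sign v i j = edge_sign ?X ?Y"
    using z by (simp add: link_sign_def edge_sign_meeting)
  obtain lo hi where P: "edge_pattern ?X ?Y (0, link_sign v i j, - link_sign v i j) lo hi"
    unfolding l by (rule edge_pattern_spacelike[OF pos admissible_pair[OF v ij]])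
  have "x + y > 0"
  proof (rule ccontr)
    assume "\<not> x + y > 0"
    then have "x = 0" "y = 0" using xy by auto
    then show False using xy(3) e by auto
  qed
  from edge_pattern_cone[OF P xy(1,2) this]
  have "2 * e = link_sign v i j * (sgn (y - lo * (x + y)) - sgn (y - hi * (x + y)))"
    using xy(3) by (simp add: right_diff_distrib)
  moreover have "sgn (y - hi * (x + y)) \<le> sgn (y - lo * (x + y))"
  proof -
    have "lo * (x + y) \<le> hi * (x + y)"
      using P xy by (intro mult_right_mono) (auto simp: edge_pattern_def)
    then show ?thesis by (simp add: sgn_real_def)
  qed
  moreover have "link_sign v i j \<in> {0, 1, - 1}" by (rule link_sign_values)
  ultimately show ?thesis
    using e by (auto simp: sgn_real_def split: if_splits)
qed

lemma mink_combination:
  "mink X X * mink (x *\<^sub>R X + y *\<^sub>R Y) (x *\<^sub>R X + y *\<^sub>R Y) =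
    (x * mink X X + y * mink X Y)\<^sup>2 + y\<^sup>2 * gram X Y"
  by (simp add: mink_add mink_scale mink_commute[of Y X] gram_def power2_eq_square algebra_simps)

text \<open>A plane with positive Gram determinant and a spacelike vector is positive definite, so
  it contains no null direction.\<close>

lemma link_sign_spacelike_plane:
  assumes v: "admissible v" and g: "gram (v i - v 0) (v j - v 0) > 0"
  shows "link_sign v i j = 0"
proof (rule ccontr)
  let ?X = "v i - v 0" and ?Y = "v j - v 0"
  assume n: "link_sign v i j \<noteq> 0"
  then have z: "vertex_sign v i = 0" by (auto simp: link_sign_def split: if_splits)
  have q: "mink ?X ?X > 0"
  proof -
    have "?X \<noteq> 0" using g by (auto simp: gram_def)
    then show ?thesis using z by (auto simp: vertex_sign_def causal_rank_eq_0_iff)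
  qed
  have es: "edge_sign ?X ?Y = link_sign v i j"
    using n by (auto simp: link_sign_def edge_sign_meeting split: if_splits)
  obtain t where t: "causal_rank ((1 - t) *\<^sub>R ?X + t *\<^sub>R ?Y) = link_sign v i j"
    using edge_sign_attained[OF es n] by blast
  let ?Z = "(1 - t) *\<^sub>R ?X + t *\<^sub>R ?Y"
  have "\<bar>causal_rank ?Z\<bar> = 1" using t n link_sign_values[of v i j] by auto
  then have Z: "mink ?Z ?Z = 0" "?Z \<noteq> 0"
    by (simp_all add: causal_rank_null_iff)
  have "mink ?X ?X * mink ?Z ?Z = ((1 - t) * mink ?X ?X + t * mink ?X ?Y)\<^sup>2 + t\<^sup>2 * gram ?X ?Y"
    by (rule mink_combination)
  then have 0: "((1 - t) * mink ?X ?X + t * mink ?X ?Y)\<^sup>2 + t\<^sup>2 * gram ?X ?Y = 0"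
    using Z(1) by simp
  moreover have "t\<^sup>2 * gram ?X ?Y \<ge> 0" using g by simp
  ultimately have "t\<^sup>2 * gram ?X ?Y = 0" "((1 - t) * mink ?X ?X + t * mink ?X ?Y)\<^sup>2 = 0"
    by (smt (verit) zero_le_power2)+
  then have "t = 0" "(1 - t) * mink ?X ?X + t * mink ?X ?Y = 0" using g by simp_all
  then show False using q by simp
qed

lemma opposite_sign_witness:
  assumes v: "admissible v" and z: "\<forall>i\<in>{1, 2, 3}. vertex_sign v i = 0"
    and l: "link_sign v 1 2 = 0" "link_sign v 1 3 = 0" "link_sign v 2 3 = 0"
    and a: "a \<in> orthant" "causal_rank (comb (apex_frame v) a) \<noteq> 0"
  shows "opposite_sign v \<noteq> 0"
proof
  assume "opposite_sign v = 0"
  then have "face_sign (apex_frame v) = 0"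
    using z l by (simp add: opposite_sign_def face_sign_meeting[OF v])
  moreover have "causal_rank (apex_frame v 1) = 0"
    using z by (simp add: apex_frame_def vertex_sign_def)
  ultimately show False
    using no_null_imp_spacelike[OF admissible_frame[OF v] _ _ a(1)] a(2) by blast
qed

lemma opposite_sign_none:
  assumes v: "admissible v" and a: "\<And>a. a \<in> orthant \<Longrightarrow> causal_rank (comb (apex_frame v) a) = 0"
  shows "opposite_sign v = 0"
proof -
  have "\<not> meets v e {1, 2, 3}" if "e \<in> signs" for e
    unfolding meets_opposite[OF v that] using a that by fastforce
  then show ?thesis by (simp add: opposite_sign_def meeting_sign_def)
qed

lemma vertex_type_pattern:
  assumes v: "admissible v"
    and s: "sign_pattern t (vertex_sign v 1) (vertex_sign v 2) (vertex_sign v 3)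
      (link_sign v 1 2) (link_sign v 1 3) (link_sign v 2 3) (opposite_sign v)"
  shows "\<exists>v. admissible v \<and> vertex_type v = t"
  using v sign_pattern_classify[OF admissible_valid_signs[OF v] s] by (auto simp: vertex_type_def)

lemmas numeric = mink_def gram_def det3_def vertex_sign_def causal_rank_def power2_eq_square

lemma comb_tet: "comb (apex_frame (tet a b c)) x = x $ 1 *\<^sub>R a + x $ 2 *\<^sub>R b + x $ 3 *\<^sub>R c"
  by (simp add: comb_def sum_3 apex_frame_def)

text \<open>In the plane \<open>x$1 = r\<close> the future light cone of the origin cuts out the circle of radius \<open>r\<close>, so
  that most of the types are realised by a triangle and a circle in the plane.\<close>

lemma vertex_type_surj: "\<exists>v. admissible v \<and> vertex_type v = t"
proof (cases t)
  case A1
  let ?v = "tet (vector [2, 0, 0]) (vector [2, 1, 0]) (vector [2, 0, 1])"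
  have v: "admissible ?v" by (rule admissible_tet) (simp_all add: numeric)
  show ?thesis by (rule vertex_type_pattern[OF v]) (simp add: A1 numeric)
next
  case A2
  let ?v = "tet (vector [2, 0, 0]) (vector [2, 1, 0]) (vector [- 2, 0, 1])"
  have v: "admissible ?v" by (rule admissible_tet) (simp_all add: numeric)
  show ?thesis by (rule vertex_type_pattern[OF v]) (simp add: A2 numeric)
next
  case B1
  let ?v = "tet (vector [2, 0, 0]) (vector [2, 1, 0]) (vector [2, 0, 3])"
  have v: "admissible ?v" by (rule admissible_tet) (simp_all add: numeric)
  show ?thesis by (rule vertex_type_pattern[OF v]) (simp add: B1 numeric)
next
  case B2
  let ?v = "tet (vector [2, 0, 0]) (vector [- 2, 1, 0]) (vector [0, 0, 1])"
  have v: "admissible ?v" by (rule admissible_tet) (simp_all add: numeric)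
  show ?thesis by (rule vertex_type_pattern[OF v]) (simp add: B2 numeric)
next
  case C1
  let ?v = "tet (vector [2, 0, 0]) (vector [2, 3, 0]) (vector [2, 3, 3])"
  have v: "admissible ?v" by (rule admissible_tet) (simp_all add: numeric)
  have "link_sign ?v 2 3 = 0" by (rule link_sign_spacelike_plane[OF v]) (simp add: numeric)
  then show ?thesis by (intro vertex_type_pattern[OF v]) (simp add: C1 numeric)
next
  case C2
  let ?v = "tet (vector [2, 0, 0]) (vector [2, 3, 1]) (vector [2, - 3, 1])"
  have v: "admissible ?v" by (rule admissible_tet) (simp_all add: numeric)
  have "link_sign ?v 2 3 = 1"
    by (rule link_sign_witness[OF v, of 2 3 1 1 1]) (simp_all add: numeric)
  then show ?thesis by (intro vertex_type_pattern[OF v]) (simp add: C2 numeric)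
next
  case C3
  let ?v = "tet (vector [2, 0, 0]) (vector [- 2, 3, 1]) (vector [- 2, - 3, 1])"
  have v: "admissible ?v" by (rule admissible_tet) (simp_all add: numeric)
  have "link_sign ?v 2 3 = - 1"
    by (rule link_sign_witness[OF v, of 2 3 "- 1" 1 1]) (simp_all add: numeric)
  then show ?thesis by (intro vertex_type_pattern[OF v]) (simp add: C3 numeric)
next
  case D1
  let ?v = "tet (vector [0, 1, 0]) (vector [0, 0, 1]) (vector [1, 2, 2])"
  have v: "admissible ?v" by (rule admissible_tet) (simp_all add: numeric)
  have l: "link_sign ?v 1 2 = 0" "link_sign ?v 1 3 = 0" "link_sign ?v 2 3 = 0"
    by (rule link_sign_spacelike_plane[OF v], simp add: numeric)+
  have "opposite_sign ?v = 0"
  proof (rule opposite_sign_none[OF v])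
    fix a :: "real^3" assume a: "a \<in> orthant"
    define X where "X = comb (apex_frame ?v) a"
    have n: "0 \<le> a $ i" for i using a by (simp add: orthant_def)
    have x: "X $ 1 = a $ 3" "X $ 2 = a $ 1 + 2 * a $ 3" "X $ 3 = a $ 2 + 2 * a $ 3"
      by (simp_all add: X_def comb_tet)
    \<comment> \<open>In the orthant \<open>X $ 1 \<le> X $ 2\<close> with both nonnegative, so the
      form is at least the square of the remaining coordinate.\<close>
    have "(X $ 1)\<^sup>2 \<le> (X $ 2)\<^sup>2"
      unfolding x using n[of 1] n[of 3] by (intro power_mono) auto
    then have "mink X X \<ge> (X $ 3)\<^sup>2"
      by (simp add: mink_def power2_eq_square)
    moreover have "a = 0" if 3: "X $ 3 = 0" and q: "mink X X = 0"
    proof -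
      have "a $ 2 = 0" "a $ 3 = 0" using 3 n[of 2] n[of 3] unfolding x by linarith+
      moreover from this have "a $ 1 = 0" using q unfolding mink_def x by simp
      ultimately show "a = 0" by (simp add: vec3_eq_iff)
    qed
    moreover have "(X $ 3)\<^sup>2 > 0" if "X $ 3 \<noteq> 0"
      using that by simp
    moreover have "(X $ 3)\<^sup>2 \<ge> 0"
      by simp
    ultimately have "mink X X > 0 \<or> a = 0"
      by linarith
    then show "causal_rank (comb (apex_frame ?v) a) = 0"
      unfolding X_def[symmetric] causal_rank_eq_0_iff by (auto simp: X_def)
  qed
  with l show ?thesis by (intro vertex_type_pattern[OF v]) (simp add: D1 numeric)
next
  case D2
  let ?v = "tet (vector [1, 4, 0]) (vector [1, - 3, 4]) (vector [1, - 3, - 4])"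
  have v: "admissible ?v" by (rule admissible_tet) (simp_all add: numeric)
  have l: "link_sign ?v 1 2 = 0" "link_sign ?v 1 3 = 0" "link_sign ?v 2 3 = 0"
    by (rule link_sign_spacelike_plane[OF v], simp add: numeric)+
  \<comment> \<open>The weights 6, 4, 4 cancel the spatial parts; they represent a multiple of the
    centre of the circle.\<close>
  have "opposite_sign ?v \<noteq> 0"
    by (rule opposite_sign_witness[OF v _ l, of "vector [6, 4, 4]"])
      (simp_all add: numeric comb_tet orthant_def forall_3)
  with l show ?thesis by (intro vertex_type_pattern[OF v]) (simp add: D2 numeric)
next
  case D3
  let ?v = "tet (vector [2, 3, 1]) (vector [2, - 3, 1]) (vector [2, 0, 5])"
  have v: "admissible ?v" by (rule admissible_tet) (simp_all add: numeric)
  have "link_sign ?v 1 3 = 0" "link_sign ?v 2 3 = 0"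
    by (rule link_sign_spacelike_plane[OF v], simp add: numeric)+
  moreover have "link_sign ?v 1 2 = 1"
    by (rule link_sign_witness[OF v, of 1 2 1 1 1]) (simp_all add: numeric)
  ultimately show ?thesis by (intro vertex_type_pattern[OF v]) (simp add: D3 numeric)
next
  case D4
  let ?v = "tet (vector [1, 0, - 2]) (vector [1, - 1, 4]) (vector [1, 1, 4])"
  have v: "admissible ?v" by (rule admissible_tet) (simp_all add: numeric)
  have "link_sign ?v 2 3 = 0" by (rule link_sign_spacelike_plane[OF v]) (simp add: numeric)
  \<comment> \<open>The weights 2 and 1 cancel the last coordinate and leave the timelike vector (3,
    -1, 0); the edge to the third vertex is its mirror image.\<close>
  moreover have "link_sign ?v 1 2 = 1"
    by (rule link_sign_witness[OF v, of 1 2 1 2 1]) (simp_all add: numeric)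
  moreover have "link_sign ?v 1 3 = 1"
    by (rule link_sign_witness[OF v, of 1 3 1 2 1]) (simp_all add: numeric)
  ultimately show ?thesis by (intro vertex_type_pattern[OF v]) (simp add: D4 numeric)
next
  case D5
  let ?v = "tet (vector [2, 3, 0]) (vector [2, - 1, 3]) (vector [2, - 1, - 3])"
  have v: "admissible ?v" by (rule admissible_tet) (simp_all add: numeric)
  have "link_sign ?v 1 2 = 1"
    by (rule link_sign_witness[OF v, of 1 2 1 1 1]) (simp_all add: numeric)
  moreover have "link_sign ?v 1 3 = 1"
    by (rule link_sign_witness[OF v, of 1 3 1 1 1]) (simp_all add: numeric)
  moreover have "link_sign ?v 2 3 = 1"
    by (rule link_sign_witness[OF v, of 2 3 1 1 1]) (simp_all add: numeric)
  ultimately show ?thesis by (intro vertex_type_pattern[OF v]) (simp add: D5 numeric)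
next
  case D6
  \<comment> \<open>This triangle is not in a plane of constant time: reflection in time fixes its
    first vertex and exchanges the other two. The weights 5 and 3 below cancel the second coordinate
    on both edges.\<close>
  let ?v = "tet (vector [0, 3, 0]) (vector [4, - 5, 1]) (vector [- 4, - 5, 1])"
  have v: "admissible ?v" by (rule admissible_tet) (simp_all add: numeric)
  have "link_sign ?v 1 2 = 1"
    by (rule link_sign_witness[OF v, of 1 2 1 5 3]) (simp_all add: numeric)
  moreover have "link_sign ?v 1 3 = - 1"
    by (rule link_sign_witness[OF v, of 1 3 "- 1" 5 3]) (simp_all add: numeric)
  ultimately show ?thesis by (intro vertex_type_pattern[OF v]) (simp add: D6 numeric)
qed

section \<open>Counting the classes\<close>

lemma card_causal_type: "card (UNIV :: causal_type set) = 13"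
proof -
  have U: "(UNIV :: causal_type set) = {A1, A2, B1, B2, C1, C2, C3, D1, D2, D3, D4, D5, D6}"
    using causal_type.exhaust by auto
  show ?thesis unfolding U by simp
qed

text \<open>The classes are the fibres of \<open>vertex_type\<close>, which takes every value of
  \<open>causal_type\<close>.\<close>

lemma card_causal_classes: "card ({v. admissible v} // causal_type_rel) = 13"
proof -
  define cls where "cls t = {v. admissible v \<and> vertex_type v = t}" for t
  have img: "causal_type_rel `` {v} = cls (vertex_type v)" if "admissible v" for v
    using that by (auto simp: causal_type_rel_def cls_def same_causal_type_iff)
  have "{v. admissible v} // causal_type_rel = range cls"
  proof
    show "{v. admissible v} // causal_type_rel \<subseteq> range cls"
      by (auto simp: quotient_def img)
    show "range cls \<subseteq> {v. admissible v} // causal_type_rel"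
    proof
      fix X assume "X \<in> range cls"
      then obtain t where t: "X = cls t" by blast
      obtain v where "admissible v" "vertex_type v = t" using vertex_type_surj by blast
      then show "X \<in> {v. admissible v} // causal_type_rel"
        using img[of v] by (auto simp: quotient_def t)
    qed
  qed
  moreover have "inj cls"
  proof (rule injI)
    fix t u assume eq: "cls t = cls u"
    obtain v where "admissible v" "vertex_type v = t" using vertex_type_surj by blast
    then have "v \<in> cls u" using eq by (auto simp: cls_def)
    then show "t = u" using \<open>vertex_type v = t\<close> by (simp add: cls_def)
  qed
  ultimately show ?thesis
    using card_image[of cls UNIV] by (simp add: card_causal_type)
qed

theorem proposition4:
  shows
    "(\<forall>v w p s. admissible v \<and> admissible w \<and> relabelling p \<and> s \<in> signs \<and>
        same_vertex_positions p s v w \<and> same_opposite_intersection p s v w \<longrightarrow>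
        same_structure p s v w) \<and>
     card ({v. admissible v} // causal_type_rel) = 13 \<and>
     (\<forall>v. admissible v \<longrightarrow> (\<exists>!t. has_type t v)) \<and>
     (\<forall>t. \<exists>v. admissible v \<and> has_type t v) \<and>
     (\<forall>v w. admissible v \<and> admissible w \<longrightarrow>
        (same_causal_type v w \<longleftrightarrow> (\<exists>t. has_type t v \<and> has_type t w)))"
proof (intro conjI allI impI)
  show "same_structure p s v w"
    if "admissible v \<and> admissible w \<and> relabelling p \<and> s \<in> signs \<and>
      same_vertex_positions p s v w \<and> same_opposite_intersection p s v w" for v w p s
    using that by (elim conjE) (rule same_positions_structure)
  show "card ({v. admissible v} // causal_type_rel) = 13"
    by (rule card_causal_classes)
  show "\<exists>!t. has_type t v" if "admissible v" for v
    by (simp add: has_type_iff[OF that])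
  show "\<exists>v. admissible v \<and> has_type t v" for t
    using vertex_type_surj[of t] has_type_iff by blast
  show "same_causal_type v w \<longleftrightarrow> (\<exists>t. has_type t v \<and> has_type t w)"
    if "admissible v \<and> admissible w" for v w
    using that by (auto simp: has_type_iff same_causal_type_iff)
qed

end
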